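(* Let $f(Z)=\sum_{i=1}^d \alpha_i Z^i\in\mathbb{R}[Z]$ be any polynomial of degree $d\ge 3$, and let $a,q$ be integers with $q\ge 1$, $\gcd(a,q)=1$ and $$\left|\alpha_d-\frac aq\right|<\frac1{q^2}.$$ Let $m$ and $\ell$ be positive integers and let $k\in\{0,\ldots,m-1\}$. Then $$|U_f(r,\ell,k,m)|\le 2^{(1+o(1))r}\left(\ell^{\eta_1(d)}q^{-\eta_1(d)}+\ell^{\vartheta(d)}2^{-\zeta_1(d)r}+2^{-\zeta_2(d)r}+2^{-\zeta_3(d)r}q^{\eta_2(d)}\right)^{1/2}$$ as $r\to\infty$, where $$\eta_1(d)=\frac1{d^2-2d+2},\qquad \eta_2(d)=\frac1{(d-1)^2},\qquad \vartheta(d)=\frac1{d(d-1)},$$ $$\zeta_1(d)=\frac{d-2}{d(d-1)},\qquad \zeta_2(d)=\frac1{d^2-3d+3},\qquad \zeta_3(d)=\frac1{d-1}.$$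
   Context: Let $\mathbf{e}(z)=\exp(2\pi i z)$, and let $\sigma(n)$ denote the sum of the binary digits of the nonnegative integer $n$. For positive integers $r,m$ and $k\in\{0,\ldots,m-1\}$ put $$\mathcal{E}_{k,m}(r)=\{0\le n<2^r:\ \sigma(n)\equiv k \pmod m\},\qquad U_f(r,\ell,k,m)=\sum_{n\in\mathcal{E}_{k,m}(r)}\mathbf{e}(\ell f(n)).$$ The notation $o(1)$ means: for every $\varepsilon>0$ there is $r_0$, depending only on $\varepsilon$, $d$ and $m$ (and not on $f,a,q,\ell,k$), such that for all $r\ge r_0$ the bound holds with $o(1)$ replaced by $\varepsilon$. *)

theory Defs
  imports Complex_Main "HOL-Computational_Algebra.Polynomial" "HOL-Number_Theory.Cong"
begin

definition e :: "real \<Rightarrow> complex"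
  where "e z = exp (2 * of_real pi * \<i> * of_real z)"

fun bin_digit_sum :: "nat \<Rightarrow> nat"
  where "bin_digit_sum n = (if n = 0 then 0 else n mod 2 + bin_digit_sum (n div 2))"

declare bin_digit_sum.simps [simp del]

definition E_set :: "nat \<Rightarrow> nat \<Rightarrow> nat \<Rightarrow> nat set"
  where "E_set k m r = {n. n < 2 ^ r \<and> [bin_digit_sum n = k] (mod m)}"

definition U_sum :: "real poly \<Rightarrow> nat \<Rightarrow> nat \<Rightarrow> nat \<Rightarrow> nat \<Rightarrow> complex"
  where "U_sum f r l k m = (\<Sum>n\<in>E_set k m r. e (real l * poly f (real n)))"

definition eta1 :: "nat \<Rightarrow> real"
  where "eta1 d = 1 / ((real d)\<^sup>2 - 2 * real d + 2)"

definition eta2 :: "nat \<Rightarrow> real"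
  where "eta2 d = 1 / (real d - 1)\<^sup>2"

definition vartheta :: "nat \<Rightarrow> real"
  where "vartheta d = 1 / (real d * (real d - 1))"

definition zeta1 :: "nat \<Rightarrow> real"
  where "zeta1 d = (real d - 2) / (real d * (real d - 1))"

definition zeta2 :: "nat \<Rightarrow> real"
  where "zeta2 d = 1 / ((real d)\<^sup>2 - 3 * real d + 3)"

definition zeta3 :: "nat \<Rightarrow> real"
  where "zeta3 d = 1 / (real d - 1)"

end

theory Submission
  imports Defs "HOL-Analysis.Analysis"
begin

text \<open>
  Split the binary digits: \<open>n = v + 2^t u\<close> with \<open>v < H = 2^t\<close>, so that the digit sum is additive and the
  condition modulo \<open>m\<close> only correlates the classes of \<open>u\<close> and \<open>v\<close>. After the Cauchy-Schwarz inequality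
  in \<open>u\<close>, the digit condition on \<open>u\<close> disappears and one is left with complete Weyl sums over
  \<open>u < N = 2^(r-t)\<close> of the polynomials \<open>f(v + H u) - f(w + H u)\<close>, of degree \<open>d - 1\<close> and with leading
  coefficient \<open>d H^(d-1) (v - w)\<close> times that of \<open>f\<close>. Vinogradov's method bounds them through the optimal
  mean value theorem in degree \<open>d - 2\<close>, and \<open>H\<close> is chosen to balance the diagonal with the Weyl bound.

  The mean value theorem comes from a \<open>p\<close>-adic decoupling inequality, proved by induction on the
  degree \<open>k\<close> in the manner of Wooley's nested efficient congruencing and of the proof of decoupling
  for the moment curve by Guo, Li, Yung and Zorin-Kranich. On residue classes \<open>xi\<close> modulo \<open>p^a\<close> and
  \<open>eta\<close> modulo \<open>p^b\<close> that differ modulo \<open>p\<close>, one studies the means of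
  \<open>|f_xi|^(l(l+1)) |f_eta|^(k(k+1)-l(l+1))\<close>. There are \<open>l\<close> directions in which \<open>f_eta\<close> is constant at scale
  \<open>p^((k-l+1)b)\<close> whereas \<open>f_xi\<close> traces a nondegenerate curve in \<open>l\<close> dimensions, so that decoupling in
  degree \<open>l < k\<close> refines \<open>xi\<close>. Hoelder's inequality then passes to the exponents \<open>k - l\<close>
  (with the two classes interchanged) and \<open>l - 1\<close>. Iterating this gains more than the loss incurred
  by passing to separated classes.
\<close>

section \<open>Means of exponential sums modulo a prime power\<close>

text \<open>Working modulo \<open>p^(k*n)\<close> makes the analysis exact: the absolute value of a
  sum over a class really is constant in the directions that do not see the class, and averages
  along frequency shifts need neither cutoffs nor tails. The prime must be large in terms of the
  exponent to be lost: each passage from scale n - 1 to n costs a factor \<open>2^P\<close>, which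
  has to stay below a fixed part of \<open>p^\<eta>\<close>.

  The degree drops twice before the mean value theorem enters: differencing removes the top
  coefficient, and a shift of the variable in degree d - 1 leaves the top coefficient unchanged, so
  only powers up to d - 2 are counted.

  The exponents of the theorem come from the balance. The Weyl bound takes a root of order
  (d-1)(d-2), so each of its terms \<open>u * H^n\<close>, with H about 1 / Delta, must be at most
  Delta^((d-1)(d-2)). This asks for u below Delta^(n + (d-1)(d-2)); the reciprocals of the four
  exponents are eta1, zeta2, vartheta and eta2.\<close>

lemma e_add: "e (x + y) = e x * e y"
  by (simp add: e_def exp_add[symmetric] algebra_simps)

lemma e_zero [simp]: "e 0 = 1"
  by (simp add: e_def)

lemma norm_e [simp]: "norm (e x) = 1"
  by (simp add: e_def norm_exp_eq_Re)

lemma e_of_int [simp]: "e (of_int n) = 1"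
proof -
  have "e (of_int n) = exp (of_int (2 * n) * (of_real pi * \<i>))"
    by (simp add: e_def algebra_simps)
  also have "\<dots> = 1"
    using exp_integer_2pi[of "of_int n"] by (simp add: algebra_simps)
  finally show ?thesis .
qed

lemma e_add_int [simp]: "e (x + of_int n) = e x"
  by (simp add: e_add)

lemma cnj_e [simp]: "cnj (e x) = e (- x)"
  by (simp add: e_def exp_cnj)

lemma e_diff: "e (x - y) = e x * cnj (e y)"
  using e_add[of x "- y"] by simp

lemma e_sum: "e (\<Sum>i\<in>I. f i) = (\<Prod>i\<in>I. e (f i))"
  by (induction I rule: infinite_finite_induct) (auto simp: e_add)

lemma e_power: "e x ^ n = e (real n * x)"
  by (induction n) (auto simp: e_add algebra_simps)

lemma e_eq_1_iff: "e x = 1 \<longleftrightarrow> x \<in> \<int>"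
proof
  assume "e x = 1"
  then obtain n :: int where "2 * pi * x = of_int (2 * n) * pi"
    by (auto simp: e_def exp_eq_1)
  then have "x = of_int n" by simp
  then show "x \<in> \<int>" by simp
qed (auto elim!: Ints_cases)

lemma e_cong:
  assumes "Q > 0" "[a = b] (mod Q)"
  shows "e (of_int a / of_int Q) = e (of_int b / of_int Q)"
proof -
  obtain t where t: "a = b + Q * t"
    using cong_sym[OF assms(2)] by (auto simp: cong_iff_lin)
  have "of_int a / of_int Q = (of_int b / of_int Q + of_int t :: real)"
    using assms(1) by (simp add: t field_simps)
  then show ?thesis by (metis e_add_int)
qed

lemma sum_e_residues:
  assumes "Q > 0"
  shows "(\<Sum>a\<in>{0..<Q}. e (of_int (a * n) / of_int Q)) = (if Q dvd n then of_int Q else 0)"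
proof -
  define z where "z = e (of_int n / of_int Q)"
  have eq: "(\<Sum>a\<in>{0..<Q}. e (of_int (a * n) / of_int Q)) = (\<Sum>i<nat Q. z ^ i)"
    unfolding z_def e_power using assms
    by (intro sum.reindex_bij_witness[where i = int and j = nat]) auto
  show ?thesis
  proof (cases "Q dvd n")
    case True
    then have "z = 1" using assms by (auto simp: z_def)
    then show ?thesis using True eq assms by simp
  next
    case False
    have "z \<noteq> 1"
    proof
      assume "z = 1"
      then obtain t :: int where "of_int n / of_int Q = (of_int t :: real)"
        unfolding z_def e_eq_1_iff by (auto elim: Ints_cases)
      then have "of_int n = (of_int (Q * t) :: real)" using assms by (simp add: field_simps)
      then have "n = Q * t" by (simp only: of_int_eq_iff)
      then show False using False by simp
    qed
    moreover have "z ^ nat Q = 1"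
      using assms by (simp add: z_def e_power)
    ultimately show ?thesis using False eq by (simp add: geometric_sum)
  qed
qed

section \<open>Means over frequency boxes and weighted exponential sums\<close>

definition bx :: "nat \<Rightarrow> int \<Rightarrow> (nat \<Rightarrow> int) set"
  where "bx k Q = PiE {1..k} (\<lambda>_. {0..<Q})"

definition mean :: "nat \<Rightarrow> int \<Rightarrow> ((nat \<Rightarrow> int) \<Rightarrow> real) \<Rightarrow> real"
  where "mean k Q G = (\<Sum>\<alpha>\<in>bx k Q. G \<alpha>) / of_int Q ^ k"

definition ip :: "nat \<Rightarrow> (nat \<Rightarrow> int poly) \<Rightarrow> (nat \<Rightarrow> int) \<Rightarrow> int \<Rightarrow> int"
  where "ip k \<phi> \<alpha> x = (\<Sum>j=1..k. \<alpha> j * poly (\<phi> j) x)"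

text \<open>The arbitrary weight makes decoupling inheritable: after restriction to a residue class,
  every phase that does not depend on the frequencies being averaged becomes part of it.\<close>

definition expsum :: "nat \<Rightarrow> int \<Rightarrow> (nat \<Rightarrow> int poly) \<Rightarrow> (int \<Rightarrow> complex) \<Rightarrow> int set \<Rightarrow> (nat \<Rightarrow> int) \<Rightarrow> complex"
  where "expsum k Q \<phi> w A \<alpha> = (\<Sum>x\<in>A. w x * e (of_int (ip k \<phi> \<alpha> x) / of_int Q))"

text \<open>Descent to (Z/Q)^k. Only the coordinates 1..k are compared, so that a translated vector,
  which need not be extensional, can be identified with one in the box.\<close>

definition periodic :: "nat \<Rightarrow> int \<Rightarrow> ((nat \<Rightarrow> int) \<Rightarrow> 'b) \<Rightarrow> bool"
  where "periodic k Q G \<longleftrightarrow> (\<forall>\<alpha> \<beta>. (\<forall>j\<in>{1..k}. [\<alpha> j = \<beta> j] (mod Q)) \<longrightarrow> G \<alpha> = G \<beta>)"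

definition moment :: "nat \<Rightarrow> int \<Rightarrow> (nat \<Rightarrow> int poly) \<Rightarrow> (int \<Rightarrow> complex) \<Rightarrow> int set \<Rightarrow> nat \<Rightarrow> real"
  where "moment k Q \<phi> w A s = mean k Q (\<lambda>\<alpha>. norm (expsum k Q \<phi> w A \<alpha>) ^ s)"

lemma finite_bx [simp]: "finite (bx k Q)"
  by (simp add: bx_def finite_PiE)

lemma card_bx: "Q \<ge> 0 \<Longrightarrow> of_nat (card (bx k Q)) = (of_int Q ^ k :: real)"
  by (simp add: bx_def card_PiE)

lemma mean_mono: "(\<And>\<alpha>. \<alpha> \<in> bx k Q \<Longrightarrow> G \<alpha> \<le> H \<alpha>) \<Longrightarrow> Q \<ge> 0 \<Longrightarrow> mean k Q G \<le> mean k Q H"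
  unfolding mean_def by (intro divide_right_mono sum_mono) auto

lemma mean_nonneg: "(\<And>\<alpha>. \<alpha> \<in> bx k Q \<Longrightarrow> G \<alpha> \<ge> 0) \<Longrightarrow> Q \<ge> 0 \<Longrightarrow> mean k Q G \<ge> 0"
  unfolding mean_def by (intro divide_nonneg_nonneg sum_nonneg) auto

lemma mean_cong: "(\<And>\<alpha>. \<alpha> \<in> bx k Q \<Longrightarrow> G \<alpha> = H \<alpha>) \<Longrightarrow> mean k Q G = mean k Q H"
  unfolding mean_def by (metis (mono_tags, lifting) sum.cong)

lemma mean_cmult: "mean k Q (\<lambda>\<alpha>. c * G \<alpha>) = c * mean k Q G"
  by (simp add: mean_def sum_distrib_left)

lemma mean_add: "mean k Q (\<lambda>\<alpha>. G \<alpha> + H \<alpha>) = mean k Q G + mean k Q H"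
  by (simp add: mean_def sum.distrib add_divide_distrib)

lemma mean_sum: "mean k Q (\<lambda>\<alpha>. \<Sum>i\<in>I. G i \<alpha>) = (\<Sum>i\<in>I. mean k Q (G i))"
proof -
  have "(\<Sum>\<alpha>\<in>bx k Q. \<Sum>i\<in>I. G i \<alpha>) = (\<Sum>i\<in>I. \<Sum>\<alpha>\<in>bx k Q. G i \<alpha>)"
    by (rule sum.swap)
  then show ?thesis by (simp add: mean_def sum_divide_distrib)
qed

lemma mean_const: "Q > 0 \<Longrightarrow> mean k Q (\<lambda>_. c) = c"
  by (simp add: mean_def card_bx)

lemma mean_swap:
  "mean k Q (\<lambda>\<alpha>. mean l R (\<lambda>\<beta>. G \<alpha> \<beta>)) = mean l R (\<lambda>\<beta>. mean k Q (\<lambda>\<alpha>. G \<alpha> \<beta>))"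
  unfolding mean_def sum_divide_distrib[symmetric]
  by (subst sum.swap) (simp add: mult.commute)

lemma mean_shift:
  fixes \<tau> :: "nat \<Rightarrow> int"
  assumes "periodic k Q G" "Q > 0"
  shows "mean k Q (\<lambda>\<alpha>. G (\<lambda>j. \<alpha> j + \<tau> j)) = mean k Q G"
proof -
  have "(\<Sum>\<alpha>\<in>bx k Q. G (\<lambda>j. \<alpha> j + \<tau> j)) = (\<Sum>\<alpha>\<in>bx k Q. G \<alpha>)"
  proof (rule sum.reindex_bij_witness[where i = "\<lambda>\<alpha>. restrict (\<lambda>j. (\<alpha> j - \<tau> j) mod Q) {1..k}"
        and j = "\<lambda>\<alpha>. restrict (\<lambda>j. (\<alpha> j + \<tau> j) mod Q) {1..k}"])
    fix \<alpha> assume \<alpha>: "\<alpha> \<in> bx k Q"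
    show "(\<lambda>j\<in>{1..k}. ((\<lambda>j\<in>{1..k}. (\<alpha> j + \<tau> j) mod Q) j - \<tau> j) mod Q) = \<alpha>"
      using \<alpha> by (auto simp: bx_def PiE_iff extensional_def fun_eq_iff mod_diff_left_eq)
    show "(\<lambda>j\<in>{1..k}. ((\<lambda>j\<in>{1..k}. (\<alpha> j - \<tau> j) mod Q) j + \<tau> j) mod Q) = \<alpha>"
      using \<alpha> by (auto simp: bx_def PiE_iff extensional_def fun_eq_iff mod_add_left_eq)
    show "G (\<lambda>j\<in>{1..k}. (\<alpha> j + \<tau> j) mod Q) = G (\<lambda>j. \<alpha> j + \<tau> j)"
      by (rule assms(1)[unfolded periodic_def, rule_format]) (simp add: cong_def)
  qed (use assms(2) in \<open>auto simp: bx_def\<close>)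
  then show ?thesis by (simp add: mean_def)
qed

lemma ip_cong:
  assumes "\<forall>j\<in>{1..k}. [\<alpha> j = \<beta> j] (mod Q)"
  shows "[ip k \<phi> \<alpha> x = ip k \<phi> \<beta> x] (mod Q)"
  unfolding ip_def using assms by (intro cong_sum cong_mult cong_refl) auto

lemma periodic_expsum: "Q > 0 \<Longrightarrow> periodic k Q (expsum k Q \<phi> w A)"
  unfolding periodic_def expsum_def
  by (intro allI impI sum.cong refl arg_cong2[where f = "(*)"] e_cong ip_cong) auto

lemma periodic_comp: "periodic k Q G \<Longrightarrow> periodic k Q (\<lambda>\<alpha>. h (G \<alpha>))"
  unfolding periodic_def by metis

lemma periodic_comp2: "periodic k Q G \<Longrightarrow> periodic k Q H \<Longrightarrow> periodic k Q (\<lambda>\<alpha>. h (G \<alpha>) (H \<alpha>))"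
  unfolding periodic_def by metis

definition shift :: "nat \<Rightarrow> (nat \<Rightarrow> nat \<Rightarrow> int) \<Rightarrow> (nat \<Rightarrow> int) \<Rightarrow> (nat \<Rightarrow> int) \<Rightarrow> nat \<Rightarrow> int"
  where "shift l \<tau> \<beta> \<alpha> = (\<lambda>j. \<alpha> j + (\<Sum>i=1..l. \<beta> i * \<tau> i j))"

text \<open>Each translation preserves the mean, hence so does the average over the translations.
  The inner mean over \<open>\<beta>\<close> is the one to which decoupling in degree
  \<open>l\<close> will be applied.\<close>

lemma mean_shift_avg:
  assumes "periodic k Q G" "Q > 0" "R > 0"
  shows "mean k Q G = mean k Q (\<lambda>\<alpha>. mean l R (\<lambda>\<beta>. G (shift l \<tau> \<beta> \<alpha>)))"
proof -
  have "mean k Q (\<lambda>\<alpha>. mean l R (\<lambda>\<beta>. G (shift l \<tau> \<beta> \<alpha>)))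
     = mean l R (\<lambda>\<beta>. mean k Q (\<lambda>\<alpha>. G (shift l \<tau> \<beta> \<alpha>)))"
    by (rule mean_swap)
  also have "\<dots> = mean l R (\<lambda>\<beta>. mean k Q G)"
    unfolding shift_def using assms by (intro mean_cong mean_shift)
  also have "\<dots> = mean k Q G"
    using assms by (simp add: mean_const)
  finally show ?thesis ..
qed

text \<open>Perturbations of the moment curve that vanish modulo \<open>p\<close>. Unlike the moment curve itself, this class is
  preserved, after a change of frame, by restriction to a residue class and rescaling.\<close>

definition curve :: "int \<Rightarrow> nat \<Rightarrow> (nat \<Rightarrow> int poly) \<Rightarrow> bool"
  where "curve p k \<phi> \<longleftrightarrow> (\<forall>j\<in>{1..k}. \<forall>i. [coeff (\<phi> j) i = (if i = j then 1 else 0)] (mod p))"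

definition cls :: "int \<Rightarrow> nat \<Rightarrow> int \<Rightarrow> int set \<Rightarrow> int set"
  where "cls p a \<xi> A = {x\<in>A. x mod p ^ a = \<xi>}"

text \<open>When all classes contribute equally, the right-hand side is \<open>K\<close> times the value predicted by square root
  cancellation between the \<open>p^n\<close> classes.\<close>

definition dec_at :: "int \<Rightarrow> nat \<Rightarrow> nat \<Rightarrow> real \<Rightarrow> (nat \<Rightarrow> int poly) \<Rightarrow> (int \<Rightarrow> complex) \<Rightarrow> int set \<Rightarrow> bool"
  where "dec_at p k n K \<phi> w A \<longleftrightarrow> moment k (p ^ (k * n)) \<phi> w A (k * (k + 1))
     \<le> K * of_int p ^ (n * (k * (k + 1) div 2 - 1)) *
       (\<Sum>\<theta>\<in>{0..<p ^ n}. moment k (p ^ (k * n)) \<phi> w (cls p n \<theta> A) (k * (k + 1)))"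

definition dec :: "int \<Rightarrow> nat \<Rightarrow> nat \<Rightarrow> real \<Rightarrow> bool"
  where "dec p k n K \<longleftrightarrow> (\<forall>\<phi> w A. curve p k \<phi> \<longrightarrow> finite A \<longrightarrow> dec_at p k n K \<phi> w A)"

section \<open>Decoupling along frequency shifts inside a residue class\<close>

lemma finite_cls [simp]: "finite A \<Longrightarrow> finite (cls p a \<xi> A)"
  by (simp add: cls_def)

lemma ip_shift: "ip k \<phi> (shift l \<tau> \<beta> \<alpha>) x = ip k \<phi> \<alpha> x + (\<Sum>i=1..l. \<beta> i * ip k \<phi> (\<tau> i) x)"
proof -
  have "ip k \<phi> (shift l \<tau> \<beta> \<alpha>) x = ip k \<phi> \<alpha> x + (\<Sum>j=1..k. \<Sum>i=1..l. \<beta> i * (\<tau> i j * poly (\<phi> j) x))"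
    by (simp add: ip_def shift_def algebra_simps sum.distrib sum_distrib_left)
  also have "(\<Sum>j=1..k. \<Sum>i=1..l. \<beta> i * (\<tau> i j * poly (\<phi> j) x)) = (\<Sum>i=1..l. \<beta> i * ip k \<phi> (\<tau> i) x)"
    by (subst sum.swap) (simp add: ip_def sum_distrib_left)
  finally show ?thesis .
qed

text \<open>The factor \<open>Q'\<close> cancels against the modulus, so that \<open>\<beta>\<close>
  becomes a genuine frequency modulo \<open>R\<close> for the curve \<open>\<psi>\<close>. The
  constants \<open>c i\<close> only contribute a unimodular factor, and the part of the phase that
  depends on \<open>\<alpha>\<close> joins the weight.\<close>

lemma expsum_transfer:
  fixes p :: int
  assumes "p > 1" "Q = R * Q'" "R > 0" "Q' > 0"
    and \<tau>: "\<And>i z. i \<in> {1..l} \<Longrightarrow> ip k \<phi> (\<tau> i) (\<xi> + p ^ a * z) = c i + Q' * poly (\<psi> i) z"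
    and B: "\<And>x. x \<in> B \<Longrightarrow> x mod p ^ a = \<xi>"
  shows "norm (expsum k Q \<phi> w B (shift l \<tau> \<beta> \<alpha>)) =
    norm (expsum l R \<psi> (\<lambda>z. w (\<xi> + p ^ a * z) * e (of_int (ip k \<phi> \<alpha> (\<xi> + p ^ a * z)) / of_int Q))
       {z. \<xi> + p ^ a * z \<in> B} \<beta>)"
proof -
  define c0 where "c0 = (\<Sum>i=1..l. \<beta> i * c i)"
  have ipeq: "ip k \<phi> (shift l \<tau> \<beta> \<alpha>) (\<xi> + p ^ a * z)
      = ip k \<phi> \<alpha> (\<xi> + p ^ a * z) + c0 + Q' * ip l \<psi> \<beta> z" for z
  proof -
    have "(\<Sum>i=1..l. \<beta> i * ip k \<phi> (\<tau> i) (\<xi> + p ^ a * z)) = (\<Sum>i=1..l. \<beta> i * (c i + Q' * poly (\<psi> i) z))"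
      using \<tau> by (intro sum.cong) auto
    also have "\<dots> = c0 + Q' * ip l \<psi> \<beta> z"
      by (simp add: c0_def ip_def algebra_simps sum.distrib sum_distrib_left)
    finally show ?thesis by (simp add: ip_shift)
  qed
  have Beq: "B = (\<lambda>z. \<xi> + p ^ a * z) ` {z. \<xi> + p ^ a * z \<in> B}"
  proof (intro equalityI subsetI)
    fix x assume "x \<in> B"
    then have "x = \<xi> + p ^ a * (x div p ^ a)" using B[of x] by (metis mod_mult_div_eq)
    then show "x \<in> (\<lambda>z. \<xi> + p ^ a * z) ` {z. \<xi> + p ^ a * z \<in> B}" using \<open>x \<in> B\<close> by auto
  qed auto
  have inj: "inj_on (\<lambda>z. \<xi> + p ^ a * z) {z. \<xi> + p ^ a * z \<in> B}"
    using assms(1) by (auto simp: inj_on_def)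
  have "expsum k Q \<phi> w B (shift l \<tau> \<beta> \<alpha>) =
     (\<Sum>z\<in>{z. \<xi> + p ^ a * z \<in> B}. w (\<xi> + p ^ a * z) *
        e (of_int (ip k \<phi> \<alpha> (\<xi> + p ^ a * z) + c0 + Q' * ip l \<psi> \<beta> z) / of_int Q))"
    unfolding expsum_def by (subst Beq, subst sum.reindex[OF inj]) (simp only: o_def ipeq)
  also have "\<dots> = e (of_int c0 / of_int Q) * expsum l R \<psi>
     (\<lambda>z. w (\<xi> + p ^ a * z) * e (of_int (ip k \<phi> \<alpha> (\<xi> + p ^ a * z)) / of_int Q))
       {z. \<xi> + p ^ a * z \<in> B} \<beta>"
    unfolding expsum_def sum_distrib_left
  proof (intro sum.cong refl)
    fix z
    have "of_int (ip k \<phi> \<alpha> (\<xi> + p ^ a * z) + c0 + Q' * ip l \<psi> \<beta> z) / of_int Q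
      = (of_int (ip k \<phi> \<alpha> (\<xi> + p ^ a * z)) / of_int Q + of_int c0 / of_int Q
         + of_int (ip l \<psi> \<beta> z) / of_int R :: real)"
      using assms(2-4) by (simp add: field_simps)
    then show "w (\<xi> + p ^ a * z) *
        e (of_int (ip k \<phi> \<alpha> (\<xi> + p ^ a * z) + c0 + Q' * ip l \<psi> \<beta> z) / of_int Q) =
       e (of_int c0 / of_int Q) * (w (\<xi> + p ^ a * z) * e (of_int (ip k \<phi> \<alpha> (\<xi> + p ^ a * z)) / of_int Q)
         * e (of_int (ip l \<psi> \<beta> z) / of_int R))"
      by (simp add: e_add)
  qed
  finally show ?thesis by (simp add: norm_mult)
qed

lemma cls_shift:
  assumes "p > 1" "0 \<le> \<xi>" "\<xi> < p ^ a" "0 \<le> \<theta>"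
  shows "{z. \<xi> + p ^ a * z \<in> cls p (a + n) (\<xi> + p ^ a * \<theta>) A} = cls p n \<theta> {z. \<xi> + p ^ a * z \<in> cls p a \<xi> A}"
proof -
  have "(\<xi> + p ^ a * z) mod p ^ (a + n) = \<xi> + p ^ a * (z mod p ^ n)" for z
  proof -
    have "(\<xi> + p ^ a * z) mod (p ^ a * p ^ n) = p ^ a * ((\<xi> + p ^ a * z) div p ^ a mod p ^ n) + (\<xi> + p ^ a * z) mod p ^ a"
      using assms(1) by (simp add: zmod_zmult2_eq)
    moreover have "(\<xi> + p ^ a * z) div p ^ a = z" "(\<xi> + p ^ a * z) mod p ^ a = \<xi>"
      using assms by auto
    ultimately show ?thesis by (simp add: power_add)
  qed
  then show ?thesis using assms by (auto simp: cls_def)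
qed

text \<open>Decoupling is applied to the inner mean for each fixed \<open>\<alpha>\<close>; the
  factor \<open>W\<close> leaves that mean because it is invariant along the shifts. In this form
  one factor of a bilinear mean can be decoupled while the other is left alone.\<close>

lemma dec_transfer:
  fixes p :: int
  assumes dec: "dec p l n K" and "p > 1" "Q = p ^ (l * n) * Q'" "Q' > 0"
    and \<tau>: "\<And>i z. i \<in> {1..l} \<Longrightarrow> ip k \<phi> (\<tau> i) (\<xi> + p ^ a * z) = c i + Q' * poly (\<psi> i) z"
    and curve: "curve p l \<psi>" and "finite A" and \<xi>: "0 \<le> \<xi>" "\<xi> < p ^ a"
    and W: "periodic k Q W" "\<And>\<alpha>. W \<alpha> \<ge> 0"
      "\<And>\<alpha> \<beta>. W (shift l \<tau> \<beta> \<alpha>) = W \<alpha>"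
  shows "mean k Q (\<lambda>\<alpha>. W \<alpha> * norm (expsum k Q \<phi> w (cls p a \<xi> A) \<alpha>) ^ (l * (l + 1)))
    \<le> K * of_int p ^ (n * (l * (l + 1) div 2 - 1)) * (\<Sum>\<theta>\<in>{0..<p ^ n}.
         mean k Q (\<lambda>\<alpha>. W \<alpha> * norm (expsum k Q \<phi> w (cls p (a + n) (\<xi> + p ^ a * \<theta>) A) \<alpha>) ^ (l * (l + 1))))"
proof -
  define R where "R = p ^ (l * n)"
  have R: "R > 0" using assms(2) by (simp add: R_def)
  then have Q: "Q > 0" using assms(3,4) by (simp add: R_def)
  define w' where "w' = (\<lambda>\<alpha> z. w (\<xi> + p ^ a * z) * e (of_int (ip k \<phi> \<alpha> (\<xi> + p ^ a * z)) / of_int Q))"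
  define Z where "Z = {z. \<xi> + p ^ a * z \<in> cls p a \<xi> A}"
  have finZ: "finite Z"
    using finite_vimageI[of "cls p a \<xi> A" "\<lambda>z. \<xi> + p ^ a * z"] \<open>finite A\<close> assms(2)
    by (auto simp: Z_def vimage_def inj_on_def)
  have per: "periodic k Q (\<lambda>\<alpha>. W \<alpha> * norm (expsum k Q \<phi> w B \<alpha>) ^ (l * (l + 1)))" for B
    by (intro periodic_comp2[where h = "\<lambda>x y. x * norm y ^ (l * (l + 1))"] W(1) periodic_expsum Q)
  \<comment> \<open>The same fibering identity serves the class itself and each of its subclasses,
    so both sides are compared along one system of shifts.\<close>
  have main: "mean k Q (\<lambda>\<alpha>. W \<alpha> * norm (expsum k Q \<phi> w B \<alpha>) ^ (l * (l + 1))) =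
    mean k Q (\<lambda>\<alpha>. W \<alpha> * mean l R (\<lambda>\<beta>. norm (expsum l R \<psi> (w' \<alpha>) {z. \<xi> + p ^ a * z \<in> B} \<beta>) ^ (l * (l + 1))))"
    if "\<And>x. x \<in> B \<Longrightarrow> x mod p ^ a = \<xi>" for B
    unfolding mean_shift_avg[OF per Q R, of B l \<tau>] W(3) mean_cmult w'_def
    by (subst expsum_transfer[where Q' = Q' and R = R and c = c and \<psi> = \<psi> and \<xi> = \<xi> and a = a and p = p])
       (use assms R that \<tau> in \<open>auto simp: R_def\<close>)
  have m0: "x mod p ^ a = \<xi>" if "x \<in> cls p a \<xi> A" for x using that by (simp add: cls_def)
  have m1: "x mod p ^ a = \<xi>" if "x \<in> cls p (a + n) (\<xi> + p ^ a * \<theta>) A" "\<theta> \<in> {0..<p ^ n}" for x \<theta>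
  proof -
    have "x mod p ^ (a + n) mod p ^ a = (\<xi> + p ^ a * \<theta>) mod p ^ a" using that by (simp add: cls_def)
    then show ?thesis using \<xi> by (simp add: power_add mod_mod_cancel)
  qed
  have "mean k Q (\<lambda>\<alpha>. W \<alpha> * norm (expsum k Q \<phi> w (cls p a \<xi> A) \<alpha>) ^ (l * (l + 1)))
    = mean k Q (\<lambda>\<alpha>. W \<alpha> * mean l R (\<lambda>\<beta>. norm (expsum l R \<psi> (w' \<alpha>) Z \<beta>) ^ (l * (l + 1))))"
    unfolding Z_def by (rule main) (rule m0)
  also have "\<dots> \<le> mean k Q (\<lambda>\<alpha>. W \<alpha> * (K * of_int p ^ (n * (l * (l + 1) div 2 - 1)) * (\<Sum>\<theta>\<in>{0..<p ^ n}.
         mean l R (\<lambda>\<beta>. norm (expsum l R \<psi> (w' \<alpha>) (cls p n \<theta> Z) \<beta>) ^ (l * (l + 1))))))"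
    using dec curve finZ W(2) Q unfolding dec_def dec_at_def moment_def R_def
    by (intro mean_mono mult_left_mono) auto
  also have "\<dots> = K * of_int p ^ (n * (l * (l + 1) div 2 - 1)) * (\<Sum>\<theta>\<in>{0..<p ^ n}.
     mean k Q (\<lambda>\<alpha>. W \<alpha> * mean l R (\<lambda>\<beta>. norm (expsum l R \<psi> (w' \<alpha>) (cls p n \<theta> Z) \<beta>) ^ (l * (l + 1)))))"
    unfolding mean_sum[symmetric] mean_cmult[symmetric]
    by (intro mean_cong) (simp add: sum_distrib_left algebra_simps)
  also have "(\<Sum>\<theta>\<in>{0..<p ^ n}.
     mean k Q (\<lambda>\<alpha>. W \<alpha> * mean l R (\<lambda>\<beta>. norm (expsum l R \<psi> (w' \<alpha>) (cls p n \<theta> Z) \<beta>) ^ (l * (l + 1)))))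
    = (\<Sum>\<theta>\<in>{0..<p ^ n}.
         mean k Q (\<lambda>\<alpha>. W \<alpha> * norm (expsum k Q \<phi> w (cls p (a + n) (\<xi> + p ^ a * \<theta>) A) \<alpha>) ^ (l * (l + 1))))"
  proof (intro sum.cong refl)
    fix \<theta> assume \<theta>: "\<theta> \<in> {0..<p ^ n}"
    have "cls p n \<theta> Z = {z. \<xi> + p ^ a * z \<in> cls p (a + n) (\<xi> + p ^ a * \<theta>) A}"
      unfolding Z_def using assms(2) \<xi> \<theta> by (intro cls_shift[symmetric]) auto
    then show "mean k Q (\<lambda>\<alpha>. W \<alpha> * mean l R (\<lambda>\<beta>. norm (expsum l R \<psi> (w' \<alpha>) (cls p n \<theta> Z) \<beta>) ^ (l * (l + 1))))
      = mean k Q (\<lambda>\<alpha>. W \<alpha> * norm (expsum k Q \<phi> w (cls p (a + n) (\<xi> + p ^ a * \<theta>) A) \<alpha>) ^ (l * (l + 1)))"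
      using \<theta> main[of "cls p (a + n) (\<xi> + p ^ a * \<theta>) A"] m1[of _ \<theta>] by simp
  qed
  finally show ?thesis .
qed

text \<open>Real powers with \<open>0^0 = 1\<close>, in contrast to \<open>0 powr 0 = 0\<close>.\<close>

definition rpow :: "real \<Rightarrow> real \<Rightarrow> real"
  where "rpow x t = (if t = 0 then 1 else x powr t)"

lemma rpow_nonneg [simp]: "rpow x t \<ge> 0"
  by (simp add: rpow_def)

lemma rpow_add: "x \<ge> 0 \<Longrightarrow> a \<ge> 0 \<Longrightarrow> b \<ge> 0 \<Longrightarrow> rpow x a * rpow x b = rpow x (a + b)"
  by (auto simp: rpow_def powr_add)

lemma rpow_powr: "x \<ge> 0 \<Longrightarrow> a \<ge> 0 \<Longrightarrow> \<theta> > 0 \<Longrightarrow> rpow x a powr \<theta> = rpow x (a * \<theta>)"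
  by (auto simp: rpow_def powr_powr)

lemma rpow_of_nat: "x \<ge> 0 \<Longrightarrow> rpow x (real n) = x ^ n"
  by (cases "x = 0") (auto simp: rpow_def powr_realpow)

lemma rpow_mono: "0 \<le> x \<Longrightarrow> x \<le> y \<Longrightarrow> t \<ge> 0 \<Longrightarrow> rpow x t \<le> rpow y t"
  by (auto simp: rpow_def intro: powr_mono2)

section \<open>Hoelder inequalities with fractional exponents\<close>

lemma weighted_am_gm:
  fixes a b :: real
  assumes "a \<ge> 0" "b \<ge> 0" "0 < \<theta>" "\<theta> < 1"
  shows "a powr \<theta> * b powr (1 - \<theta>) \<le> \<theta> * a + (1 - \<theta>) * b"
proof (cases "a = 0 \<or> b = 0")
  case False
  then show ?thesis using assms Youngs_inequality_0[of \<theta> "1 - \<theta>" a b] by auto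
qed (use assms in auto)

text \<open>Dividing by the two sums reduces this to the weighted mean inequality termwise. If one
  of the sums vanishes, so does every product, because \<open>0 powr \<theta>\<close> is 0.\<close>

lemma holder_sum:
  fixes F G :: "'a \<Rightarrow> real"
  assumes "finite S" "\<And>i. i \<in> S \<Longrightarrow> F i \<ge> 0" "\<And>i. i \<in> S \<Longrightarrow> G i \<ge> 0" "0 < \<theta>" "\<theta> < 1"
  shows "(\<Sum>i\<in>S. F i powr \<theta> * G i powr (1 - \<theta>)) \<le> (\<Sum>i\<in>S. F i) powr \<theta> * (\<Sum>i\<in>S. G i) powr (1 - \<theta>)"
proof (cases "(\<Sum>i\<in>S. F i) = 0 \<or> (\<Sum>i\<in>S. G i) = 0")
  case True
  then have "F i = 0 \<or> G i = 0" if "i \<in> S" for i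
    using assms(1-3) that by (auto simp: sum_nonneg_eq_0_iff)
  then have "(\<Sum>i\<in>S. F i powr \<theta> * G i powr (1 - \<theta>)) = 0"
    by (intro sum.neutral) auto
  then show ?thesis by simp
next
  case False
  define A B where "A = (\<Sum>i\<in>S. F i)" and "B = (\<Sum>i\<in>S. G i)"
  have pos: "A > 0" "B > 0"
    using False assms by (auto simp: A_def B_def less_le sum_nonneg)
  have "F i powr \<theta> * G i powr (1 - \<theta>) \<le>
      (A powr \<theta> * B powr (1 - \<theta>)) * (\<theta> * (F i / A) + (1 - \<theta>) * (G i / B))" if "i \<in> S" for i
  proof -
    have "F i powr \<theta> * G i powr (1 - \<theta>) = (A powr \<theta> * B powr (1 - \<theta>)) *
        ((F i / A) powr \<theta> * (G i / B) powr (1 - \<theta>))"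
      using pos assms(2,3)[OF that] by (simp add: powr_divide)
    also have "\<dots> \<le> (A powr \<theta> * B powr (1 - \<theta>)) * (\<theta> * (F i / A) + (1 - \<theta>) * (G i / B))"
      using pos assms that by (intro mult_left_mono weighted_am_gm) auto
    finally show ?thesis .
  qed
  then have "(\<Sum>i\<in>S. F i powr \<theta> * G i powr (1 - \<theta>)) \<le>
     (\<Sum>i\<in>S. (A powr \<theta> * B powr (1 - \<theta>)) * (\<theta> * (F i / A) + (1 - \<theta>) * (G i / B)))"
    by (rule sum_mono)
  also have "\<dots> = (A powr \<theta> * B powr (1 - \<theta>)) * (\<theta> * (A / A) + (1 - \<theta>) * (B / B))"
    unfolding A_def B_def by (simp add: sum_distrib_left[symmetric] sum.distrib sum_divide_distrib[symmetric])
  also have "\<dots> = A powr \<theta> * B powr (1 - \<theta>)" using pos by simp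
  finally show ?thesis by (simp add: A_def B_def)
qed

lemma sum_powr_le:
  fixes F :: "'a \<Rightarrow> real"
  assumes "finite S" "\<And>i. i \<in> S \<Longrightarrow> F i \<ge> 0" "0 < \<theta>" "\<theta> < 1"
  shows "(\<Sum>i\<in>S. F i powr \<theta>) \<le> real (card S) powr (1 - \<theta>) * (\<Sum>i\<in>S. F i) powr \<theta>"
  using holder_sum[of S F "\<lambda>_. 1" \<theta>] assms by (simp add: mult.commute)

section \<open>Unimodular changes of frame on a curve\<close>

lemma poly_dvd_coeff: "[:c:] dvd (A - B :: int poly) \<longleftrightarrow> (\<forall>i. [coeff A i = coeff B i] (mod c))"
  by (simp add: const_poly_dvd_iff cong_iff_dvd_diff)

lemma pcompose_cong:
  assumes "\<forall>i. [coeff A i = coeff B i] (mod (c::int))"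
  shows "[coeff (pcompose A r) i = coeff (pcompose B r) i] (mod c)"
proof -
  have "[:c:] dvd A - B" using assms poly_dvd_coeff by blast
  then obtain C where "A - B = [:c:] * C" by auto
  then have "pcompose A r - pcompose B r = [:c:] * pcompose C r"
    by (metis pcompose_diff pcompose_mult pcompose_const)
  then have "[:c:] dvd pcompose A r - pcompose B r" by (metis dvd_triv_left)
  then show ?thesis using poly_dvd_coeff by blast
qed

text \<open>A constant term that is a unit makes \<open>U\<close> invertible as a power series
  modulo \<open>p\<close>; the coefficients of \<open>R\<close> are found one at a time.\<close>

lemma solve_low_coeffs:
  fixes p :: int
  assumes "prime p" "l > 0 \<Longrightarrow> \<not> p dvd coeff U 0"
  shows "\<exists>R. (R = 0 \<or> degree R < l) \<and> (\<forall>n<l. [coeff (U * R) n = s n] (mod p))"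
  using assms(2)
proof (induction l)
  case 0
  then show ?case by (intro exI[of _ 0]) auto
next
  case (Suc l)
  then have u: "\<not> p dvd coeff U 0" by simp
  with Suc obtain R where R: "R = 0 \<or> degree R < l" "\<forall>n<l. [coeff (U * R) n = s n] (mod p)" by auto
  have "coprime (coeff U 0) p"
    using u assms(1) by (simp add: coprime_commute prime_imp_coprime)
  then obtain v where v: "[coeff U 0 * v = 1] (mod p)" using cong_solve_coprime_int by blast
  define r where "r = v * (s l - coeff (U * R) l)"
  have co: "coeff (U * (R + monom r l)) n = coeff (U * R) n + (if l \<le> n then r * coeff U (n - l) else 0)" for n
    by (simp add: distrib_left mult.commute[of U "monom r l"] coeff_monom_mult)
  have "[coeff (U * (R + monom r l)) n = s n] (mod p)" if "n < Suc l" for n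
  proof (cases "n = l")
    case True
    have "[coeff (U * R) l + (coeff U 0 * v) * (s l - coeff (U * R) l) = coeff (U * R) l + 1 * (s l - coeff (U * R) l)] (mod p)"
      using v by (intro cong_add cong_mult cong_refl)
    moreover have "coeff (U * (R + monom r l)) l = coeff (U * R) l + (coeff U 0 * v) * (s l - coeff (U * R) l)"
      unfolding co by (simp add: r_def)
    ultimately show ?thesis by (simp add: True)
  next
    case False
    then show ?thesis using that R(2) by (auto simp: co)
  qed
  moreover have "R + monom r l = 0 \<or> degree (R + monom r l) < Suc l"
    using R(1) by (intro disjI2 le_imp_less_Suc degree_add_le) (auto simp: degree_monom_le)
  ultimately show ?case by blast
qed

text \<open>The interpolant is \<open>(x - eta)^K R1(x - xi) + (x - xi)^l R2(x - eta)\<close>; the conditions on \<open>R1\<close> and \<open>R2\<close>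
  decouple and are triangular with unit diagonal.\<close>

lemma hermite_mod_prime:
  fixes p :: int
  assumes "prime p" "K > 0 \<Longrightarrow> l > 0 \<Longrightarrow> \<not> p dvd (\<xi> - \<eta>)"
  shows "\<exists>q. (\<forall>n\<ge>K + l. coeff q n = 0) \<and> (\<forall>n<l. [coeff (pcompose q [:\<xi>, 1:]) n = s n] (mod p))
     \<and> (\<forall>n<K. [coeff (pcompose q [:\<eta>, 1:]) n = s' n] (mod p))"
proof -
  have co: "coeff ([:c, 1:] ^ m) 0 = c ^ m" for c :: int and m
    by (induction m) auto
  have nd1: "\<not> p dvd coeff ([:\<xi> - \<eta>, 1:] ^ K) 0" if "l > 0"
    using assms that prime_dvd_power[OF assms(1)] not_prime_unit unfolding co
    by (cases "K = 0") auto
  have nd2: "\<not> p dvd coeff ([:\<eta> - \<xi>, 1:] ^ l) 0" if "K > 0"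
    using assms that dvd_minus_iff[of p "\<xi> - \<eta>"] prime_dvd_power[OF assms(1)] not_prime_unit unfolding co
    by (cases "l = 0") auto
  obtain R1 where R1: "R1 = 0 \<or> degree R1 < l" "\<forall>n<l. [coeff ([:\<xi> - \<eta>, 1:] ^ K * R1) n = s n] (mod p)"
    using solve_low_coeffs[OF assms(1), of l "[:\<xi> - \<eta>, 1:] ^ K" s] nd1 by blast
  obtain R2 where R2: "R2 = 0 \<or> degree R2 < K" "\<forall>n<K. [coeff ([:\<eta> - \<xi>, 1:] ^ l * R2) n = s' n] (mod p)"
    using solve_low_coeffs[OF assms(1), of K "[:\<eta> - \<xi>, 1:] ^ l" s'] nd2 by blast
  define q where "q = [:- \<eta>, 1:] ^ K * pcompose R1 [:- \<xi>, 1:] + [:- \<xi>, 1:] ^ l * pcompose R2 [:- \<eta>, 1:]"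
  have pp: "pcompose ([:a, 1:] ^ m) [:b, 1:] = [:a + b, 1:] ^ m" for a b :: int and m
    by (induction m) (simp_all only: power_0 power_Suc pcompose_1 pcompose_mult, simp add: pcompose_pCons add.commute)
  have pid: "pcompose (pcompose R [:- a, 1:]) [:a, 1:] = R" for R :: "int poly" and a
    by (simp add: pcompose_assoc[symmetric] pcompose_pCons)
  have X: "[:0, 1:] ^ m = monom (1::int) m" for m
    by (simp add: monom_altdef)
  have qx: "pcompose q [:\<xi>, 1:] = [:\<xi> - \<eta>, 1:] ^ K * R1 + monom 1 l * pcompose (pcompose R2 [:- \<eta>, 1:]) [:\<xi>, 1:]"
    by (simp add: q_def pcompose_add pcompose_mult pp pid X)
  have qe: "pcompose q [:\<eta>, 1:] = monom 1 K * pcompose (pcompose R1 [:- \<xi>, 1:]) [:\<eta>, 1:] + [:\<eta> - \<xi>, 1:] ^ l * R2"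
    by (simp add: q_def pcompose_add pcompose_mult pp pid X)
  have deg: "coeff ([:a, 1:] ^ m * pcompose R [:b, 1:]) n = 0" if "R = 0 \<or> degree R < m'" "n \<ge> m + m'"
    for a b :: int and m m' n R
  proof (cases "R = 0")
    case False
    have "degree ([:a, 1:] ^ m * pcompose R [:b, 1:]) \<le> degree ([:a, 1:] ^ m) + degree (pcompose R [:b, 1:])"
      by (rule degree_mult_le)
    also have "\<dots> = m + degree R" by (simp add: degree_linear_power degree_pcompose)
    also have "\<dots> < n" using that False by simp
    finally show ?thesis by (rule coeff_eq_0)
  qed simp
  have "coeff q n = 0" if "n \<ge> K + l" for n
    using deg[OF R1(1), of K n "- \<eta>" "- \<xi>"] deg[OF R2(1), of l n "- \<xi>" "- \<eta>"] that by (simp add: q_def)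
  moreover have "[coeff (pcompose q [:\<xi>, 1:]) n = s n] (mod p)" if "n < l" for n
    using that R1(2) by (simp add: qx coeff_monom_mult)
  moreover have "[coeff (pcompose q [:\<eta>, 1:]) n = s' n] (mod p)" if "n < K" for n
    using that R2(2) by (simp add: qe coeff_monom_mult)
  ultimately show ?thesis by blast
qed

text \<open>The Taylor coefficient of order \<open>n\<close> is the one of the derivative of order
  \<open>n - 1\<close> divided by \<open>n\<close>, and \<open>n < p\<close> is a unit modulo
  \<open>p\<close>.\<close>

lemma coeff_antiderivative_cong:
  fixes Q :: "int poly"
  assumes "prime p" "int n < p" "n \<ge> 1" "\<forall>i. [coeff (pderiv Q) i = coeff q i] (mod p)"
    "[coeff (pcompose q [:c, 1:]) (n - 1) = int n * t] (mod p)"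
  shows "[coeff (pcompose Q [:c, 1:]) n = t] (mod p)"
proof -
  have "pderiv (pcompose Q [:c, 1:]) = pcompose (pderiv Q) [:c, 1:]"
    by (simp add: pderiv_pcompose pderiv_pCons)
  moreover have "coeff (pderiv (pcompose Q [:c, 1:])) (n - 1) = int n * coeff (pcompose Q [:c, 1:]) n"
    using assms(3) by (simp add: coeff_pderiv)
  ultimately have "[int n * coeff (pcompose Q [:c, 1:]) n = int n * t] (mod p)"
    using pcompose_cong[OF assms(4), of "[:c, 1:]" "n - 1"] assms(5) by (metis cong_trans)
  moreover have "coprime (int n) p"
    using assms(1-3) by (metis coprime_commute not_less of_nat_0_less_iff prime_imp_coprime zdvd_imp_le le_less_trans less_le_trans not_one_le_zero of_nat_le_0_iff not_less_eq_eq One_nat_def)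
  ultimately show ?thesis by (simp add: cong_mult_lcancel)
qed

definition taylor :: "nat \<Rightarrow> (nat \<Rightarrow> int poly) \<Rightarrow> int \<Rightarrow> (nat \<Rightarrow> int) \<Rightarrow> nat \<Rightarrow> int"
  where "taylor k \<phi> c g i = coeff (pcompose (\<Sum>j=1..k. smult (g j) (\<phi> j)) [:c, 1:]) i"

lemma taylor_add: "taylor k \<phi> c (\<lambda>j. g j + m * h j) i = taylor k \<phi> c g i + m * taylor k \<phi> c h i"
proof -
  have "(\<Sum>j=1..k. smult (g j + m * h j) (\<phi> j)) = (\<Sum>j=1..k. smult (g j) (\<phi> j)) + smult m (\<Sum>j=1..k. smult (h j) (\<phi> j))"
    by (intro poly_eqI) (simp add: coeff_sum sum_distrib_left sum.distrib algebra_simps)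
  then show ?thesis by (simp only: taylor_def pcompose_add pcompose_smult coeff_add coeff_smult)
qed

text \<open>Modulo \<open>p\<close> the combinations of the \<open>\<phi> j\<close> are the
  polynomials of degree at most \<open>k\<close> without constant term, and their derivatives are
  all polynomials of degree below \<open>k\<close>. Prescribing Taylor coefficients at both centres
  is therefore Hermite interpolation of the derivative: a confluent Vandermonde system, solvable
  because 1, ..., k and the difference of the centres are units modulo \<open>p\<close>.\<close>

lemma taylor_mod_prime:
  fixes p :: int
  assumes "prime p" "int k < p" "curve p k \<phi>" "k = K + l" "K > 0 \<Longrightarrow> l > 0 \<Longrightarrow> \<not> p dvd (\<xi> - \<eta>)"
  shows "\<exists>g. (\<forall>i\<in>{1..l}. [taylor k \<phi> \<xi> g i = t i] (mod p)) \<and> (\<forall>i\<in>{1..K}. [taylor k \<phi> \<eta> g i = t' i] (mod p))"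
proof -
  obtain q where q: "\<forall>n\<ge>K + l. coeff q n = 0"
    "\<forall>n<l. [coeff (pcompose q [:\<xi>, 1:]) n = int (Suc n) * t (Suc n)] (mod p)"
    "\<forall>n<K. [coeff (pcompose q [:\<eta>, 1:]) n = int (Suc n) * t' (Suc n)] (mod p)"
    using hermite_mod_prime[where s = "\<lambda>n. int (Suc n) * t (Suc n)" and s' = "\<lambda>n. int (Suc n) * t' (Suc n)",
        OF assms(1,5)] by blast
  have "\<exists>v. [int j * v = 1] (mod p)" if "j \<in> {1..k}" for j
  proof -
    have "\<not> p dvd int j" using that assms(2) by (auto dest: zdvd_imp_le)
    then have "coprime (int j) p" using assms(1) by (simp add: coprime_commute prime_imp_coprime)
    then show ?thesis using cong_solve_coprime_int by blast
  qed
  then obtain iv where iv: "[int j * iv j = 1] (mod p)" if "j \<in> {1..k}" for j by metis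
  \<comment> \<open>Termwise integration of the interpolant \<open>q\<close>, with
    \<open>iv j\<close> the inverse of \<open>j\<close> modulo \<open>p\<close>.\<close>
  define g where "g = (\<lambda>j. iv j * coeff q (j - 1))"
  define Q where "Q = (\<Sum>j=1..k. monom (g j) j)"
  define G where "G = (\<Sum>j=1..k. smult (g j) (\<phi> j))"
  have cQ: "coeff Q i = (if i \<in> {1..k} then g i else 0)" for i
    by (simp add: Q_def coeff_sum sum.delta)
  have GQ: "[coeff G i = coeff Q i] (mod p)" for i
  proof -
    have "[(\<Sum>j=1..k. g j * coeff (\<phi> j) i) = (\<Sum>j=1..k. g j * (if i = j then 1 else 0))] (mod p)"
      using assms(3) unfolding curve_def by (intro cong_sum cong_mult cong_refl) auto
    moreover have "(\<Sum>j=1..k. g j * (if i = j then 1 else 0)) = coeff Q i"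
      unfolding cQ by (simp add: if_distrib cong: if_cong)
    ultimately show ?thesis by (simp add: G_def coeff_sum)
  qed
  have Qq: "[coeff (pderiv Q) i = coeff q i] (mod p)" for i
  proof (cases "i < k")
    case True
    have "[(int (Suc i) * iv (Suc i)) * coeff q i = 1 * coeff q i] (mod p)"
      using True by (intro cong_mult cong_refl iv) auto
    then show ?thesis using True by (simp add: coeff_pderiv cQ g_def algebra_simps)
  next
    case False
    then show ?thesis using q(1) assms(4) by (simp add: coeff_pderiv cQ)
  qed
  have tay: "[taylor k \<phi> c g i = u] (mod p)"
    if "[coeff (pcompose q [:c, 1:]) (i - 1) = int i * u] (mod p)" "i \<in> {1..k}" for c i u
  proof -
    have "[coeff (pcompose Q [:c, 1:]) i = u] (mod p)"
      by (rule coeff_antiderivative_cong[where q = q, OF assms(1)]) (use that assms(2) Qq in auto)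
    moreover have "[taylor k \<phi> c g i = coeff (pcompose Q [:c, 1:]) i] (mod p)"
      unfolding taylor_def G_def[symmetric] by (intro pcompose_cong) (simp add: GQ)
    ultimately show ?thesis using cong_trans by blast
  qed
  have "[taylor k \<phi> \<xi> g i = t i] (mod p)" if "i \<in> {1..l}" for i
    using that assms(4) q(2)[rule_format, of "i - 1"] by (intro tay; cases i) (auto simp del: of_nat_Suc)
  moreover have "[taylor k \<phi> \<eta> g i = t' i] (mod p)" if "i \<in> {1..K}" for i
    using that assms(4) q(3)[rule_format, of "i - 1"] by (intro tay; cases i) (auto simp del: of_nat_Suc)
  ultimately show ?thesis by blast
qed

text \<open>Hensel lifting: the Taylor coefficients depend linearly on \<open>g\<close>.\<close>

lemma taylor_mod_prime_power:
  fixes p :: int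
  assumes "prime p" "int k < p" "curve p k \<phi>" "k = K + l" "K > 0 \<Longrightarrow> l > 0 \<Longrightarrow> \<not> p dvd (\<xi> - \<eta>)"
  shows "\<exists>g. (\<forall>i\<in>{1..l}. [taylor k \<phi> \<xi> g i = t i] (mod p ^ R)) \<and> (\<forall>i\<in>{1..K}. [taylor k \<phi> \<eta> g i = t' i] (mod p ^ R))"
proof (induction R arbitrary: t t')
  case (Suc R)
  obtain g where g: "\<forall>i\<in>{1..l}. [taylor k \<phi> \<xi> g i = t i] (mod p)" "\<forall>i\<in>{1..K}. [taylor k \<phi> \<eta> g i = t' i] (mod p)"
    using taylor_mod_prime[OF assms] by blast
  obtain h where h: "\<forall>i\<in>{1..l}. [taylor k \<phi> \<xi> h i = (t i - taylor k \<phi> \<xi> g i) div p] (mod p ^ R)"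
    "\<forall>i\<in>{1..K}. [taylor k \<phi> \<eta> h i = (t' i - taylor k \<phi> \<eta> g i) div p] (mod p ^ R)"
    using Suc[of "\<lambda>i. (t i - taylor k \<phi> \<xi> g i) div p" "\<lambda>i. (t' i - taylor k \<phi> \<eta> g i) div p"] by blast
  have lift: "[x + p * y = u] (mod p ^ Suc R)" if "[x = u] (mod p)" "[y = (u - x) div p] (mod p ^ R)" for x y u :: int
  proof -
    have "p dvd u - x" using that(1) by (metis cong_iff_dvd_diff cong_sym)
    then obtain v where v: "u - x = p * v" by auto
    have "p > 0" using assms(1) by (simp add: prime_gt_0_int)
    then have "[y = v] (mod p ^ R)" using that(2) v by simp
    then have "p ^ R dvd y - v" by (simp add: cong_iff_dvd_diff)
    then have "p * p ^ R dvd p * (y - v)" by simp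
    moreover have "p * (y - v) = x + p * y - u" using v by (simp add: algebra_simps)
    ultimately show ?thesis by (simp add: cong_iff_dvd_diff)
  qed
  show ?case
    by (rule exI[of _ "\<lambda>j. g j + p * h j"]) (use g h lift in \<open>auto simp only: taylor_add Ball_def\<close>)
qed auto

lemma poly_shift_expand:
  "poly G (c + x) = (\<Sum>i\<le>degree G. coeff (pcompose G [:c, 1:]) i * x ^ i)" for G :: "int poly"
proof -
  have "poly G (c + x) = poly (pcompose G [:c, 1:]) x" by (simp add: poly_pcompose add.commute)
  then show ?thesis by (simp add: poly_altdef degree_pcompose)
qed

text \<open>Frequency shifts along which the class of \<open>xi\<close> sees a rescaled \<open>l\<close>-dimensional curve \<open>psi\<close>, while the class
  of \<open>eta\<close> sees a constant.\<close>

lemma curve_shift: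
  fixes p :: int
  assumes "prime p" "int k < p" "curve p k \<phi>" "1 \<le> l" "l \<le> k" "1 \<le> a"
    and "l < k \<Longrightarrow> \<not> p dvd (\<xi> - \<eta>)" "l < k \<Longrightarrow> l * (a + n') \<le> (k - l + 1) * b" "l * (a + n') \<le> N"
  obtains \<tau> \<psi> c where "curve p l \<psi>"
    "\<And>i z. i \<in> {1..l} \<Longrightarrow> ip k \<phi> (\<tau> i) (\<xi> + p ^ a * z) = c i + p ^ (N - l * n') * poly (\<psi> i) z"
    "\<And>i y. i \<in> {1..l} \<Longrightarrow> l < k \<Longrightarrow> [y = \<eta>] (mod p ^ b) \<Longrightarrow>
      [ip k \<phi> (\<tau> i) y = ip k \<phi> (\<tau> i) \<eta>] (mod p ^ N)"
proof -
  \<comment> \<open>Enough precision to divide out \<open>p^(a*i)\<close> and still know the curve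
    modulo \<open>p\<close>, and to make the low orders at \<open>\<eta>\<close> vanish to the
    accuracy needed for constancy.\<close>
  define R where "R = l * (a + n') + 1"
  define K where "K = k - l"
  have p1: "p > 1" using assms(1) by (rule prime_gt_1_int)
  \<comment> \<open>For each \<open>i\<close>, a linear form that behaves on the curve like the
    \<open>i\<close>-th coordinate to order \<open>l\<close> at \<open>\<xi>\<close> and is flat to
    order \<open>k - l\<close> at \<open>\<eta>\<close>: in all \<open>k\<close> conditions on
    \<open>k\<close> unknowns.\<close>
  have "\<exists>g. (\<forall>i'\<in>{1..l}. [taylor k \<phi> \<xi> g i' = (if i' = i then 1 else 0)] (mod p ^ R)) \<and>
      (\<forall>i'\<in>{1..K}. [taylor k \<phi> \<eta> g i' = 0] (mod p ^ R))" for i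
    using assms by (intro taylor_mod_prime_power) (auto simp: K_def)
  then obtain g where g: "\<And>i i'. i' \<in> {1..l} \<Longrightarrow> [taylor k \<phi> \<xi> (g i) i' = (if i' = i then 1 else 0)] (mod p ^ R)"
      "\<And>i i'. i' \<in> {1..K} \<Longrightarrow> [taylor k \<phi> \<eta> (g i) i' = 0] (mod p ^ R)"
    by metis
  define G where "G = (\<lambda>i. \<Sum>j=1..k. smult (g i j) (\<phi> j))"
  have tay: "taylor k \<phi> c (g i) i' = coeff (pcompose (G i) [:c, 1:]) i'" for c i i'
    by (simp add: taylor_def G_def)
  have pG: "poly (G i) x = (\<Sum>j=1..k. g i j * poly (\<phi> j) x)" for i x
    by (simp add: G_def poly_sum)
  \<comment> \<open>On the class of \<open>\<xi>\<close> the \<open>i\<close>-th form has size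
    \<open>p^(a*i)\<close>. The factor brings all of them to the common size
    \<open>p^(N - l*n')\<close>, which leaves \<open>l*n'\<close> digits for the curve in
    \<open>l\<close> dimensions.\<close>
  define \<tau> where "\<tau> = (\<lambda>i j. p ^ (N - l * n' - a * i) * g i j)"
  have \<tau>: "ip k \<phi> (\<tau> i) x = p ^ (N - l * n' - a * i) * poly (G i) x" for i x
    by (simp add: \<tau>_def pG ip_def sum_distrib_left mult.assoc)
  have ile: "a * i \<le> l * a" if "i \<in> {1..l}" for i using that by simp
  have Req: "R = l * a + l * n' + 1" and N: "l * a + l * n' \<le> N"
    using assms(9) by (simp_all add: R_def algebra_simps)
  have Bb: "l * a + l * n' \<le> (k - l + 1) * b" if "l < k"
    using assms(8)[OF that] by (simp add: algebra_simps)
  define H where "H = (\<lambda>i. pcompose (G i) [:\<xi>, 1:])"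
  have H0: "poly (G i) (\<xi> + p ^ a * z) = poly (pcompose (H i) [:0, p ^ a:]) z" for i z
    by (simp add: H_def poly_pcompose algebra_simps)
  have cH: "coeff (pcompose (H i) [:0, p ^ a:] - [:coeff (H i) 0:]) n = (if n = 0 then 0 else p ^ (a * n) * coeff (H i) n)" for i n
    by (cases n) (auto simp: coeff_pcompose_linear power_mult power_add poly_0_coeff_0)
  have "\<exists>\<psi>. pcompose (H i) [:0, p ^ a:] - [:coeff (H i) 0:] = [:p ^ (a * i):] * \<psi>" if i: "i \<in> {1..l}" for i
  proof -
    have "p ^ (a * i) dvd coeff (pcompose (H i) [:0, p ^ a:] - [:coeff (H i) 0:]) n" for n
    proof (cases "n \<ge> i \<or> n = 0")
      case True
      then show ?thesis unfolding cH by (auto intro!: dvd_mult2 le_imp_power_dvd)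
    next
      case False
      then have "[taylor k \<phi> \<xi> (g i) n = 0] (mod p ^ R)" using g(1)[of n i] i by auto
      then have "p ^ R dvd coeff (H i) n" by (simp add: tay H_def cong_0_iff)
      moreover have "a * i \<le> R" using ile[OF i] Req by linarith
      ultimately show ?thesis unfolding cH
        by (auto intro!: dvd_mult intro: dvd_trans[OF le_imp_power_dvd])
    qed
    then have "[:p ^ (a * i):] dvd pcompose (H i) [:0, p ^ a:] - [:coeff (H i) 0:]"
      by (subst const_poly_dvd_iff) blast
    then show ?thesis unfolding dvd_def .
  qed
  then obtain \<psi> where \<psi>: "pcompose (H i) [:0, p ^ a:] - [:coeff (H i) 0:] = [:p ^ (a * i):] * \<psi> i" if "i \<in> {1..l}" for i
    by metis
  have c\<psi>: "p ^ (a * i) * coeff (\<psi> i) n = (if n = 0 then 0 else p ^ (a * n) * coeff (H i) n)" if "i \<in> {1..l}" for i n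
    using arg_cong[OF \<psi>[OF that], of "\<lambda>q. coeff q n"] cH[of i n] by simp
  have "[coeff (\<psi> i) n = (if n = i then 1 else 0)] (mod p)" if i: "i \<in> {1..l}" for i n
  proof -
    have pai: "p ^ (a * i) \<noteq> 0" using p1 by simp
    have aiR: "Suc (a * i) \<le> R" using ile[OF i] Req by linarith
    consider "n = 0" | "n = i" | "n \<in> {1..l}" "n \<noteq> i" | "n > l" by fastforce
    then show ?thesis
    proof cases
      case 1
      then show ?thesis using c\<psi>[OF i, of n] pai i by auto
    next
      case 2
      then have "coeff (\<psi> i) n = coeff (H i) n" using c\<psi>[OF i, of n] pai i by auto
      moreover have "[coeff (H i) n = 1] (mod p ^ R)" using g(1)[of n i] i 2 by (simp add: tay H_def)
      ultimately show ?thesis using 2 by (auto simp: R_def intro: cong_dvd_modulus)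
    next
      case 3
      then have "p ^ R dvd coeff (H i) n" using g(1)[of n i] by (simp add: tay H_def cong_0_iff)
      then have "p ^ Suc (a * i) dvd coeff (H i) n" using aiR by (meson dvd_trans le_imp_power_dvd)
      then have "p ^ (a * i) * p dvd p ^ (a * i) * coeff (\<psi> i) n"
        using c\<psi>[OF i, of n] 3 by (simp add: mult.commute)
      then show ?thesis using p1 3 by (simp add: cong_0_iff)
    next
      case 4
      \<comment> \<open>Orders above \<open>l\<close> at \<open>\<xi>\<close> are not controlled by
        \<open>g\<close>, but rescaling multiplies them by \<open>p^(a*n)\<close>, and
        \<open>n > i\<close> with \<open>a >= 1\<close> gives a spare factor
        \<open>p\<close>.\<close>
      have "Suc (a * i) \<le> a * Suc i" using assms(6) by simp
      also have "\<dots> \<le> a * n" using 4 i by (intro mult_le_mono) auto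
      finally have "p ^ Suc (a * i) dvd p ^ (a * n)" by (rule le_imp_power_dvd)
      then have "p ^ (a * i) * p dvd p ^ (a * i) * coeff (\<psi> i) n"
        using c\<psi>[OF i, of n] 4 by (simp add: mult.commute)
      then show ?thesis using p1 4 i by (simp add: cong_0_iff)
    qed
  qed
  then have cur: "curve p l \<psi>" unfolding curve_def by blast
  have A: "ip k \<phi> (\<tau> i) (\<xi> + p ^ a * z) =
      p ^ (N - l * n' - a * i) * coeff (H i) 0 + p ^ (N - l * n') * poly (\<psi> i) z" if i: "i \<in> {1..l}" for i z
  proof -
    have "pcompose (H i) [:0, p ^ a:] = [:coeff (H i) 0:] + [:p ^ (a * i):] * \<psi> i"
      using \<psi>[OF i] by (metis diff_eq_eq add.commute)
    then have "poly (G i) (\<xi> + p ^ a * z) = coeff (H i) 0 + p ^ (a * i) * poly (\<psi> i) z"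
      unfolding H0 by simp
    moreover have "N - l * n' - a * i + a * i = N - l * n'"
      using N ile[OF i] by linarith
    then have "p ^ (N - l * n' - a * i) * p ^ (a * i) = p ^ (N - l * n')" by (simp add: power_add[symmetric])
    ultimately show ?thesis unfolding \<tau> by (simp only: distrib_left mult.assoc[symmetric])
  qed
  have Bd: "[ip k \<phi> (\<tau> i) y = ip k \<phi> (\<tau> i) \<eta>] (mod p ^ N)"
    if i: "i \<in> {1..l}" and lk: "l < k" and y: "[y = \<eta>] (mod p ^ b)" for i y
  proof -
    obtain x where x: "y = \<eta> + p ^ b * x" using cong_sym[OF y] by (auto simp: cong_iff_lin)
    define M where "M = l * n' + a * i"
    have M: "M \<le> R" "M \<le> (k - l + 1) * b" "M \<le> N"
      using ile[OF i] Bb[OF lk] N Req unfolding M_def by linarith+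
    \<comment> \<open>Orders up to \<open>k - l\<close> vanish modulo \<open>p^R\<close> by the
      choice of \<open>g\<close>; higher orders contain at least \<open>k - l + 1\<close> factors
      \<open>y - \<eta>\<close>, each divisible by \<open>p^b\<close>.\<close>
    have "p ^ M dvd coeff (pcompose (G i) [:\<eta>, 1:]) n * (p ^ b * x) ^ n" if "n \<ge> 1" for n
    proof (cases "n \<le> K")
      case True
      then have "p ^ R dvd coeff (pcompose (G i) [:\<eta>, 1:]) n" using g(2)[of n i] that by (simp add: tay cong_0_iff)
      then show ?thesis using M(1) by (meson dvd_mult2 dvd_trans le_imp_power_dvd)
    next
      case False
      then have "(k - l + 1) * b \<le> n * b" by (intro mult_le_mono) (auto simp: K_def)
      then have "M \<le> b * n" using M(2) by (simp add: mult.commute)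
      then show ?thesis by (simp add: power_mult_distrib power_mult[symmetric] dvd_mult dvd_mult2 le_imp_power_dvd)
    qed
    then have "p ^ M dvd (\<Sum>n\<in>{..degree (G i)} - {0}. coeff (pcompose (G i) [:\<eta>, 1:]) n * (p ^ b * x) ^ n)"
      by (intro dvd_sum) auto
    moreover have "poly (G i) y = coeff (pcompose (G i) [:\<eta>, 1:]) 0 +
        (\<Sum>n\<in>{..degree (G i)} - {0}. coeff (pcompose (G i) [:\<eta>, 1:]) n * (p ^ b * x) ^ n)"
      unfolding x poly_shift_expand by (subst sum.remove[of _ 0]) auto
    moreover have "coeff (pcompose (G i) [:\<eta>, 1:]) 0 = poly (G i) \<eta>"
      by (simp add: poly_0_coeff_0[symmetric] poly_pcompose)
    ultimately have "p ^ M dvd poly (G i) y - poly (G i) \<eta>" by simp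
    then have "p ^ (N - M) * p ^ M dvd p ^ (N - M) * (poly (G i) y - poly (G i) \<eta>)" by simp
    moreover have "p ^ (N - M) * p ^ M = p ^ N" using M(3) by (simp add: power_add[symmetric])
    ultimately have "p ^ N dvd p ^ (N - l * n' - a * i) * (poly (G i) y - poly (G i) \<eta>)"
      by (simp only: M_def diff_diff_left)
    then show ?thesis unfolding \<tau> cong_iff_dvd_diff by (simp only: right_diff_distrib)
  qed
  show thesis by (rule that[OF cur A Bd])
qed

section \<open>Bilinear estimates\<close>

lemma mean_holder:
  assumes "Q > 0" "\<And>\<alpha>. F \<alpha> \<ge> 0" "\<And>\<alpha>. G \<alpha> \<ge> 0" "0 < \<theta>" "\<theta> < 1"
  shows "mean k Q (\<lambda>\<alpha>. F \<alpha> powr \<theta> * G \<alpha> powr (1 - \<theta>)) \<le> mean k Q F powr \<theta> * mean k Q G powr (1 - \<theta>)"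
proof -
  define N where "N = (of_int Q ^ k :: real)"
  have N: "N > 0" using assms(1) by (simp add: N_def)
  have "(\<Sum>\<alpha>\<in>bx k Q. F \<alpha> powr \<theta> * G \<alpha> powr (1 - \<theta>)) \<le>
      (\<Sum>\<alpha>\<in>bx k Q. F \<alpha>) powr \<theta> * (\<Sum>\<alpha>\<in>bx k Q. G \<alpha>) powr (1 - \<theta>)"
    using assms by (intro holder_sum) auto
  then have "mean k Q (\<lambda>\<alpha>. F \<alpha> powr \<theta> * G \<alpha> powr (1 - \<theta>)) \<le>
     (\<Sum>\<alpha>\<in>bx k Q. F \<alpha>) powr \<theta> * (\<Sum>\<alpha>\<in>bx k Q. G \<alpha>) powr (1 - \<theta>) / N"
    unfolding mean_def N_def[symmetric] using N by (intro divide_right_mono) auto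
  also have "\<dots> = mean k Q F powr \<theta> * mean k Q G powr (1 - \<theta>)"
  proof -
    have "N powr \<theta> * N powr (1 - \<theta>) = N" using N by (simp add: powr_add[symmetric])
    then show ?thesis unfolding mean_def N_def[symmetric]
      using assms N by (simp add: powr_divide sum_nonneg)
  qed
  finally show ?thesis .
qed

lemma power_interpolate:
  fixes u v :: real
  assumes "u \<ge> 0" "v \<ge> 0" "0 < \<theta>" "\<theta> < 1"
    "real m = real m1 * \<theta> + real m2 * (1 - \<theta>)" "real m' = real n1 * \<theta> + real n2 * (1 - \<theta>)"
  shows "u ^ m * v ^ m' = (u ^ m1 * v ^ n1) powr \<theta> * (u ^ m2 * v ^ n2) powr (1 - \<theta>)"
proof -
  have "(x ^ i) powr \<theta> * (x ^ j) powr (1 - \<theta>) = x ^ r" if "x \<ge> 0" "real r = real i * \<theta> + real j * (1 - \<theta>)" for x i j r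
    using that assms(3,4) by (simp add: rpow_of_nat[symmetric] rpow_powr rpow_add)
  note eq = this[OF assms(1,5)] this[OF assms(2,6)]
  show ?thesis
    unfolding eq[symmetric] using assms(1,2) by (simp add: powr_mult mult_ac)
qed

text \<open>All terms are rotated by the same unimodular factor.\<close>

lemma expsum_shift_const:
  assumes "Q > 0" and "\<And>i y. i \<in> {1..l} \<Longrightarrow> y \<in> B \<Longrightarrow> [ip k \<phi> (\<tau> i) y = c i] (mod Q)"
  shows "norm (expsum k Q \<phi> w B (shift l \<tau> \<beta> \<alpha>)) = norm (expsum k Q \<phi> w B \<alpha>)"
proof -
  define c0 where "c0 = (\<Sum>i=1..l. \<beta> i * c i)"
  have ipeq: "[ip k \<phi> (shift l \<tau> \<beta> \<alpha>) y = ip k \<phi> \<alpha> y + c0] (mod Q)" if "y \<in> B" for y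
    unfolding c0_def ip_shift using assms(2) that by (auto intro!: cong_add cong_sum cong_mult)
  have "expsum k Q \<phi> w B (shift l \<tau> \<beta> \<alpha>) = e (of_int c0 / of_int Q) * expsum k Q \<phi> w B \<alpha>"
    unfolding expsum_def sum_distrib_left
  proof (intro sum.cong refl)
    fix y assume "y \<in> B"
    have "e (of_int (ip k \<phi> (shift l \<tau> \<beta> \<alpha>) y) / of_int Q) =
       e (of_int (ip k \<phi> \<alpha> y) / of_int Q) * e (of_int c0 / of_int Q)"
      using e_cong[OF assms(1) ipeq[OF \<open>y \<in> B\<close>]] by (simp add: add_divide_distrib e_add)
    then show "w y * e (of_int (ip k \<phi> (shift l \<tau> \<beta> \<alpha>) y) / of_int Q) =
         e (of_int c0 / of_int Q) * (w y * e (of_int (ip k \<phi> \<alpha> y) / of_int Q))" by simp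
  qed
  then show ?thesis by (simp add: norm_mult)
qed

locale curve_sum =
  fixes p :: int and k n :: nat and \<phi> :: "nat \<Rightarrow> int poly" and w :: "int \<Rightarrow> complex" and A :: "int set"
  assumes p: "prime p" "int k < p" and k: "1 \<le> k" and curve: "curve p k \<phi>" and finA: "finite A"
begin

definition "Q = p ^ (k * n)"
definition "P = k * (k + 1)"
definition "f a \<xi> \<alpha> = norm (expsum k Q \<phi> w (cls p a \<xi> A) \<alpha>)"
text \<open>The moments over the finest classes modulo \<open>p^n\<close> are the units in which
  every bound of the locale is expressed.\<close>

definition "g \<theta> = mean k Q (\<lambda>\<alpha>. f n \<theta> \<alpha> ^ P)"
definition "S a \<xi> = (\<Sum>\<theta>\<in>{\<theta>\<in>{0..<p ^ n}. \<theta> mod p ^ a = \<xi>}. g \<theta>)"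
text \<open>The prediction for the \<open>P\<close>-th moment over the class \<open>\<xi>\<close>
  under square root cancellation between its \<open>p^(n-a)\<close> finest subclasses.\<close>

definition "Av a \<xi> = of_int p ^ ((n - a) * (P div 2 - 1)) * S a \<xi>"
definition "tt l = real (l * (l + 1)) / real P"
definition "bi l a \<xi> b \<eta> = mean k Q (\<lambda>\<alpha>. f a \<xi> \<alpha> ^ (l * (l + 1)) * f b \<eta> \<alpha> ^ (P - l * (l + 1)))"
text \<open>Distinct residues modulo \<open>p\<close> express transversality. The comparison is with
  a geometric mean of the two local predictions, weighted by the share of the \<open>P\<close>
  factors that each class carries: this form is reproduced exactly by Hoelder's inequality and by
  summation over subclasses of \<open>\<xi>\<close>.\<close>

definition "Bil l a b K \<longleftrightarrow> (\<forall>\<xi>\<in>{0..<p ^ a}. \<forall>\<eta>\<in>{0..<p ^ b}. \<xi> mod p \<noteq> \<eta> mod p \<longrightarrow>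
   bi l a \<xi> b \<eta>
     \<le> K * rpow (Av a \<xi>) (tt l) * rpow (Av b \<eta>) (1 - tt l))"

lemma p1: "p > 1" using p(1) by (rule prime_gt_1_int)

lemma Q0: "Q > 0" using p1 by (simp add: Q_def)

lemma P2: "P \<ge> 2" "even P" "real (P div 2 - 1) = real P / 2 - 1"
proof -
  show "even P" by (simp add: P_def)
  show "P \<ge> 2" using mult_le_mono[OF k, of 2 "k + 1"] k by (simp add: P_def)
  then have "P div 2 \<ge> 1" by simp
  then show "real (P div 2 - 1) = real P / 2 - 1" using \<open>even P\<close> by (simp add: of_nat_diff real_of_nat_div)
qed

lemma f_nonneg [simp]: "f a \<xi> \<alpha> \<ge> 0" by (simp add: f_def)

lemma g_nonneg [simp]: "g \<theta> \<ge> 0" unfolding g_def using Q0 by (intro mean_nonneg) auto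

lemma S_nonneg [simp]: "S a \<xi> \<ge> 0" unfolding S_def by (intro sum_nonneg) auto

lemma Av_nonneg [simp]: "Av a \<xi> \<ge> 0" unfolding Av_def using p1 by simp

lemma tt: "l < k \<Longrightarrow> tt l < 1" "tt l \<ge> 0" "l \<ge> 1 \<Longrightarrow> tt l > 0"
proof -
  have P0: "real P > 0" using P2 by simp
  show "tt l < 1" if "l < k"
  proof -
    have "l * (l + 1) < k * (k + 1)" using that by (intro mult_strict_mono) auto
    then have "real (l * (l + 1)) < real P" by (simp only: P_def of_nat_less_iff)
    then show ?thesis using P0 by (simp only: tt_def divide_less_eq_1_pos)
  qed
  show "tt l \<ge> 0" using P0 by (simp add: tt_def)
  show "tt l > 0" if "l \<ge> 1"
  proof -
    have "0 < real (l * (l + 1))" using that by (simp only: of_nat_0_less_iff) simp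
    then show ?thesis unfolding tt_def using P0 by (intro divide_pos_pos)
  qed
qed

lemma tt0 [simp]: "tt 0 = 0" by (simp add: tt_def)

lemma Pl_le: "l \<le> k \<Longrightarrow> l * (l + 1) \<le> P"
  unfolding P_def by (intro mult_le_mono) auto

lemma S_refine:
  assumes "0 \<le> \<xi>" "\<xi> < p ^ a"
  shows "(\<Sum>\<theta>\<in>{0..<p ^ m}. S (a + m) (\<xi> + p ^ a * \<theta>)) = S a \<xi>"
proof -
  have md: "x mod p ^ (a + m) = p ^ a * (x div p ^ a mod p ^ m) + x mod p ^ a" for x
    using p1 by (simp add: power_add zmod_zmult2_eq)
  have eq: "x mod p ^ (a + m) = \<xi> + p ^ a * \<theta> \<longleftrightarrow> x mod p ^ a = \<xi> \<and> x div p ^ a mod p ^ m = \<theta>" for x \<theta>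
  proof
    assume h: "x mod p ^ (a + m) = \<xi> + p ^ a * \<theta>"
    then have h2: "p ^ a * (x div p ^ a mod p ^ m) + x mod p ^ a = \<xi> + p ^ a * \<theta>" by (simp only: md)
    have "(p ^ a * (x div p ^ a mod p ^ m) + x mod p ^ a) mod p ^ a = (\<xi> + p ^ a * \<theta>) mod p ^ a"
      by (simp only: h2)
    then have x: "x mod p ^ a = \<xi>" using assms by simp
    then show "x mod p ^ a = \<xi> \<and> x div p ^ a mod p ^ m = \<theta>" using h2 p1 by simp
  qed (simp add: md)
  define T where "T = {\<theta>\<in>{0..<p ^ n}. \<theta> mod p ^ a = \<xi>}"
  have finT: "finite T" unfolding T_def by (rule finite_subset[of _ "{0..<p ^ n}"]) auto
  have "S (a + m) (\<xi> + p ^ a * \<theta>) = (\<Sum>x\<in>{x\<in>T. x div p ^ a mod p ^ m = \<theta>}. g x)" for \<theta>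
    unfolding S_def eq by (intro sum.cong) (auto simp: T_def)
  then have "(\<Sum>\<theta>\<in>{0..<p ^ m}. S (a + m) (\<xi> + p ^ a * \<theta>)) = (\<Sum>x\<in>T. g x)"
    using p1 by (simp only:) (intro sum.group[OF finT], auto)
  then show ?thesis by (simp add: S_def T_def)
qed

lemma S_top: "0 \<le> \<theta> \<Longrightarrow> \<theta> < p ^ n \<Longrightarrow> S n \<theta> = g \<theta>"
proof -
  assume "0 \<le> \<theta>" "\<theta> < p ^ n"
  then have "{x\<in>{0..<p ^ n}. x mod p ^ n = \<theta>} = {\<theta>}" by auto
  then show ?thesis by (simp add: S_def)
qed

lemma refine_range:
  assumes "0 \<le> \<xi>" "\<xi> < p ^ a" "0 \<le> \<theta>" "\<theta> < p ^ m"
  shows "0 \<le> \<xi> + p ^ a * \<theta>" "\<xi> + p ^ a * \<theta> < p ^ (a + m)"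
proof -
  show "0 \<le> \<xi> + p ^ a * \<theta>" using assms p1 by simp
  have "\<xi> + p ^ a * \<theta> < p ^ a * (\<theta> + 1)" using assms by (simp add: distrib_left)
  also have "\<dots> \<le> p ^ a * p ^ m" using assms p1 by (intro mult_left_mono) auto
  finally show "\<xi> + p ^ a * \<theta> < p ^ (a + m)" by (simp add: power_add)
qed

text \<open>Affine rescaling: the case \<open>l = k\<close> of the shifts, in which the second
  centre and its scale are dummies. A class modulo \<open>p^b\<close> sees a curve of the same type
  and has only \<open>n - b\<close> digits left to decouple.\<close>

lemma rescaled_dec:
  assumes "dec p k (n - b) D" "1 \<le> b" "b \<le> n" "0 \<le> \<eta>" "\<eta> < p ^ b"
  shows "mean k Q (\<lambda>\<alpha>. f b \<eta> \<alpha> ^ P) \<le> D * Av b \<eta>"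
proof -
  obtain \<tau> \<psi> c where cs: "curve p k \<psi>"
    "\<And>i z. i \<in> {1..k} \<Longrightarrow> ip k \<phi> (\<tau> i) (\<eta> + p ^ b * z) = c i + p ^ (k * n - k * (n - b)) * poly (\<psi> i) z"
    by (rule curve_shift[OF p curve k le_refl assms(2), of \<eta> 0 "n - b" 0 "k * n"]) (use assms in auto)
  have "Q = p ^ (k * (n - b)) * p ^ (k * n - k * (n - b))"
    by (simp add: Q_def power_add[symmetric] mult_le_mono2)
  from dec_transfer[where W = "\<lambda>_. 1", OF assms(1) p1 this _ cs(2,1) finA assms(4,5)]
  have "mean k Q (\<lambda>\<alpha>. f b \<eta> \<alpha> ^ P) \<le> D * of_int p ^ ((n - b) * (P div 2 - 1)) *
       (\<Sum>\<theta>\<in>{0..<p ^ (n - b)}. mean k Q (\<lambda>\<alpha>. f n (\<eta> + p ^ b * \<theta>) \<alpha> ^ P))"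
    using p1 assms(3) by (simp add: periodic_def f_def P_def)
  also have "(\<Sum>\<theta>\<in>{0..<p ^ (n - b)}. mean k Q (\<lambda>\<alpha>. f n (\<eta> + p ^ b * \<theta>) \<alpha> ^ P)) = (\<Sum>\<theta>\<in>{0..<p ^ (n - b)}. S (b + (n - b)) (\<eta> + p ^ b * \<theta>))"
  proof (intro sum.cong refl)
    fix \<theta> assume "\<theta> \<in> {0..<p ^ (n - b)}"
    then show "mean k Q (\<lambda>\<alpha>. f n (\<eta> + p ^ b * \<theta>) \<alpha> ^ P) = S (b + (n - b)) (\<eta> + p ^ b * \<theta>)"
      using refine_range[of \<eta> b \<theta> "n - b"] assms by (simp add: S_top g_def)
  qed
  also have "\<dots> = S b \<eta>" using assms by (intro S_refine)
  finally show ?thesis by (simp add: Av_def)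
qed

text \<open>Here the factor of \<open>\<xi>\<close> is absent. The source of all gains: since
  \<open>\<eta>\<close> is already localised at scale \<open>b\<close>, the constant for
  \<open>n - b\<close> takes the place of that for \<open>n\<close>.\<close>

lemma Bil_zero:
  assumes "dec p k (n - b) D" "1 \<le> b" "b \<le> n"
  shows "Bil 0 a b D"
  unfolding Bil_def using rescaled_dec[OF assms] by (auto simp: bi_def rpow_def)

lemma bi_nonneg: "bi l a \<xi> b \<eta> \<ge> 0"
  unfolding bi_def using Q0 by (intro mean_nonneg) auto

lemma Bil_mono: "Bil l a b K \<Longrightarrow> K \<le> K' \<Longrightarrow> Bil l a b K'"
  unfolding Bil_def by (meson mult_right_mono order_trans rpow_nonneg)

text \<open>Hoelder's inequality separates the two classes and each is rescaled on its own.
  Transversality brings nothing here; this is the start of the iteration for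
  \<open>l >= 1\<close>.\<close>

lemma Bil_trivial:
  assumes "dec p k (n - a) D" "dec p k (n - b) D" "1 \<le> a" "a \<le> n" "1 \<le> b" "b \<le> n" "1 \<le> l" "l < k" "D \<ge> 0"
  shows "Bil l a b D"
  unfolding Bil_def
proof (intro ballI impI)
  fix \<xi> \<eta> assume r: "\<xi> \<in> {0..<p ^ a}" "\<eta> \<in> {0..<p ^ b}"
  have t: "0 < tt l" "tt l < 1" using tt assms by auto
  have P0: "real P > 0" using P2 by simp
  have Pl: "l * (l + 1) \<le> P" using assms by (intro Pl_le) auto
  have "bi l a \<xi> b \<eta>
    = mean k Q (\<lambda>\<alpha>. (f a \<xi> \<alpha> ^ P) powr tt l * (f b \<eta> \<alpha> ^ P) powr (1 - tt l))"
    unfolding bi_def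
  proof (rule mean_cong)
    fix \<alpha>
    have "real (l * (l + 1)) = real P * tt l + real 0 * (1 - tt l)" "real (P - l * (l + 1)) = real 0 * tt l + real P * (1 - tt l)"
      using P0 Pl by (auto simp: tt_def of_nat_diff field_simps)
    from power_interpolate[OF f_nonneg f_nonneg t this, of a \<xi> \<alpha> b \<eta> \<alpha>]
    show "f a \<xi> \<alpha> ^ (l * (l + 1)) * f b \<eta> \<alpha> ^ (P - l * (l + 1)) = (f a \<xi> \<alpha> ^ P) powr tt l * (f b \<eta> \<alpha> ^ P) powr (1 - tt l)"
      by simp
  qed
  also have "\<dots> \<le> mean k Q (\<lambda>\<alpha>. f a \<xi> \<alpha> ^ P) powr tt l * mean k Q (\<lambda>\<alpha>. f b \<eta> \<alpha> ^ P) powr (1 - tt l)"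
    using t Q0 by (intro mean_holder) auto
  also have "\<dots> \<le> (D * Av a \<xi>) powr tt l * (D * Av b \<eta>) powr (1 - tt l)"
    using t Q0 r assms by (intro mult_mono powr_mono2 rescaled_dec mean_nonneg) auto
  also have "\<dots> = D * rpow (Av a \<xi>) (tt l) * rpow (Av b \<eta>) (1 - tt l)"
  proof -
    have "D powr tt l * D powr (1 - tt l) = D" using assms(9) t by (cases "D = 0") (auto simp: powr_add[symmetric])
    then show ?thesis using t assms(9) by (simp add: powr_mult rpow_def)
  qed
  finally show "bi l a \<xi> b \<eta>
     \<le> D * rpow (Av a \<xi>) (tt l) * rpow (Av b \<eta>) (1 - tt l)" .
qed

text \<open>With \<open>c = k - l\<close> and \<open>\<theta> = 1/(c+1)\<close>, the exponent
  \<open>l*(l+1)\<close> is \<open>\<theta> * (P - c*(c+1)) + (1-\<theta>) * (l-1)*l\<close>. In the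
  first of the two means the classes have exchanged their roles, so that \<open>\<eta>\<close> is
  the next one to be refined.\<close>

lemma Bil_holder:
  assumes "Bil (k - l) b a K1" "Bil (l - 1) a b K2" "1 \<le> l" "l < k" "K1 \<ge> 0" "K2 \<ge> 0"
    and \<theta>: "\<theta> = 1 / (real k - real l + 1)"
  shows "Bil l a b (K1 powr \<theta> * K2 powr (1 - \<theta>))"
  unfolding Bil_def
proof (intro ballI impI)
  fix \<xi> \<eta> assume r: "\<xi> \<in> {0..<p ^ a}" "\<eta> \<in> {0..<p ^ b}" and ne: "\<xi> mod p \<noteq> \<eta> mod p"
  have "real k - real l + 1 > 1" using assms(4) by simp
  then have th: "0 < \<theta>" "\<theta> < 1" unfolding \<theta> by simp_all
  obtain c where c: "k = l + c" "c \<ge> 1" using assms(4) by (metis less_imp_add_positive One_nat_def Suc_leI)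
  obtain l' where l': "l = Suc l'" using assms(3) by (cases l) auto
  have P0: "real P > 0" using P2 by simp
  have Pr: "real P = (real l' + 1 + real c) * (real l' + 1 + real c + 1)" unfolding P_def by (simp add: c l' algebra_simps)
  have \<theta>c: "\<theta> = 1 / (real c + 1)" by (simp add: \<theta> c)
  have \<theta>1: "(real c + 1) * \<theta> = 1" by (simp add: \<theta>c)
  have e1: "real (l * (l + 1)) = real (P - (k - l) * (k - l + 1)) * \<theta> + real ((l - 1) * (l - 1 + 1)) * (1 - \<theta>)"
    and e2: "real (P - l * (l + 1)) = real ((k - l) * (k - l + 1)) * \<theta> + real (P - (l - 1) * (l - 1 + 1)) * (1 - \<theta>)"
  proof -
    have le: "l * (l + 1) \<le> P" "(k - l) * (k - l + 1) \<le> P" "(l - 1) * (l - 1 + 1) \<le> P"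
      using Pl_le[of l] Pl_le[of "k - l"] Pl_le[of "l - 1"] assms by simp_all
    have k: "real (k - l) = real c" "real (l - 1) = real l'" "real l = real l' + 1" by (simp_all add: c l')
    show "real (l * (l + 1)) = real (P - (k - l) * (k - l + 1)) * \<theta> + real ((l - 1) * (l - 1 + 1)) * (1 - \<theta>)"
      using le by (simp only: of_nat_diff of_nat_mult of_nat_add of_nat_1 k Pr) (use \<theta>1 in algebra)
    show "real (P - l * (l + 1)) = real ((k - l) * (k - l + 1)) * \<theta> + real (P - (l - 1) * (l - 1 + 1)) * (1 - \<theta>)"
      using le by (simp only: of_nat_diff of_nat_mult of_nat_add of_nat_1 k Pr) (use \<theta>1 in algebra)
  qed
  have t1: "tt l = (1 - tt (k - l)) * \<theta> + tt (l - 1) * (1 - \<theta>)"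
  proof -
    have "real P - real ((k - l) * (k - l + 1)) = real (P - (k - l) * (k - l + 1))"
      using Pl_le[of "k - l"] by (simp add: of_nat_diff)
    then have "1 - tt (k - l) = real (P - (k - l) * (k - l + 1)) / real P"
      using P0 unfolding tt_def by (simp add: diff_divide_distrib[symmetric] field_simps)
    then show ?thesis unfolding tt_def[of l] e1
      by (simp only: add_divide_distrib times_divide_eq_left tt_def)
  qed
  have t2: "1 - tt l = tt (k - l) * \<theta> + (1 - tt (l - 1)) * (1 - \<theta>)"
    unfolding t1 by (simp add: algebra_simps)
  have ttp: "tt (k - l) \<ge> 0" "1 - tt (k - l) \<ge> 0" "tt (l - 1) \<ge> 0" "1 - tt (l - 1) \<ge> 0"
    using tt(1)[of "k - l"] tt(1)[of "l - 1"] tt(2) assms by (auto simp: less_imp_le)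
  have "bi l a \<xi> b \<eta> =
     mean k Q (\<lambda>\<alpha>. (f b \<eta> \<alpha> ^ ((k - l) * (k - l + 1)) * f a \<xi> \<alpha> ^ (P - (k - l) * (k - l + 1))) powr \<theta> *
       (f a \<xi> \<alpha> ^ ((l - 1) * (l - 1 + 1)) * f b \<eta> \<alpha> ^ (P - (l - 1) * (l - 1 + 1))) powr (1 - \<theta>))"
    unfolding bi_def
    by (intro mean_cong, subst power_interpolate[OF _ _ th e1 e2]) (simp_all add: mult.commute)
  also have "\<dots> \<le> bi (k - l) b \<eta> a \<xi> powr \<theta> * bi (l - 1) a \<xi> b \<eta> powr (1 - \<theta>)"
    unfolding bi_def using th Q0 by (intro mean_holder) auto
  also have "\<dots> \<le> (K1 * rpow (Av b \<eta>) (tt (k - l)) * rpow (Av a \<xi>) (1 - tt (k - l))) powr \<theta> *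
      (K2 * rpow (Av a \<xi>) (tt (l - 1)) * rpow (Av b \<eta>) (1 - tt (l - 1))) powr (1 - \<theta>)"
    using assms(1,2) r ne th unfolding Bil_def by (intro mult_mono powr_mono2 bi_nonneg) auto
  also have "\<dots> = (K1 powr \<theta> * K2 powr (1 - \<theta>)) *
     (rpow (Av a \<xi>) ((1 - tt (k - l)) * \<theta>) * rpow (Av a \<xi>) (tt (l - 1) * (1 - \<theta>))) *
     (rpow (Av b \<eta>) (tt (k - l) * \<theta>) * rpow (Av b \<eta>) ((1 - tt (l - 1)) * (1 - \<theta>)))"
    using assms(5,6) th ttp by (simp add: powr_mult rpow_powr)
  also have "\<dots> = K1 powr \<theta> * K2 powr (1 - \<theta>) * rpow (Av a \<xi>) (tt l) * rpow (Av b \<eta>) (1 - tt l)"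
    using th ttp unfolding t2 by (simp add: rpow_add t1[symmetric] del: One_nat_def)
  finally show "bi l a \<xi> b \<eta>
     \<le> K1 powr \<theta> * K2 powr (1 - \<theta>) * rpow (Av a \<xi>) (tt l) * rpow (Av b \<eta>) (1 - tt l)" .
qed

text \<open>The relation between \<open>a + m\<close> and \<open>b\<close> describes the finest
  scale to which \<open>\<xi>\<close> can be refined while the sum over \<open>\<eta>\<close> stays
  constant along the shifts. Nothing but the constant of decoupling in degree \<open>l\<close> is
  lost.\<close>

lemma Bil_step:
  assumes dec: "dec p l m K1" and Bil: "Bil l (a + m) b K" and l: "1 \<le> l" "l < k" and "1 \<le> a" "1 \<le> b" "a + m \<le> n"
    and lab: "l * (a + m) = (k - l + 1) * b" and K: "K1 \<ge> 0" "K \<ge> 0"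
  shows "Bil l a b (K1 * K)"
  unfolding Bil_def
proof (intro ballI impI)
  fix \<xi> \<eta> assume r: "\<xi> \<in> {0..<p ^ a}" "\<eta> \<in> {0..<p ^ b}" and ne: "\<xi> mod p \<noteq> \<eta> mod p"
  define a' where "a' = a + m"
  have nd: "\<not> p dvd \<xi> - \<eta>" using ne by (simp add: mod_eq_dvd_iff)
  have N: "l * (a + m) \<le> k * n" using l assms(7) by (intro mult_le_mono) auto
  obtain \<tau> \<psi> c where cs: "curve p l \<psi>"
    "\<And>i z. i \<in> {1..l} \<Longrightarrow> ip k \<phi> (\<tau> i) (\<xi> + p ^ a * z) = c i + p ^ (k * n - l * m) * poly (\<psi> i) z"
    "\<And>i y. i \<in> {1..l} \<Longrightarrow> l < k \<Longrightarrow> [y = \<eta>] (mod p ^ b) \<Longrightarrow>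
      [ip k \<phi> (\<tau> i) y = ip k \<phi> (\<tau> i) \<eta>] (mod p ^ (k * n))"
  proof (rule curve_shift[OF p curve l(1) less_imp_le[OF l(2)] assms(5), of \<xi> \<eta> m b "k * n"])
    show "\<not> p dvd \<xi> - \<eta>" by (rule nd)
    show "l * (a + m) \<le> (k - l + 1) * b" using lab by simp
    show "l * (a + m) \<le> k * n" by (rule N)
  qed (rule that, assumption+)
  define W where "W = (\<lambda>\<alpha>. f b \<eta> \<alpha> ^ (P - l * (l + 1)))"
  have W1: "periodic k Q W" unfolding W_def f_def
    by (intro periodic_comp[where h = "\<lambda>x. norm x ^ (P - l * (l + 1))"] periodic_expsum Q0)
  have W2: "W \<alpha> \<ge> 0" for \<alpha> by (simp add: W_def)
  have W3: "W (shift l \<tau> \<beta> \<alpha>) = W \<alpha>" for \<alpha> \<beta>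
    unfolding W_def f_def
  proof (subst expsum_shift_const[where c = "\<lambda>i. ip k \<phi> (\<tau> i) \<eta>", OF Q0])
    fix i y assume "i \<in> {1..l}" "y \<in> cls p b \<eta> A"
    then show "[ip k \<phi> (\<tau> i) y = ip k \<phi> (\<tau> i) \<eta>] (mod Q)"
      unfolding Q_def using r l by (intro cs(3)) (auto simp: cls_def cong_def)
  qed simp
  have lm: "l * m \<le> k * n" using l assms(7) by (intro mult_le_mono) auto
  have QQ: "Q = p ^ (l * m) * p ^ (k * n - l * m)"
    using lm by (simp add: Q_def power_add[symmetric])
  define D where "D = (of_int p ^ (m * (l * (l + 1) div 2 - 1)) :: real)"
  define X where "X = rpow (Av b \<eta>) (1 - tt l)"
  have D0: "D \<ge> 0" using p1 by (simp add: D_def)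
  have t: "0 < tt l" "tt l < 1" using tt l by auto
  have Wbi: "mean k Q (\<lambda>\<alpha>. W \<alpha> * f c \<zeta> \<alpha> ^ (l * (l + 1))) = bi l c \<zeta> b \<eta>" for c \<zeta>
    by (simp add: bi_def W_def mult.commute)
  have "bi l a \<xi> b \<eta> \<le> K1 * D * (\<Sum>\<theta>\<in>{0..<p ^ m}. bi l a' (\<xi> + p ^ a * \<theta>) b \<eta>)"
    unfolding Wbi[symmetric] f_def D_def a'_def
    by (rule dec_transfer[OF dec p1 QQ _ cs(2) cs(1) finA _ _ W1 W2 W3]) (use p1 r in auto)
  also have "\<dots> \<le> K1 * D * (\<Sum>\<theta>\<in>{0..<p ^ m}. K * rpow (Av a' (\<xi> + p ^ a * \<theta>)) (tt l) * X)"
  proof (intro mult_left_mono sum_mono)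
    fix \<theta> assume \<theta>: "\<theta> \<in> {0..<p ^ m}"
    have "(\<xi> + p ^ a * \<theta>) mod p = \<xi> mod p" using assms(5) by (cases a) (auto simp: mult.assoc)
    then show "bi l a' (\<xi> + p ^ a * \<theta>) b \<eta> \<le> K * rpow (Av a' (\<xi> + p ^ a * \<theta>)) (tt l) * X"
      using Bil r ne \<theta> refine_range[of \<xi> a \<theta> m] unfolding Bil_def a'_def X_def by auto
  qed (use K D0 in auto)
  also have "\<dots> = K1 * K * X * (D * (\<Sum>\<theta>\<in>{0..<p ^ m}. Av a' (\<xi> + p ^ a * \<theta>) powr tt l))"
    using t by (simp add: sum_distrib_left rpow_def algebra_simps)
  \<comment> \<open>Concavity is needed because the local predictions of the subclasses enter with
    the power \<open>tt l\<close> only.\<close>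
  also have "\<dots> \<le> K1 * K * X * (D * (real (card {0..<p ^ m}) powr (1 - tt l) * (\<Sum>\<theta>\<in>{0..<p ^ m}. Av a' (\<xi> + p ^ a * \<theta>)) powr tt l))"
    using t K D0 by (intro mult_left_mono sum_powr_le) (auto simp: X_def)
  also have "(\<Sum>\<theta>\<in>{0..<p ^ m}. Av a' (\<xi> + p ^ a * \<theta>)) = of_int p ^ ((n - a') * (P div 2 - 1)) * S a \<xi>"
    using S_refine[of \<xi> a m] r unfolding Av_def a'_def by (simp add: sum_distrib_left[symmetric])
  also have "D * (real (card {0..<p ^ m}) powr (1 - tt l) * (of_int p ^ ((n - a') * (P div 2 - 1)) * S a \<xi>) powr tt l) = Av a \<xi> powr tt l"
  proof -
    define x where "x = (of_int p :: real)"
    have x: "x > 0" using p1 by (simp add: x_def)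
    have d1: "real (l * (l + 1) div 2 - 1) = real (l * (l + 1)) / 2 - 1"
    proof -
      have "l * (l + 1) div 2 \<ge> 1" using mult_le_mono[OF l(1), of 2 "l + 1"] l(1) by simp
      then show ?thesis by (simp add: of_nat_diff real_of_nat_div)
    qed
    have P0: "real P > 0" using P2 by simp
    have Dx: "D = x powr (real m * (real (l * (l + 1)) / 2 - 1))"
      unfolding D_def x_def[symmetric] d1[symmetric] using x by (simp add: powr_realpow[symmetric])
    have cx: "real (card {0..<p ^ m}) = x powr real m"
      using x p1 by (simp add: powr_realpow x_def)
    have px: "of_int p ^ ((n - c) * (P div 2 - 1)) = x powr (real (n - c) * (real P / 2 - 1))" for c
      unfolding x_def[symmetric] P2(3)[symmetric] using x by (simp add: powr_realpow[symmetric])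
    have na: "real (n - a) = real (n - a') + real m" using assms(7) by (simp add: a'_def of_nat_diff)
    have "real P * tt l = real (l * (l + 1))" using P0 by (simp add: tt_def)
    \<comment> \<open>The powers of \<open>p\<close> from decoupling, from concavity over
      \<open>p^m\<close> subclasses and from the predictions match exactly, because
      \<open>P * tt l = l*(l+1)\<close>.\<close>
    then have ex: "real m * (real (l * (l + 1)) / 2 - 1) + real m * (1 - tt l) + real (n - a') * (real P / 2 - 1) * tt l =
      real (n - a) * (real P / 2 - 1) * tt l"
      unfolding na by (simp add: algebra_simps)
    show ?thesis
      unfolding Av_def px Dx cx using x
      by (simp add: powr_mult powr_powr powr_add[symmetric] ex[symmetric] mult.assoc[symmetric] add.assoc)
  qed
  finally show "bi l a \<xi> b \<eta>
     \<le> K1 * K * rpow (Av a \<xi>) (tt l) * rpow (Av b \<eta>) (1 - tt l)"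
    using t by (simp add: X_def rpow_def mult_ac)
qed

end

section \<open>Power means, orthogonality and decoupling in degree one\<close>

lemma finite_argmax:
  fixes x :: "'a \<Rightarrow> real"
  assumes "finite I" "I \<noteq> {}"
  obtains i where "i \<in> I" "\<And>j. j \<in> I \<Longrightarrow> x j \<le> x i"
proof -
  have "Max (x ` I) \<in> x ` I" using assms by (intro Max_in) auto
  then obtain i where "i \<in> I" "x i = Max (x ` I)" by auto
  then show thesis using that[of i] assms by simp
qed

text \<open>A crude power mean inequality through the largest term; the exponent \<open>m\<close> of
  \<open>N\<close> in place of \<open>m - 1\<close> is harmless where it is used.\<close>

lemma sum_power_le:
  fixes x :: "'a \<Rightarrow> real"
  assumes "finite I" "\<And>i. i \<in> I \<Longrightarrow> x i \<ge> 0" "m \<ge> 1" "real (card I) \<le> N"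
  shows "(\<Sum>i\<in>I. x i) ^ m \<le> N ^ m * (\<Sum>i\<in>I. x i ^ m)"
proof (cases "I = {}")
  case True
  then show ?thesis using assms(3) by (simp add: power_0_left)
next
  case False
  obtain i where i: "i \<in> I" "\<And>j. j \<in> I \<Longrightarrow> x j \<le> x i" using finite_argmax[OF assms(1) False] by metis
  have N: "N \<ge> 0" using assms(4) by linarith
  have "(\<Sum>j\<in>I. x j) \<le> real (card I) * x i" using i by (intro sum_bounded_above) auto
  also have "\<dots> \<le> N * x i" using assms i by (intro mult_right_mono) auto
  finally have "(\<Sum>j\<in>I. x j) ^ m \<le> (N * x i) ^ m" using assms by (intro power_mono sum_nonneg) auto
  also have "\<dots> = N ^ m * x i ^ m" by (simp add: power_mult_distrib)
  also have "\<dots> \<le> N ^ m * (\<Sum>i\<in>I. x i ^ m)"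
    using assms i N by (intro mult_left_mono member_le_sum) auto
  finally show ?thesis .
qed

text \<open>The index is abstract because it is a single point in degree one and a tuple of points
  when solutions of power sum systems are counted.\<close>

lemma parseval:
  fixes v :: "'a \<Rightarrow> nat \<Rightarrow> int" and w :: "'a \<Rightarrow> complex"
  assumes "finite I" "Q > 0"
  shows "of_real (mean k Q (\<lambda>\<alpha>. norm (\<Sum>i\<in>I. w i * e (of_int (\<Sum>j=1..k. \<alpha> j * v i j) / of_int Q)) ^ 2)) =
    (\<Sum>i\<in>I. \<Sum>i'\<in>I. if (\<forall>j\<in>{1..k}. [v i j = v i' j] (mod Q)) then w i * cnj (w i') else 0)"
proof -
  define E where "E = (\<lambda>\<alpha> i. e (of_int (\<Sum>j=1..k. \<alpha> j * v i j) / of_int Q))"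
  have orth: "(\<Sum>\<alpha>\<in>bx k Q. E \<alpha> i * cnj (E \<alpha> i')) = (if (\<forall>j\<in>{1..k}. [v i j = v i' j] (mod Q)) then of_int Q ^ k else 0)" for i i'
  proof -
    have "E \<alpha> i * cnj (E \<alpha> i') = (\<Prod>j=1..k. e (of_int (\<alpha> j * (v i j - v i' j)) / of_int Q))" for \<alpha>
    proof -
      have "E \<alpha> i * cnj (E \<alpha> i') = e (\<Sum>j=1..k. of_int (\<alpha> j * (v i j - v i' j)) / of_int Q)"
        unfolding E_def e_diff[symmetric]
        by (simp add: sum_divide_distrib[symmetric] sum_subtractf[symmetric] diff_divide_distrib[symmetric] algebra_simps)
      then show ?thesis by (simp add: e_sum)
    qed
    then have "(\<Sum>\<alpha>\<in>bx k Q. E \<alpha> i * cnj (E \<alpha> i')) =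
      (\<Prod>j=1..k. \<Sum>a\<in>{0..<Q}. e (of_int (a * (v i j - v i' j)) / of_int Q))"
      unfolding bx_def by (subst prod_sum_PiE) auto
    also have "\<dots> = (\<Prod>j=1..k. if [v i j = v i' j] (mod Q) then of_int Q else 0)"
      by (simp only: sum_e_residues[OF assms(2)] cong_iff_dvd_diff)
    also have "\<dots> = (if (\<forall>j\<in>{1..k}. [v i j = v i' j] (mod Q)) then of_int Q ^ k else 0)"
      by (auto simp: prod_zero_iff)
    finally show ?thesis .
  qed
  have "of_real (norm (\<Sum>i\<in>I. w i * E \<alpha> i) ^ 2) = (\<Sum>i\<in>I. \<Sum>i'\<in>I. w i * cnj (w i') * (E \<alpha> i * cnj (E \<alpha> i')))" for \<alpha>
    unfolding complex_norm_square by (simp add: sum_product algebra_simps)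
  then have "of_real (\<Sum>\<alpha>\<in>bx k Q. norm (\<Sum>i\<in>I. w i * E \<alpha> i) ^ 2) =
    (\<Sum>\<alpha>\<in>bx k Q. \<Sum>i\<in>I. \<Sum>i'\<in>I. w i * cnj (w i') * (E \<alpha> i * cnj (E \<alpha> i')))"
    by (simp only: of_real_sum)
  also have "\<dots> = (\<Sum>i\<in>I. \<Sum>i'\<in>I. w i * cnj (w i') * (\<Sum>\<alpha>\<in>bx k Q. E \<alpha> i * cnj (E \<alpha> i')))"
    by (subst sum.swap, intro sum.cong refl, subst sum.swap) (simp add: sum_distrib_left)
  also have "\<dots> = (\<Sum>i\<in>I. \<Sum>i'\<in>I. if (\<forall>j\<in>{1..k}. [v i j = v i' j] (mod Q)) then w i * cnj (w i') else 0) * of_int Q ^ k"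
    unfolding orth sum_distrib_right by (intro sum.cong refl) auto
  finally show ?thesis using assms(2) unfolding mean_def E_def
    by (simp add: divide_eq_eq)
qed

lemma poly_diff_dvd: "(x - y) dvd poly (q :: int poly) x - poly q y"
proof (induction q)
  case (pCons a q)
  have "poly (pCons a q) x - poly (pCons a q) y = (x - y) * poly q x + y * (poly q x - poly q y)"
    by (simp add: algebra_simps)
  then show ?case using pCons by (metis dvd_add dvd_mult dvd_triv_left)
qed auto

text \<open>In degree one the moment is quadratic, and orthogonality gives equality with constant 1.
  Since \<open>\<phi> 1\<close> is the identity plus \<open>p\<close> times a polynomial, a
  difference of its values is \<open>x - y\<close> times a unit, so congruence of values modulo
  \<open>p^n\<close> is congruence of arguments.\<close>

lemma dec_one:
  fixes p :: int
  assumes "prime p"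
  shows "dec p 1 n 1"
  unfolding dec_def
proof (intro allI impI)
  fix \<phi> :: "nat \<Rightarrow> int poly" and w :: "int \<Rightarrow> complex" and A :: "int set"
  assume cur: "curve p 1 \<phi>" and fin: "finite A"
  have p1: "p > 1" using assms by (rule prime_gt_1_int)
  have "[coeff (\<phi> 1) i = coeff (monom 1 1) i] (mod p)" for i
    using cur[unfolded curve_def, rule_format, of 1 i] by (cases "i = 1") auto
  then have "[:p:] dvd \<phi> 1 - monom 1 1"
    unfolding poly_dvd_coeff by blast
  then obtain \<psi> where \<psi>: "\<phi> 1 - monom 1 1 = [:p:] * \<psi>" by (auto elim: dvdE)
  have inj: "[poly (\<phi> 1) x = poly (\<phi> 1) y] (mod p ^ n) \<longleftrightarrow> [x = y] (mod p ^ n)" for x y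
  proof -
    obtain t where t: "poly \<psi> x - poly \<psi> y = (x - y) * t" using poly_diff_dvd[of x y \<psi>] by (auto elim: dvdE)
    have "\<phi> 1 = monom 1 1 + [:p:] * \<psi>" using \<psi> by (metis diff_eq_eq add.commute)
    then have "poly (\<phi> 1) x - poly (\<phi> 1) y = (x - y) + p * (poly \<psi> x - poly \<psi> y)"
      by (simp add: poly_monom algebra_simps)
    also have "\<dots> = (x - y) * (1 + p * t)" unfolding t by (simp add: algebra_simps)
    finally have eq: "poly (\<phi> 1) x - poly (\<phi> 1) y = (x - y) * (1 + p * t)" .
    have "coprime (p ^ n) (1 + p * t)"
      by (metis coprime_power_left_iff coprime_add_one_right coprime_mult_left_iff add.commute coprime_commute)
    then show ?thesis unfolding cong_iff_dvd_diff eq by (simp add: coprime_dvd_mult_left_iff)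
  qed
  define G where "G = (\<lambda>x y. if [x = y] (mod p ^ n) then w x * cnj (w y) else 0)"
  have pv: "of_real (moment 1 (p ^ n) \<phi> w B 2) = (\<Sum>x\<in>B. \<Sum>y\<in>B. G x y)" if "finite B" for B
    unfolding moment_def expsum_def ip_def G_def
    using parseval[OF that, of "p ^ n" 1 w "\<lambda>x j. poly (\<phi> j) x"] p1 by (simp add: inj del: One_nat_def)
  have "complex_of_real (\<Sum>\<theta>\<in>{0..<p ^ n}. moment 1 (p ^ n) \<phi> w (cls p n \<theta> A) 2) =
     (\<Sum>\<theta>\<in>{0..<p ^ n}. \<Sum>x\<in>cls p n \<theta> A. \<Sum>y\<in>cls p n \<theta> A. G x y)"
    using fin by (simp add: pv del: One_nat_def)
  also have "\<dots> = (\<Sum>\<theta>\<in>{0..<p ^ n}. \<Sum>x\<in>cls p n \<theta> A. \<Sum>y\<in>A. G x y)"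
    by (rule sum.cong[OF refl], rule sum.cong[OF refl], rule sum.mono_neutral_left)
       (use fin in \<open>auto simp: cls_def G_def Cong.cong_def\<close>)
  also have "\<dots> = (\<Sum>x\<in>A. \<Sum>y\<in>A. G x y)"
    unfolding cls_def using fin p1 by (intro sum.group) auto
  also have "\<dots> = complex_of_real (moment 1 (p ^ n) \<phi> w A 2)"
    using fin by (simp add: pv del: One_nat_def)
  finally have "moment 1 (p ^ n) \<phi> w A 2 =
    (\<Sum>\<theta>\<in>{0..<p ^ n}. moment 1 (p ^ n) \<phi> w (cls p n \<theta> A) 2)"
    by (simp only: of_real_eq_iff)
  then show "dec_at p 1 n 1 \<phi> w A"
    unfolding dec_at_def by (simp add: numeral_2_eq_2)
qed

lemma dec_mono:
  assumes "dec p k n K" "K \<le> K'" "p > 1"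
  shows "dec p k n K'"
proof -
  have "(\<Sum>\<theta>\<in>{0..<p ^ n}. moment k (p ^ (k * n)) \<phi> w (cls p n \<theta> A) (k * (k + 1))) \<ge> 0" for \<phi> w A
    unfolding moment_def using assms(3) by (intro sum_nonneg mean_nonneg) auto
  then show ?thesis
    using assms unfolding dec_def dec_at_def
    by (meson mult_right_mono order_trans of_int_0_le_iff zero_le_power less_imp_le zero_less_one less_trans)
qed

text \<open>The recursion reflects one round of \<open>Bil_step\<close> and \<open>Bil_holder\<close>. Its matrix has the all-ones vector as a left
  fixed vector, so the inflow from \<open>l = 0\<close> makes the sum over \<open>l\<close> grow linearly.\<close>

primrec saving :: "nat \<Rightarrow> nat \<Rightarrow> nat \<Rightarrow> real" where
  "saving k 0 l = (if l = 0 then 1 else 0)"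
| "saving k (Suc t) l = (if l = 0 then 1 else
     saving k t (k - l) / real l + saving k t (l - 1) * (1 - 1 / (real k - real l + 1)))"

lemma saving_zero [simp]: "saving k t 0 = 1"
  by (cases t) auto

text \<open>After the substitutions of \<open>k - l\<close> and \<open>l - 1\<close>, index
  \<open>l\<close> passes the share \<open>1/(k-l)\<close> through the reflection and
  \<open>1 - 1/(k-l)\<close> through the shift. Only index 0, with its constant value 1, adds a
  surplus: \<open>1 - 1/k\<close> in each round.\<close>

lemma saving_sum:
  assumes "k \<ge> 1"
  shows "(\<Sum>l\<in>{1..<k}. saving k t l) = real t * (1 - 1 / real k)"
proof (induction t)
  case (Suc t)
  obtain k' where k': "k = Suc k'" using assms by (cases k) auto
  have "(\<Sum>l\<in>{1..<k}. saving k (Suc t) l) = (\<Sum>l\<in>{1..<k}. saving k t (k - l) / real l) +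
     (\<Sum>l\<in>{1..<k}. saving k t (l - 1) * (1 - 1 / (real k - real l + 1)))"
    by (simp add: sum.distrib)
  also have "(\<Sum>l\<in>{1..<k}. saving k t (k - l) / real l) = (\<Sum>l\<in>{1..<k}. saving k t l / (real k - real l))"
    by (rule sum.reindex_bij_witness[where i = "\<lambda>l. k - l" and j = "\<lambda>l. k - l"]) (auto simp: of_nat_diff)
  also have "(\<Sum>l\<in>{1..<k}. saving k t (l - 1) * (1 - 1 / (real k - real l + 1))) =
      (\<Sum>l\<in>{0..<k'}. saving k t l * (1 - 1 / (real k - real l)))"
    by (rule sum.reindex_bij_witness[where i = Suc and j = "\<lambda>l. l - 1"]) (auto simp: k')
  \<comment> \<open>The additional index \<open>k - 1\<close> has the factor 1 - 1/1 = 0.\<close>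
  also have "\<dots> = (\<Sum>l\<in>{0..<k}. saving k t l * (1 - 1 / (real k - real l)))"
    unfolding k' by simp
  also have "\<dots> = (1 - 1 / real k) + (\<Sum>l\<in>{1..<k}. saving k t l * (1 - 1 / (real k - real l)))"
    using assms by (subst sum.atLeast_Suc_lessThan) auto
  finally have F: "(\<Sum>l\<in>{1..<k}. saving k (Suc t) l) = (\<Sum>l\<in>{1..<k}. saving k t l / (real k - real l)) +
     ((1 - 1 / real k) + (\<Sum>l\<in>{1..<k}. saving k t l * (1 - 1 / (real k - real l))))" .
  have "(\<Sum>l\<in>{1..<k}. saving k t l / (real k - real l)) + (\<Sum>l\<in>{1..<k}. saving k t l * (1 - 1 / (real k - real l))) =
     (\<Sum>l\<in>{1..<k}. saving k t l)"
    by (subst sum.distrib[symmetric]) (intro sum.cong, auto simp: algebra_simps)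
  with F Suc have "(\<Sum>l\<in>{1..<k}. saving k (Suc t) l) = (1 - 1 / real k) + real t * (1 - 1 / real k)"
    by linarith
  then show ?case by (simp only: of_nat_Suc distrib_right mult_1_left)
qed auto

text \<open>By \<open>saving_sum\<close> the average over the \<open>k - 1\<close> positive indices
  is \<open>t / k\<close>.\<close>

lemma saving_large:
  assumes "k \<ge> 2" "real t \<ge> real k * G"
  obtains l where "1 \<le> l" "l < k" "saving k t l \<ge> G"
proof (rule ccontr)
  assume "\<not> thesis"
  then have "saving k t l < G" if "l \<in> {1..<k}" for l using that \<open>\<And>l. _ \<Longrightarrow> _ \<Longrightarrow> _ \<Longrightarrow> thesis\<close> by force
  then have "(\<Sum>l\<in>{1..<k}. saving k t l) < (\<Sum>l\<in>{1..<k}. G)" using assms(1) by (intro sum_strict_mono) auto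
  also have "\<dots> = (real k - 1) * G" using assms(1) by (simp add: of_nat_diff)
  also have "\<dots> = real k * G * (1 - 1 / real k)" using assms(1) by (simp add: field_simps)
  also have "\<dots> \<le> real t * (1 - 1 / real k)" using assms by (intro mult_right_mono) auto
  finally show False using saving_sum[of k t] assms(1) by simp
qed

section \<open>Reduction to separated classes and iteration of the bilinear estimate\<close>

context curve_sum
begin

lemma filter_mod_one: "{\<theta>\<in>{0..<N}. \<theta> mod p ^ 0 = 0} = {0..<N}"
  by auto

lemma S_total: "S 0 0 = (\<Sum>\<theta>\<in>{0..<p ^ n}. g \<theta>)"
  unfolding S_def filter_mod_one ..

lemma S_le: "S a \<xi> \<le> S 0 0"
  unfolding S_total unfolding S_def by (intro sum_mono2) auto

lemma Av_le: "Av a \<xi> \<le> Av 0 0"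
  unfolding Av_def using p1 S_le[of a \<xi>]
  by (intro mult_mono power_increasing) auto

lemma f_refine:
  assumes "a \<le> b"
  shows "f a \<xi> \<alpha> \<le> (\<Sum>\<eta>\<in>{\<eta>\<in>{0..<p ^ b}. \<eta> mod p ^ a = \<xi>}. f b \<eta> \<alpha>)"
proof -
  define T where "T = {\<eta>\<in>{0..<p ^ b}. \<eta> mod p ^ a = \<xi>}"
  have finT: "finite T" unfolding T_def by (rule finite_subset[of _ "{0..<p ^ b}"]) auto
  have mm: "x mod p ^ b mod p ^ a = x mod p ^ a" for x
    using assms by (intro mod_mod_cancel le_imp_power_dvd)
  have "expsum k Q \<phi> w (cls p a \<xi> A) \<alpha> = (\<Sum>\<eta>\<in>T. \<Sum>x\<in>{x\<in>cls p a \<xi> A. x mod p ^ b = \<eta>}. w x * e (of_int (ip k \<phi> \<alpha> x) / of_int Q))"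
    unfolding expsum_def using finA finT p1 mm by (intro sum.group[symmetric]) (auto simp: T_def cls_def)
  also have "\<dots> = (\<Sum>\<eta>\<in>T. expsum k Q \<phi> w (cls p b \<eta> A) \<alpha>)"
    unfolding expsum_def using mm by (intro sum.cong refl) (auto simp: T_def cls_def)
  finally show ?thesis unfolding f_def T_def[symmetric] by (simp add: sum_norm_le)
qed

lemma card_refine: "real (card {\<eta>\<in>{0..<p ^ b}. \<eta> mod p ^ a = \<xi>}) \<le> of_int p ^ b"
proof -
  have "card {\<eta>\<in>{0..<p ^ b}. \<eta> mod p ^ a = \<xi>} \<le> card {0..<p ^ b}" by (intro card_mono) auto
  also have "real \<dots> = of_int p ^ b" using p1 by simp
  finally show ?thesis by simp
qed

text \<open>For bounded \<open>n\<close> the loss is a constant, which starts the induction on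
  \<open>n\<close>.\<close>

lemma trivial_dec: "mean k Q (\<lambda>\<alpha>. f 0 0 \<alpha> ^ P) \<le> of_int p ^ (n * P) * Av 0 0"
proof -
  have "mean k Q (\<lambda>\<alpha>. f 0 0 \<alpha> ^ P) \<le> mean k Q (\<lambda>\<alpha>. (of_int p ^ n) ^ P * (\<Sum>\<theta>\<in>{0..<p ^ n}. f n \<theta> \<alpha> ^ P))"
  proof (rule mean_mono)
    fix \<alpha>
    have "f 0 0 \<alpha> ^ P \<le> (\<Sum>\<theta>\<in>{0..<p ^ n}. f n \<theta> \<alpha>) ^ P"
      using f_refine[of 0 n 0 \<alpha>] unfolding filter_mod_one by (intro power_mono) auto
    also have "\<dots> \<le> (of_int p ^ n) ^ P * (\<Sum>\<theta>\<in>{0..<p ^ n}. f n \<theta> \<alpha> ^ P)"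
      using P2 p1 by (intro sum_power_le) auto
    finally show "f 0 0 \<alpha> ^ P \<le> (of_int p ^ n) ^ P * (\<Sum>\<theta>\<in>{0..<p ^ n}. f n \<theta> \<alpha> ^ P)" .
  qed (use Q0 in simp)
  also have "\<dots> = of_int p ^ (n * P) * S 0 0"
    by (simp add: mean_cmult mean_sum S_total g_def power_mult)
  also have "\<dots> \<le> of_int p ^ (n * P) * Av 0 0"
  proof -
    have "1 * S 0 0 \<le> Av 0 0" unfolding Av_def using p1 by (intro mult_right_mono) auto
    then show ?thesis using p1 by (intro mult_left_mono) auto
  qed
  finally show ?thesis .
qed

text \<open>If the largest class has less than half of the whole, the other classes together have
  more than half, so one of them has at least the fraction \<open>1/(2*p)\<close>. The largest class
  then has this much too, and both factors of some transversal product are large.\<close>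

lemma broad_narrow_pointwise:
  assumes "l \<le> k"
  shows "f 0 0 \<alpha> ^ P \<le> 2 ^ P * (\<Sum>\<xi>\<in>{0..<p}. f 1 \<xi> \<alpha> ^ P) + (2 * of_int p) ^ P *
    (\<Sum>\<xi>\<in>{0..<p}. \<Sum>\<eta>\<in>{0..<p} - {\<xi>}. f 1 \<xi> \<alpha> ^ (l * (l + 1)) * f 1 \<eta> \<alpha> ^ (P - l * (l + 1)))"
proof -
  define F where "F = f 0 0 \<alpha>"
  define x where "x = (\<lambda>\<xi>. f 1 \<xi> \<alpha>)"
  define m where "m = l * (l + 1)"
  have x0: "x \<xi> \<ge> 0" for \<xi> by (simp add: x_def)
  have F0: "F \<ge> 0" by (simp add: F_def)
  have m: "m \<le> P" using Pl_le[OF assms] by (simp add: m_def)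
  have Fx: "F \<le> (\<Sum>\<xi>\<in>{0..<p}. x \<xi>)" using f_refine[of 0 1 0 \<alpha>] unfolding filter_mod_one by (simp add: F_def x_def)
  define BB where "BB = (\<Sum>\<xi>\<in>{0..<p}. \<Sum>\<eta>\<in>{0..<p} - {\<xi>}. x \<xi> ^ m * x \<eta> ^ (P - m))"
  have BB0: "BB \<ge> 0" unfolding BB_def by (intro sum_nonneg) (simp add: x0)
  obtain \<xi> where \<xi>: "\<xi> \<in> {0..<p}" "\<And>j. j \<in> {0..<p} \<Longrightarrow> x j \<le> x \<xi>"
    using finite_argmax[of "{0..<p}" x] p1 by auto
  show ?thesis
  proof (cases "F \<le> 2 * x \<xi>")
    case True
    have "F ^ P \<le> (2 * x \<xi>) ^ P" using True F0 by (rule power_mono)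
    also have "\<dots> = 2 ^ P * x \<xi> ^ P" by (simp add: power_mult_distrib)
    also have "\<dots> \<le> 2 ^ P * (\<Sum>\<xi>\<in>{0..<p}. x \<xi> ^ P)"
      using \<xi> x0 by (intro mult_left_mono member_le_sum) auto
    also have "\<dots> \<le> \<dots> + (2 * of_int p) ^ P * BB" using BB0 p1 by simp
    finally show ?thesis by (simp add: F_def x_def BB_def m_def)
  next
    case False
    have "\<exists>\<eta>\<in>{0..<p} - {\<xi>}. F / (2 * of_int p) \<le> x \<eta>"
    proof (rule ccontr)
      assume "\<not> ?thesis"
      then have "(\<Sum>\<eta>\<in>{0..<p} - {\<xi>}. x \<eta>) \<le> (\<Sum>\<eta>\<in>{0..<p} - {\<xi>}. F / (2 * of_int p))"
        by (intro sum_mono less_imp_le) (auto simp: not_le)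
      also have "\<dots> \<le> (\<Sum>\<eta>\<in>{0..<p}. F / (2 * of_int p))"
        using F0 p1 by (intro sum_mono2) auto
      also have "\<dots> = F / 2" using p1 by simp
      finally have "(\<Sum>\<eta>\<in>{0..<p}. x \<eta>) \<le> x \<xi> + F / 2"
        using \<xi>(1) by (subst sum.remove[of _ \<xi>]) auto
      then show False using Fx False by linarith
    qed
    then obtain \<eta> where \<eta>: "\<eta> \<in> {0..<p} - {\<xi>}" "F / (2 * of_int p) \<le> x \<eta>" by blast
    have Fp0: "F / (2 * of_int p) \<ge> 0" using F0 p1 by simp
    have "F / (2 * of_int p) \<le> x \<xi>" using \<eta> \<xi>(2)[of \<eta>] by auto
    then have "(F / (2 * of_int p)) ^ m * (F / (2 * of_int p)) ^ (P - m) \<le> x \<xi> ^ m * x \<eta> ^ (P - m)"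
      using \<eta> x0 Fp0 by (intro mult_mono power_mono) auto
    also have "\<dots> \<le> (\<Sum>\<eta>\<in>{0..<p} - {\<xi>}. x \<xi> ^ m * x \<eta> ^ (P - m))"
      using \<eta> x0 by (intro member_le_sum) auto
    also have "\<dots> \<le> BB"
      unfolding BB_def using \<xi> x0 by (intro member_le_sum[of \<xi> _ "\<lambda>\<xi>. \<Sum>\<eta>\<in>{0..<p} - {\<xi>}. x \<xi> ^ m * x \<eta> ^ (P - m)"] sum_nonneg) auto
    finally have "(F / (2 * of_int p)) ^ P \<le> BB" using m by (simp add: power_add[symmetric])
    then have "F ^ P \<le> (2 * of_int p) ^ P * BB" using p1 by (simp add: power_divide field_simps)
    also have "\<dots> \<le> 2 ^ P * (\<Sum>\<xi>\<in>{0..<p}. x \<xi> ^ P) + \<dots>"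
      using x0 by (simp add: sum_nonneg)
    finally show ?thesis by (simp add: F_def x_def BB_def m_def)
  qed
qed

text \<open>The narrow part loses only \<open>2^P\<close>, without any power of \<open>p\<close>,
  and is rescaled to \<open>n - 1\<close>. In the broad part the class of \<open>\<eta>\<close> is
  split down to scale \<open>p^b\<close> by the triangle inequality; this loses powers of
  \<open>p^b\<close>, which the factor \<open>K\<close> will have to recover.\<close>

lemma broad_narrow:
  assumes "dec p k (n - 1) D" "Bil l 1 b K" "1 \<le> l" "l < k" "1 \<le> b" "b \<le> n" "D \<ge> 0" "K \<ge> 0"
  shows "mean k Q (\<lambda>\<alpha>. f 0 0 \<alpha> ^ P) \<le>
    (2 ^ P * D + (2 * of_int p) ^ P * (of_int p ^ 2 * ((of_int p ^ b) ^ P * (of_int p ^ b * K)))) * Av 0 0"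
proof -
  define m where "m = l * (l + 1)"
  have "real P > 0" using P2 by simp
  then have "real m < real P"
    using tt(1)[OF assms(4)] by (simp only: m_def tt_def divide_less_eq_1_pos)
  then have mP: "m < P" by (simp only: of_nat_less_iff)
  have t: "0 < tt l" "tt l < 1" using tt assms by auto
  have nar: "(\<Sum>\<xi>\<in>{0..<p}. mean k Q (\<lambda>\<alpha>. f 1 \<xi> \<alpha> ^ P)) \<le> D * Av 0 0"
  proof -
    have "(\<Sum>\<xi>\<in>{0..<p}. mean k Q (\<lambda>\<alpha>. f 1 \<xi> \<alpha> ^ P)) \<le> (\<Sum>\<xi>\<in>{0..<p}. D * Av 1 \<xi>)"
      using assms by (intro sum_mono rescaled_dec) auto
    also have "\<dots> = D * (of_int p ^ ((n - 1) * (P div 2 - 1)) * (\<Sum>\<xi>\<in>{0..<p}. S 1 \<xi>))"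
      by (simp add: Av_def sum_distrib_left)
    also have "(\<Sum>\<xi>\<in>{0..<p}. S 1 \<xi>) = S 0 0" using S_refine[of 0 0 1] by simp
    also have "D * (of_int p ^ ((n - 1) * (P div 2 - 1)) * S 0 0) \<le> D * Av 0 0"
      unfolding Av_def using p1 assms by (intro mult_left_mono mult_right_mono power_increasing) auto
    finally show ?thesis .
  qed
  have br: "bi l 1 \<xi> 1 \<eta> \<le> (of_int p ^ b) ^ P * (of_int p ^ b * K) * Av 0 0"
    if "\<xi> \<in> {0..<p}" "\<eta> \<in> {0..<p} - {\<xi>}" for \<xi> \<eta>
  proof -
    define T where "T = {\<eta>'\<in>{0..<p ^ b}. \<eta>' mod p ^ 1 = \<eta>}"
    have finT: "finite T" unfolding T_def by (rule finite_subset[of _ "{0..<p ^ b}"]) auto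
    have cT: "real (card T) \<le> of_int p ^ b" unfolding T_def by (rule card_refine)
    have pb: "(of_int p ^ b :: real) \<ge> 1" using p1 by simp
    have "f 1 \<eta> \<alpha> ^ (P - m) \<le> (of_int p ^ b) ^ P * (\<Sum>\<eta>'\<in>T. f b \<eta>' \<alpha> ^ (P - m))" for \<alpha>
    proof -
      have "f 1 \<eta> \<alpha> ^ (P - m) \<le> (\<Sum>\<eta>'\<in>T. f b \<eta>' \<alpha>) ^ (P - m)"
        using f_refine[OF assms(5), of \<eta> \<alpha>] unfolding T_def by (intro power_mono) auto
      also have "\<dots> \<le> (of_int p ^ b) ^ (P - m) * (\<Sum>\<eta>'\<in>T. f b \<eta>' \<alpha> ^ (P - m))"
        using finT cT mP by (intro sum_power_le) auto
      also have "\<dots> \<le> (of_int p ^ b) ^ P * (\<Sum>\<eta>'\<in>T. f b \<eta>' \<alpha> ^ (P - m))"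
        using pb by (intro mult_right_mono power_increasing sum_nonneg) auto
      finally show ?thesis .
    qed
    then have "bi l 1 \<xi> 1 \<eta> \<le>
        mean k Q (\<lambda>\<alpha>. f 1 \<xi> \<alpha> ^ m * ((of_int p ^ b) ^ P * (\<Sum>\<eta>'\<in>T. f b \<eta>' \<alpha> ^ (P - m))))"
      unfolding bi_def m_def[symmetric] using Q0 by (intro mean_mono mult_left_mono) auto
    also have "\<dots> = (of_int p ^ b) ^ P * (\<Sum>\<eta>'\<in>T. bi l 1 \<xi> b \<eta>')"
      unfolding bi_def m_def[symmetric] mean_sum[symmetric] mean_cmult[symmetric]
      by (intro mean_cong) (simp add: sum_distrib_left algebra_simps)
    also have "\<dots> \<le> (of_int p ^ b) ^ P * (\<Sum>\<eta>'\<in>T. K * Av 0 0)"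
    proof (intro mult_left_mono sum_mono)
      fix \<eta>' assume \<eta>': "\<eta>' \<in> T"
      have "\<xi> mod p = \<xi>" using that by auto
      then have "bi l 1 \<xi> b \<eta>' \<le> K * rpow (Av 1 \<xi>) (tt l) * rpow (Av b \<eta>') (1 - tt l)"
        using assms(2) that \<eta>' unfolding Bil_def m_def T_def by auto
      also have "\<dots> \<le> K * rpow (Av 0 0) (tt l) * rpow (Av 0 0) (1 - tt l)"
        using t assms(8) by (intro mult_mono rpow_mono Av_le mult_nonneg_nonneg) auto
      also have "\<dots> = K * Av 0 0" using t rpow_of_nat[of "Av 0 0" 1]
        by (simp add: mult.assoc rpow_add)
      finally show "bi l 1 \<xi> b \<eta>' \<le> K * Av 0 0" .
    qed (use pb in auto)
    also have "\<dots> \<le> (of_int p ^ b) ^ P * (of_int p ^ b * (K * Av 0 0))"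
      using cT pb assms(8) by (intro mult_left_mono) (auto intro!: mult_right_mono)
    finally show ?thesis by (simp add: mult.assoc)
  qed
  have "mean k Q (\<lambda>\<alpha>. f 0 0 \<alpha> ^ P) \<le> mean k Q (\<lambda>\<alpha>. 2 ^ P * (\<Sum>\<xi>\<in>{0..<p}. f 1 \<xi> \<alpha> ^ P) + (2 * of_int p) ^ P *
    (\<Sum>\<xi>\<in>{0..<p}. \<Sum>\<eta>\<in>{0..<p} - {\<xi>}. f 1 \<xi> \<alpha> ^ m * f 1 \<eta> \<alpha> ^ (P - m)))"
    unfolding m_def using assms Q0 by (intro mean_mono broad_narrow_pointwise) auto
  also have "\<dots> = 2 ^ P * (\<Sum>\<xi>\<in>{0..<p}. mean k Q (\<lambda>\<alpha>. f 1 \<xi> \<alpha> ^ P)) + (2 * of_int p) ^ P *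
    (\<Sum>\<xi>\<in>{0..<p}. \<Sum>\<eta>\<in>{0..<p} - {\<xi>}. bi l 1 \<xi> 1 \<eta>)"
    by (simp add: bi_def m_def mean_add mean_cmult mean_sum)
  also have "\<dots> \<le> 2 ^ P * (D * Av 0 0) + (2 * of_int p) ^ P *
    (\<Sum>\<xi>\<in>{0..<p}. \<Sum>\<eta>\<in>{0..<p}. (of_int p ^ b) ^ P * (of_int p ^ b * K) * Av 0 0)"
  proof (intro add_mono mult_left_mono nar sum_mono)
    fix \<xi> assume \<xi>: "\<xi> \<in> {0..<p}"
    have "(\<Sum>\<eta>\<in>{0..<p} - {\<xi>}. bi l 1 \<xi> 1 \<eta>) \<le>
       (\<Sum>\<eta>\<in>{0..<p} - {\<xi>}. (of_int p ^ b) ^ P * (of_int p ^ b * K) * Av 0 0)"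
      using \<xi> by (intro sum_mono br)
    also have "\<dots> \<le> (\<Sum>\<eta>\<in>{0..<p}. (of_int p ^ b) ^ P * (of_int p ^ b * K) * Av 0 0)"
      using p1 assms(8) by (intro sum_mono2) auto
    finally show "(\<Sum>\<eta>\<in>{0..<p} - {\<xi>}. bi l 1 \<xi> 1 \<eta>) \<le>
       (\<Sum>\<eta>\<in>{0..<p}. (of_int p ^ b) ^ P * (of_int p ^ b * K) * Av 0 0)" .
  qed (use p1 in auto)
  also have "\<dots> = (2 ^ P * D + (2 * of_int p) ^ P * (of_int p ^ 2 * ((of_int p ^ b) ^ P * (of_int p ^ b * K)))) * Av 0 0"
    using p1 by (simp add: algebra_simps power2_eq_square)
  finally show ?thesis .
qed

text \<open>Each round refines \<open>\<xi>\<close> to the scale \<open>a' = (k-l+1)*b/l\<close> and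
  then interpolates. Divisibility of \<open>b\<close> by a power of k! keeps the scales integral;
  they grow by at most a factor \<open>k\<close> per round, so \<open>b * k^t <= n\<close> keeps
  them below \<open>n\<close>; the last condition on \<open>a\<close> says that \<open>a'\<close> is
  indeed finer than \<open>a\<close>.\<close>

lemma Bil_iterate:
  assumes H1: "\<And>m. m < n \<Longrightarrow> dec p k m (C * of_int p powr (\<eta> * real m))"
    and H2: "\<And>l m. 1 \<le> l \<Longrightarrow> l < k \<Longrightarrow> dec p l m (C1 * of_int p powr (\<delta> * real m))"
    and C: "C > 0" "C1 \<ge> 1" "\<eta> > 0" "\<delta> \<ge> 0"
    and ab: "l < k" "1 \<le> a" "a \<le> n" "1 \<le> b" "fact k ^ t dvd b" "b * k ^ t \<le> n" "l * a \<le> (k - l + 1) * b"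
  shows "Bil l a b ((C1 * of_int p powr (\<delta> * real (k ^ t * b))) ^ t * (C * of_int p powr (\<eta> * (real n - saving k t l * real b))))"
  using ab
proof (induction t arbitrary: l a b)
  case (0 l a b)
  have p1': "of_int p > (1::real)" using p1 by simp
  show ?case
  proof (cases "l = 0")
    case True
    have "dec p k (n - b) (C * of_int p powr (\<eta> * (real n - saving k 0 l * real b)))"
      using H1[of "n - b"] 0 True by (simp add: of_nat_diff)
    then show ?thesis using 0 Bil_zero True by auto
  next
    case False
    \<comment> \<open>For \<open>l >= 1\<close> nothing is saved before the first round, so the
      constants for smaller scales are weakened to that for \<open>n\<close>.\<close>
    have *: "dec p k (n - c) (C * of_int p powr (\<eta> * real n))" if "1 \<le> c" "c \<le> n" for c
    proof (rule dec_mono[OF H1[of "n - c"] _ p1])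
      have "\<eta> * real (n - c) \<le> \<eta> * real n" using C(3) by (intro mult_left_mono) auto
      then show "C * of_int p powr (\<eta> * real (n - c)) \<le> C * of_int p powr (\<eta> * real n)"
        using C p1' by (intro mult_left_mono powr_mono) auto
    qed (use that in linarith)
    have "Bil l a b (C * of_int p powr (\<eta> * real n))"
      using 0 False C by (intro Bil_trivial *) auto
    then show ?thesis using False by simp
  qed
next
  case (Suc t l a b)
  have p1': "of_int p > (1::real)" using p1 by simp
  define X where "X = (C1 * of_int p powr (\<delta> * real (k ^ Suc t * b))) ^ t"
  have fac1: "1 \<le> C1 * of_int p powr x" if "x \<ge> 0" for x
  proof -
    have "of_int p powr x \<ge> (1::real)" using that p1' by (simp add: ge_one_powr_ge_zero)
    then show ?thesis using C(2) mult_mono[of 1 C1 1 "of_int p powr x"] by simp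
  qed
  have fac: "1 \<le> C1 * of_int p powr (\<delta> * real c)" for c using C by (intro fac1) auto
  have k0: "k \<ge> 1" using Suc.prems(1) by simp
  show ?case
  proof (cases "l = 0")
    case True
    have "dec p k (n - b) (C * of_int p powr (\<eta> * (real n - saving k (Suc t) l * real b)))"
    proof -
      have "b * 1 \<le> b * k ^ Suc t" using k0 by (intro mult_le_mono) auto
      then have "b \<le> n" using Suc.prems(6) by linarith
      then show ?thesis using H1[of "n - b"] Suc.prems True by (simp add: of_nat_diff)
    qed
    moreover have "b \<le> n"
    proof -
      have "b * 1 \<le> b * k ^ Suc t" using k0 by (intro mult_le_mono) auto
      then show ?thesis using Suc.prems(6) by linarith
    qed
    ultimately have "Bil l a b (C * of_int p powr (\<eta> * (real n - saving k (Suc t) l * real b)))"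
      using Bil_zero Suc.prems True by simp
    then show ?thesis
    proof (rule Bil_mono)
      have "1 \<le> (C1 * of_int p powr (\<delta> * real (k ^ Suc t * b))) ^ Suc t" using fac by (intro one_le_power)
      then show "C * of_int p powr (\<eta> * (real n - saving k (Suc t) l * real b)) \<le>
        (C1 * of_int p powr (\<delta> * real (k ^ Suc t * b))) ^ Suc t * (C * of_int p powr (\<eta> * (real n - saving k (Suc t) l * real b)))"
        using C mult_right_mono[of 1 _ "C * of_int p powr (\<eta> * (real n - saving k (Suc t) l * real b))"] by fastforce
    qed
  next
    case False
    then have l: "1 \<le> l" "l < k" using Suc.prems by auto
    have "fact k ^ t * l dvd fact k ^ Suc t"
      using l by (simp add: mult.commute dvd_fact mult_dvd_mono)
    then have "fact k ^ t * l dvd b" using Suc.prems(5) by (rule dvd_trans)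
    then obtain b' where b': "b = l * b'" "fact k ^ t dvd b'"
      by (metis dvdE dvd_triv_left mult.assoc mult.left_commute)
    \<comment> \<open>One factor k! of \<open>b\<close> is spent on dividing by \<open>l\<close>,
      which makes the refined scale an integer.\<close>
    define a' where "a' = (k - l + 1) * b'"
    have b1: "b' \<ge> 1" using Suc.prems(4) b' by (cases b') auto
    have la': "l * a' = (k - l + 1) * b" by (simp add: a'_def b'(1) algebra_simps)
    have "l * a \<le> l * a'" using Suc.prems(7) la' by simp
    then have aa': "a \<le> a'" using l by simp
    have kb: "a' \<le> k * b"
      unfolding a'_def b'(1) using l by (intro mult_le_mono) auto
    have sc: "k * b * k ^ t \<le> n" using Suc.prems(6) by (simp add: algebra_simps)
    have a't: "a' * k ^ t \<le> n" using mult_le_mono1[OF kb, of "k ^ t"] sc by linarith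
    have bt: "b * k ^ t \<le> n"
    proof -
      have "b * k ^ t \<le> k * b * k ^ t" using k0 by simp
      then show ?thesis using sc by linarith
    qed
    have kt: "1 \<le> k ^ t" using k0 by simp
    have an: "a' \<le> n" "b \<le> n"
      using a't bt kt by (metis mult.right_neutral mult_le_mono2 order_trans)+
    have a'1: "1 \<le> a'" using Suc.prems(2) aa' by simp
    define \<theta> where "\<theta> = 1 / (real k - real l + 1)"
    have th: "0 < \<theta>" "\<theta> < 1" using l by (auto simp: \<theta>_def field_simps)
    define K1 where "K1 = X * (C * of_int p powr (\<eta> * (real n - saving k t (k - l) * real a')))"
    define K2 where "K2 = X * (C * of_int p powr (\<eta> * (real n - saving k t (l - 1) * real b)))"
    have X1: "X \<ge> 1" unfolding X_def using fac by (intro one_le_power)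
    have mon: "(C1 * of_int p powr (\<delta> * real (k ^ t * c))) ^ t * Y \<le> X * Y" if "c \<le> k * b" "Y \<ge> 0" for c Y
    proof -
      have "k ^ t * c \<le> k ^ Suc t * b" using mult_le_mono2[OF that(1), of "k ^ t"] by (simp add: algebra_simps)
      then have "\<delta> * real (k ^ t * c) \<le> \<delta> * real (k ^ Suc t * b)"
        using C(4) by (intro mult_left_mono) (simp_all only: of_nat_le_iff)
      then have le: "of_int p powr (\<delta> * real (k ^ t * c)) \<le> of_int p powr (\<delta> * real (k ^ Suc t * b))"
        by (rule powr_mono) (use p1 in simp)
      show ?thesis unfolding X_def
        by (intro mult_right_mono power_mono mult_left_mono le) (use C that(2) in auto)
    qed
    have "Bil (k - l) b a' K1"
    proof (rule Bil_mono)
      show "Bil (k - l) b a' ((C1 * of_int p powr (\<delta> * real (k ^ t * a'))) ^ t * (C * of_int p powr (\<eta> * (real n - saving k t (k - l) * real a'))))"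
      proof (rule Suc.IH)
        show "fact k ^ t dvd a'" using b'(2) by (simp add: a'_def)
        have "(k - l) * b \<le> (k - l + 1) * b" by simp
        also have "\<dots> = l * a'" using la' by simp
        also have "\<dots> \<le> (k - (k - l) + 1) * a'" using l by (intro mult_le_mono) auto
        finally show "(k - l) * b \<le> (k - (k - l) + 1) * a'" .
      qed (use l Suc.prems an a't a'1 in auto)
      show "(C1 * of_int p powr (\<delta> * real (k ^ t * a'))) ^ t * (C * of_int p powr (\<eta> * (real n - saving k t (k - l) * real a'))) \<le> K1"
        unfolding K1_def using kb C by (intro mon) auto
    qed
    moreover have "Bil (l - 1) a' b K2"
    proof (rule Bil_mono)
      show "Bil (l - 1) a' b ((C1 * of_int p powr (\<delta> * real (k ^ t * b))) ^ t * (C * of_int p powr (\<eta> * (real n - saving k t (l - 1) * real b))))"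
      proof (rule Suc.IH)
        have "(l - 1) * a' \<le> l * a'" by simp
        also have "\<dots> \<le> (k - (l - 1) + 1) * b" unfolding la' using l by (intro mult_le_mono) auto
        finally show "(l - 1) * a' \<le> (k - (l - 1) + 1) * b" .
        show "fact k ^ t dvd b" using Suc.prems(5) by (metis dvd_trans le_imp_power_dvd le_SucI order_refl)
      qed (use l Suc.prems an bt a'1 in auto)
      show "(C1 * of_int p powr (\<delta> * real (k ^ t * b))) ^ t * (C * of_int p powr (\<eta> * (real n - saving k t (l - 1) * real b))) \<le> K2"
        unfolding K2_def using k0 C by (intro mon) auto
    qed
    ultimately have B: "Bil l a' b (K1 powr \<theta> * K2 powr (1 - \<theta>))"
      by (rule Bil_holder) (use l X1 C in \<open>auto simp: K1_def K2_def \<theta>_def\<close>)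
    have KK: "K1 powr \<theta> * K2 powr (1 - \<theta>) = X * (C * of_int p powr (\<eta> * (real n - saving k (Suc t) l * real b)))"
    proof -
      have "real l * real a' = (real k - real l + 1) * real b"
      proof -
        have "l * a' + l * b = (k - l + 1 + l) * b" unfolding la' by (simp only: distrib_right)
        also have "k - l + 1 + l = k + 1" using l by simp
        finally have "real (l * a' + l * b) = real ((k + 1) * b)" by (simp only:)
        then show ?thesis by (simp add: algebra_simps)
      qed
      \<comment> \<open>In the interchanged mean the scale measuring the gain is \<open>a'\<close>
        instead of \<open>b\<close>; this conversion produces the weight \<open>1/l\<close> in the
        recursion for \<open>saving\<close>.\<close>
      then have "real a' * \<theta> = real b / real l"
        using l unfolding \<theta>_def by (simp add: field_simps)
      then have ex: "\<eta> * (real n - saving k t (k - l) * real a') * \<theta> + \<eta> * (real n - saving k t (l - 1) * real b) * (1 - \<theta>)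
         = \<eta> * (real n - saving k (Suc t) l * real b)"
      proof -
        define r where "r = 1 / real l"
        have "saving k (Suc t) l = saving k t (k - l) * r + saving k t (l - 1) * (1 - \<theta>)"
          using l by (simp add: \<theta>_def r_def)
        moreover have "real a' * \<theta> = real b * r"
          using \<open>real a' * \<theta> = _\<close> by (simp add: r_def)
        ultimately show ?thesis by algebra
      qed
      have "Y powr \<theta> * Y powr (1 - \<theta>) = Y" if "Y > 0" for Y :: real
        using that by (simp add: powr_add[symmetric])
      then have XC: "X powr \<theta> * X powr (1 - \<theta>) = X" "C powr \<theta> * C powr (1 - \<theta>) = C"
        using X1 C by auto
      have "K1 powr \<theta> * K2 powr (1 - \<theta>) = (X powr \<theta> * X powr (1 - \<theta>)) * ((C powr \<theta> * C powr (1 - \<theta>)) *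
          (of_int p powr (\<eta> * (real n - saving k t (k - l) * real a') * \<theta>) *
           of_int p powr (\<eta> * (real n - saving k t (l - 1) * real b) * (1 - \<theta>))))"
        unfolding K1_def K2_def using X1 C by (simp add: powr_mult powr_powr mult_ac)
      then show ?thesis unfolding XC unfolding powr_add[symmetric] ex .
    qed
    have d: "dec p l (a' - a) (C1 * of_int p powr (\<delta> * real (k ^ Suc t * b)))"
    proof (rule dec_mono[OF H2[OF l, of "a' - a"] _ p1])
      have "a' - a \<le> k * b" using kb by simp
      also have "\<dots> \<le> k ^ Suc t * b" using k0 by (simp add: mult_le_mono)
      finally show "C1 * of_int p powr (\<delta> * real (a' - a)) \<le> C1 * of_int p powr (\<delta> * real (k ^ Suc t * b))"
        using C p1' by (intro mult_left_mono powr_mono) (simp_all only: of_nat_le_iff mult_left_mono)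
    qed
    have "Bil l a b ((C1 * of_int p powr (\<delta> * real (k ^ Suc t * b))) * (K1 powr \<theta> * K2 powr (1 - \<theta>)))"
      by (rule Bil_step[OF d]) (use B aa' an l Suc.prems la' fac[of "k ^ Suc t * b"] in \<open>auto simp: X1\<close>)
    then show ?thesis unfolding KK by (simp add: X_def mult.assoc)
  qed
qed

end

section \<open>Decoupling and the Vinogradov mean value theorem\<close>

lemma (in curve_sum) dec_atI:
  "mean k Q (\<lambda>\<alpha>. f 0 0 \<alpha> ^ P) \<le> K * Av 0 0 \<Longrightarrow> dec_at p k n K \<phi> w A"
  unfolding dec_at_def moment_def Av_def S_total g_def f_def Q_def P_def by (simp add: mult.assoc cls_def)

text \<open>Inside the induction on the degree runs one on \<open>n\<close>. The narrow part is at
  most half of the claim because \<open>p\<close> is large, the broad part because the iterated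
  bilinear gain outweighs all powers of \<open>p^b\<close> lost on the way. The constant only has to
  cover small \<open>n\<close>.\<close>

theorem decoupling:
  assumes "k \<ge> 1" "\<eta> > 0"
  shows "\<exists>p0::int. \<forall>p\<ge>p0. prime p \<longrightarrow> (\<exists>C>0. \<forall>n. dec p k n (C * of_int p powr (\<eta> * real n)))"
  using assms
proof (induction k arbitrary: \<eta> rule: less_induct)
  case (less k \<eta>)
  show ?case
  proof (cases "k = 1")
    case True
    have "dec p k n (1 * of_int p powr (\<eta> * real n))" if "prime p" for p :: int and n
    proof -
      have "p > 1" using that by (rule prime_gt_1_int)
      moreover have "1 \<le> of_int p powr (\<eta> * real n)"
        using \<open>p > 1\<close> less.prems by (intro ge_one_powr_ge_zero) auto
      ultimately show ?thesis using dec_mono[OF dec_one[OF that]] True by simp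
    qed
    then show ?thesis by (metis zero_less_one)
  next
    case False
    then have k: "k \<ge> 2" using less.prems by simp
    define P where "P = k * (k + 1)"
    \<comment> \<open>The broad part loses at most \<open>p^((3*P+5)*b)\<close>; the additional unit
      leaves a factor \<open>p^(-b)\<close>, which is at most 1/2.\<close>
    define G where "G = 3 * real P + 6"
    have G: "G / \<eta> > 0" using less.prems by (simp add: G_def add_nonneg_pos)
    obtain T :: nat where T: "real k * (G / \<eta>) \<le> real T" using real_arch_simple by blast
    obtain l where l: "1 \<le> l" "l < k" "saving k T l \<ge> G / \<eta>" using saving_large[OF k T] by blast
    have T0: "T > 0"
    proof (rule ccontr)
      assume "\<not> T > 0"
      moreover have "real k * (G / \<eta>) > 0" using G k by (intro mult_pos_pos) auto
      ultimately show False using T by auto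
    qed
    \<comment> \<open>Chosen so that the \<open>T\<close> uses of decoupling in lower degree, each
      losing at most \<open>p^(\<delta> * k^T * b)\<close> besides a constant, lose
      \<open>p^b\<close> together.\<close>
    define \<delta> where "\<delta> = 1 / (real T * real k ^ T)"
    have \<delta>: "\<delta> > 0" using T0 k by (simp add: \<delta>_def)
    have "\<forall>i\<in>{1..<k}. \<exists>p0::int. \<forall>p\<ge>p0. prime p \<longrightarrow> (\<exists>C>0. \<forall>n. dec p i n (C * of_int p powr (\<delta> * real n)))"
      using less.IH \<delta> by auto
    then obtain p0 :: "nat \<Rightarrow> int" where p0: "\<And>i p. i \<in> {1..<k} \<Longrightarrow> p \<ge> p0 i \<Longrightarrow> prime p \<Longrightarrow>
        \<exists>C>0. \<forall>n. dec p i n (C * of_int p powr (\<delta> * real n))" by metis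
    \<comment> \<open>The power of 2 ensures \<open>2 * 2^P <= p^\<eta>\<close>, which pays for the
      narrow part.\<close>
    define p1 where "p1 = max (Max (p0 ` {1..<k})) (max (int k + 1) \<lceil>2 powr ((real P + 1) / \<eta>)\<rceil>)"
    have p0p1: "p0 i \<le> p1" if "i \<in> {1..<k}" for i
    proof -
      have "p0 i \<le> Max (p0 ` {1..<k})" using that by (intro Max_ge) auto
      then show ?thesis by (simp add: p1_def)
    qed
    show ?thesis
    proof (intro exI[of _ p1] allI impI)
      fix p :: int assume pp: "p \<ge> p1" and prime: "prime p"
      have pk: "int k < p" using pp by (simp add: p1_def)
      have pgt: "p > 1" using prime by (rule prime_gt_1_int)
      define x where "x = (of_int p :: real)"
      have x2: "x \<ge> 2" using pgt by (simp add: x_def)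
      have "\<lceil>2 powr ((real P + 1) / \<eta>)\<rceil> \<le> p" using pp by (simp add: p1_def)
      then have "2 powr ((real P + 1) / \<eta>) \<le> x" by (simp add: x_def ceiling_le_iff)
      then have "(2 powr ((real P + 1) / \<eta>)) powr \<eta> \<le> x powr \<eta>" using less.prems by (intro powr_mono2) auto
      then have "2 powr (real P + 1) \<le> x powr \<eta>" using less.prems by (simp add: powr_powr)
      then have x\<eta>: "2 * 2 ^ P \<le> x powr \<eta>" by (simp add: powr_add powr_realpow)
      obtain c where c: "\<And>i n. i \<in> {1..<k} \<Longrightarrow> dec p i n (c i * x powr (\<delta> * real n))"
        using p0[OF _ order_trans[OF p0p1 pp] prime] unfolding x_def by metis
      define C1 where "C1 = max 1 (Max (c ` {1..<k}))"
      have C1: "C1 \<ge> 1" by (simp add: C1_def)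
      have H2: "dec p i m (C1 * x powr (\<delta> * real m))" if "1 \<le> i" "i < k" for i m
      proof (rule dec_mono[OF c])
        have "c i \<le> Max (c ` {1..<k})" using that by (intro Max_ge) auto
        then have "c i \<le> C1" by (simp add: C1_def)
        then show "c i * x powr (\<delta> * real m) \<le> C1 * x powr (\<delta> * real m)" by (intro mult_right_mono) auto
      qed (use that pgt in auto)
      obtain B :: nat where B: "C1 ^ T < 2 ^ B" using real_arch_pow[of 2] by auto
      \<comment> \<open>Divisible as the iteration requires, large enough for
        \<open>C1^T <= p^b\<close>, and at least \<open>k\<close>, so that the iteration may start
        from the scale \<open>a = 1\<close>.\<close>
      define b where "b = fact k ^ T * (B + 1)"
      have fk: "(fact k ^ T :: nat) \<ge> 1" by simp
      have bB: "b \<ge> B + 1" using mult_le_mono1[OF fk, of "B + 1"] by (simp add: b_def)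
      have bk: "b \<ge> k"
      proof -
        have "k \<le> fact k" by (rule fact_ge_self)
        also have "\<dots> = fact k ^ 1" by simp
        also have "\<dots> \<le> fact k ^ T" using T0 by (intro power_increasing) auto
        also have "\<dots> \<le> b" by (simp add: b_def)
        finally show ?thesis .
      qed
      have C1T: "C1 ^ T \<le> x ^ b"
      proof -
        have "C1 ^ T \<le> 2 ^ B" using B by simp
        also have "\<dots> \<le> 2 ^ b" using bB by (intro power_increasing) auto
        also have "\<dots> \<le> x ^ b" using x2 by (intro power_mono) auto
        finally show ?thesis .
      qed
      define n0 where "n0 = b * k ^ T"
      \<comment> \<open>For \<open>n < n0\<close>, where the iteration does not fit into
        \<open>n\<close> digits, this constant absorbs the trivial bound.\<close>
      define C where "C = x ^ (n0 * P)"
      have C0: "C \<ge> 1" unfolding C_def using x2 by (intro one_le_power) auto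
      have "dec p k n (C * x powr (\<eta> * real n))" for n
      proof (induction n rule: less_induct)
        case (less n)
        show ?case unfolding dec_def
        proof (intro allI impI)
          fix \<phi> :: "nat \<Rightarrow> int poly" and w :: "int \<Rightarrow> complex" and A :: "int set"
          assume cur: "curve p k \<phi>" and finA: "finite A"
          interpret cs: curve_sum p k n \<phi> w A
            by unfold_locales (use prime pk k cur finA in auto)
          have PP: "cs.P = P" by (simp add: cs.P_def P_def)
          have xn: "x powr (\<eta> * real n) \<ge> 1" using x2 \<open>\<eta> > 0\<close> by (intro ge_one_powr_ge_zero) auto
          show "dec_at p k n (C * x powr (\<eta> * real n)) \<phi> w A"
          proof (rule cs.dec_atI, cases "n < n0")
            case True
            have "x ^ (n * P) \<le> x ^ (n0 * P)" using True x2 by (intro power_increasing mult_le_mono) auto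
            also have "\<dots> * 1 \<le> C * x powr (\<eta> * real n)" unfolding C_def using xn x2 by (intro mult_left_mono) auto
            finally have "x ^ (n * P) * cs.Av 0 0 \<le> C * x powr (\<eta> * real n) * cs.Av 0 0"
              by (intro mult_right_mono) auto
            with cs.trivial_dec show "mean k cs.Q (\<lambda>\<alpha>. cs.f 0 0 \<alpha> ^ cs.P) \<le> C * x powr (\<eta> * real n) * cs.Av 0 0"
              unfolding PP x_def by linarith
          next
            case False
            then have nn0: "b * k ^ T \<le> n" by (simp add: n0_def)
            have "k ^ T \<ge> 1" using k by simp
            then have bn: "b \<le> n" using nn0 by (metis mult.right_neutral mult_le_mono2 order_trans)
            have b1: "1 \<le> b" using bB by simp
            define K where "K = (C1 * x powr (\<delta> * real (k ^ T * b))) ^ T * (C * x powr (\<eta> * (real n - saving k T l * real b)))"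
            have "cs.Bil l 1 b K"
              unfolding K_def x_def
            proof (rule cs.Bil_iterate[OF _ H2[unfolded x_def]])
              show "dec p k m (C * of_int p powr (\<eta> * real m))" if "m < n" for m
                using less[OF that] by (simp add: x_def)
              have "l * 1 \<le> b" using l bk by simp
              also have "\<dots> \<le> (k - l + 1) * b" by simp
              finally show "l * 1 \<le> (k - l + 1) * b" .
              show "fact k ^ T dvd b" by (simp add: b_def)
            qed (use l C0 C1 \<open>\<eta> > 0\<close> \<delta> b1 bn nn0 in auto)
            have K0: "K \<ge> 0" unfolding K_def using C0 C1 by simp
            have Kle: "K \<le> x ^ (2 * b) * (C * x powr (\<eta> * real n)) * x powr (- (G * real b))"
            proof -
              have "(x powr (\<delta> * real (k ^ T * b))) ^ T = x powr (real T * (\<delta> * real (k ^ T * b)))"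
                using x2 by (simp add: powr_powr powr_realpow[symmetric] mult.commute)
              also have "real T * (\<delta> * real (k ^ T * b)) = real b"
                using T0 k by (simp add: \<delta>_def)
              also have "x powr real b = x ^ b" using x2 by (simp add: powr_realpow)
              finally have e1: "(C1 * x powr (\<delta> * real (k ^ T * b))) ^ T \<le> x ^ b * x ^ b"
                using C1T x2 by (simp add: power_mult_distrib)
              have "G * real b \<le> \<eta> * saving k T l * real b"
                using l(3) \<open>\<eta> > 0\<close> by (intro mult_right_mono) (auto simp: field_simps)
              then have "x powr (\<eta> * (real n - saving k T l * real b)) \<le> x powr (\<eta> * real n + - (G * real b))"
                using x2 by (intro powr_mono) (auto simp: algebra_simps)
              then have e2: "C * x powr (\<eta> * (real n - saving k T l * real b)) \<le> C * (x powr (\<eta> * real n) * x powr (- (G * real b)))"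
                using C0 by (intro mult_left_mono) (auto simp: powr_add[symmetric])
              have "K \<le> (x ^ b * x ^ b) * (C * (x powr (\<eta> * real n) * x powr (- (G * real b))))"
                unfolding K_def using e1 e2 C0 x2 by (intro mult_mono) auto
              then show ?thesis by (simp add: power_add[symmetric] mult_2 mult.assoc)
            qed
            have narrow: "2 ^ P * (C * x powr (\<eta> * real (n - 1))) \<le> 1 / 2 * (C * x powr (\<eta> * real n))"
            proof -
              have n1: "n \<ge> 1" using b1 bn by simp
              have "x powr (\<eta> * real n) = x powr (\<eta> * real (n - 1)) * x powr \<eta>"
                using n1 by (simp add: powr_add[symmetric] of_nat_diff algebra_simps)
              moreover have "x powr (\<eta> * real (n - 1)) * (2 * 2 ^ P) \<le> x powr (\<eta> * real (n - 1)) * x powr \<eta>"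
                using x\<eta> by (intro mult_left_mono) auto
              ultimately have "C * (2 * 2 ^ P * x powr (\<eta> * real (n - 1))) \<le> C * x powr (\<eta> * real n)"
                using C0 by (intro mult_left_mono) (auto simp: algebra_simps)
              then show ?thesis by (simp add: mult_ac)
            qed
            have broad: "(2 * x) ^ P * (x ^ 2 * ((x ^ b) ^ P * (x ^ b * K))) \<le> 1 / 2 * (C * x powr (\<eta> * real n))"
            proof -
              have "(2 * x) ^ P \<le> (x * x) ^ P" using x2 by (intro power_mono mult_right_mono) auto
              also have "\<dots> = x ^ (2 * P)" by (simp add: power2_eq_square[symmetric] power_mult)
              also have "\<dots> \<le> x ^ (2 * P * b)" using x2 b1 by (intro power_increasing) auto
              finally have f1: "(2 * x) ^ P \<le> x ^ (2 * P * b)" .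
              have f2: "x ^ 2 \<le> x ^ (2 * b)" using x2 b1 by (intro power_increasing) auto
              have "(2 * x) ^ P * (x ^ 2 * ((x ^ b) ^ P * (x ^ b * K))) \<le>
                 x ^ (2 * P * b) * (x ^ (2 * b) * (x ^ (P * b) * (x ^ b *
                  (x ^ (2 * b) * (C * x powr (\<eta> * real n)) * x powr (- (G * real b))))))"
                unfolding power_mult[symmetric] mult.commute[of b P]
                using f1 f2 Kle K0 x2 C0 by (intro mult_mono) auto
              also have "\<dots> = (C * x powr (\<eta> * real n)) * (x ^ (2 * P * b + (2 * b + (P * b + (b + 2 * b)))) * x powr (- (G * real b)))"
                by (simp only: power_add mult_ac)
              also have "\<dots> \<le> (C * x powr (\<eta> * real n)) * (1 / 2)"
              proof (rule mult_left_mono)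
                have "x ^ (2 * P * b + (2 * b + (P * b + (b + 2 * b)))) * x powr (- (G * real b)) =
                   x powr (real (2 * P * b + (2 * b + (P * b + (b + 2 * b)))) + - (G * real b))"
                  unfolding powr_add using x2 by (simp only: powr_realpow)
                also have "real (2 * P * b + (2 * b + (P * b + (b + 2 * b)))) + - (G * real b) = - real b"
                  by (simp add: G_def algebra_simps)
                also have "x powr (- real b) \<le> x powr (- 1)" using x2 b1 by (intro powr_mono) auto
                also have "x powr (- 1) \<le> 1 / 2" using x2 by (simp add: powr_minus field_simps)
                finally show "x ^ (2 * P * b + (2 * b + (P * b + (b + 2 * b)))) * x powr (- (G * real b)) \<le> 1 / 2" .
              qed (use C0 in auto)
              finally show ?thesis by (simp only: mult.commute)
            qed
            have "mean k cs.Q (\<lambda>\<alpha>. cs.f 0 0 \<alpha> ^ P) \<le>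
               (2 ^ P * (C * x powr (\<eta> * real (n - 1))) + (2 * x) ^ P * (x ^ 2 * ((x ^ b) ^ P * (x ^ b * K)))) * cs.Av 0 0"
              unfolding x_def PP[symmetric]
            proof (rule cs.broad_narrow)
              show "dec p k (n - 1) (C * of_int p powr (\<eta> * real (n - 1)))"
                using less[of "n - 1"] b1 bn by (simp add: x_def)
              show "cs.Bil l 1 b K" by fact
            qed (use l b1 bn K0 C0 in auto)
            also have "\<dots> \<le> (C * x powr (\<eta> * real n)) * cs.Av 0 0"
              using add_mono[OF narrow broad] by (intro mult_right_mono) auto
            finally show "mean k cs.Q (\<lambda>\<alpha>. cs.f 0 0 \<alpha> ^ cs.P) \<le> C * x powr (\<eta> * real n) * cs.Av 0 0"
              unfolding PP .
          qed
        qed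
      qed
      then show "\<exists>C>0. \<forall>n. dec p k n (C * of_int p powr (\<eta> * real n))"
        using C0 unfolding x_def by (intro exI[of _ C]) auto
    qed
  qed
qed

section \<open>Vinogradov's system over an interval\<close>

definition vinogradov_pairs :: "nat \<Rightarrow> nat \<Rightarrow> int \<Rightarrow> ((nat \<Rightarrow> int) \<times> (nat \<Rightarrow> int)) set"
  where "vinogradov_pairs k s N = {(x, y) \<in> (PiE {..<s} (\<lambda>_. {-N..<N})) \<times> (PiE {..<s} (\<lambda>_. {-N..<N})).
     \<forall>j\<in>{1..k}. (\<Sum>i<s. x i ^ j) = (\<Sum>i<s. y i ^ j)}"

text \<open>The moment counts the solutions of the system modulo \<open>Q\<close>, among which are
  all integer solutions.\<close>

lemma card_vinogradov_pairs_le: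
  assumes "Q > 0"
  shows "real (card (vinogradov_pairs k s N)) \<le>
    moment k Q (monom 1) (\<lambda>_. 1) {-N..<N} (2 * s)"
proof -
  define X where "X = PiE {..<s} (\<lambda>_. {-N..<N})"
  define v where "v = (\<lambda>(x :: nat \<Rightarrow> int) j. \<Sum>i<s. x i ^ j)"
  have fin: "finite X" by (simp add: X_def finite_PiE)
  have "expsum k Q (monom 1) (\<lambda>_. 1) {-N..<N} \<alpha> ^ s =
     (\<Sum>x\<in>X. e (of_int (\<Sum>j=1..k. \<alpha> j * v x j) / of_int Q))" for \<alpha>
  proof -
    have "expsum k Q (monom 1) (\<lambda>_. 1) {-N..<N} \<alpha> ^ s =
      (\<Prod>i<s. \<Sum>x\<in>{-N..<N}. e (of_int (\<Sum>j=1..k. \<alpha> j * x ^ j) / of_int Q))"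
      by (simp add: expsum_def ip_def poly_monom)
    also have "\<dots> = (\<Sum>x\<in>X. \<Prod>i<s. e (of_int (\<Sum>j=1..k. \<alpha> j * x i ^ j) / of_int Q))"
      unfolding X_def by (rule prod_sum_PiE) auto
    also have "\<dots> = (\<Sum>x\<in>X. e (of_int (\<Sum>j=1..k. \<alpha> j * v x j) / of_int Q))"
    proof (intro sum.cong refl)
      fix x
      have "(\<Sum>j=1..k. \<alpha> j * v x j) = (\<Sum>i<s. \<Sum>j=1..k. \<alpha> j * x i ^ j)"
        unfolding v_def sum_distrib_left by (rule sum.swap)
      then show "(\<Prod>i<s. e (of_int (\<Sum>j=1..k. \<alpha> j * x i ^ j) / of_int Q)) = e (of_int (\<Sum>j=1..k. \<alpha> j * v x j) / of_int Q)"
        by (simp only: e_sum[symmetric] of_int_sum sum_divide_distrib)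
    qed
    finally show ?thesis .
  qed
  then have "norm (expsum k Q (monom 1) (\<lambda>_. 1) {-N..<N} \<alpha>) ^ (2 * s) =
     norm (\<Sum>x\<in>X. 1 * e (of_int (\<Sum>j=1..k. \<alpha> j * v x j) / of_int Q)) ^ 2" for \<alpha>
    by (metis (no_types, lifting) mult_1 norm_power power_mult mult.commute sum.cong)
  then have "of_real (moment k Q (monom 1) (\<lambda>_. 1) {-N..<N} (2 * s)) =
     (\<Sum>x\<in>X. \<Sum>y\<in>X. if (\<forall>j\<in>{1..k}. [v x j = v y j] (mod Q)) then 1 * cnj 1 else (0::complex))"
    using parseval[OF fin assms, where w = "\<lambda>_. 1" and v = v and k = k] by (simp add: moment_def)
  also have "\<dots> = of_real (\<Sum>x\<in>X. \<Sum>y\<in>X. if (\<forall>j\<in>{1..k}. [v x j = v y j] (mod Q)) then 1 else 0)"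
    by (simp only: of_real_sum) (intro sum.cong refl, auto)
  finally have eq: "moment k Q (monom 1) (\<lambda>_. 1) {-N..<N} (2 * s) =
     (\<Sum>x\<in>X. \<Sum>y\<in>X. if (\<forall>j\<in>{1..k}. [v x j = v y j] (mod Q)) then 1 else 0)"
    by (simp only: of_real_eq_iff)
  have "real (card (vinogradov_pairs k s N)) = (\<Sum>z\<in>X \<times> X. if (\<forall>j\<in>{1..k}. v (fst z) j = v (snd z) j) then 1 else 0)"
    using fin unfolding vinogradov_pairs_def X_def[symmetric]
    by (subst sum.inter_filter[symmetric]) (auto simp: v_def intro!: arg_cong[where f = card])
  also have "\<dots> \<le> (\<Sum>z\<in>X \<times> X. if (\<forall>j\<in>{1..k}. [v (fst z) j = v (snd z) j] (mod Q)) then 1 else 0)"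
    by (intro sum_mono) auto
  also have "\<dots> = moment k Q (monom 1) (\<lambda>_. 1) {-N..<N} (2 * s)"
    unfolding eq by (simp add: sum.cartesian_product case_prod_beta)
  finally show ?thesis .
qed

text \<open>With \<open>p^n\<close> the least power that is at least \<open>2*N\<close>, a class
  modulo \<open>p^n\<close> contains at most one point of the interval, so decoupling goes down to
  single points. Minimality gives \<open>p^n <= 2*N*p\<close>, hence the right order of magnitude.
  One fixed prime serves all \<open>N\<close>.\<close>

theorem vinogradov_mean_value:
  assumes "k \<ge> 1" "\<epsilon> > 0" "s = k * (k + 1) div 2"
  shows "\<exists>C>0. \<forall>N\<ge>1. real (card (vinogradov_pairs k s N)) \<le> C * of_int N powr (real s + \<epsilon>)"
proof -
  obtain p0 :: int where p0: "\<And>p. p \<ge> p0 \<Longrightarrow> prime p \<Longrightarrow> \<exists>C>0. \<forall>n. dec p k n (C * of_int p powr (\<epsilon> * real n))"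
    using decoupling[OF assms(1,2)] by blast
  obtain p' :: nat where "prime p'" "p' > nat p0" using bigger_prime by blast
  define p where "p = int p'"
  have p: "prime p" "p \<ge> p0" using \<open>prime p'\<close> \<open>p' > nat p0\<close> by (auto simp: p_def)
  have p1: "p > 1" using p(1) by (rule prime_gt_1_int)
  define x where "x = (of_int p :: real)"
  have x: "x > 1" using p1 by (simp add: x_def)
  obtain C where C: "C > 0" "\<And>n. dec p k n (C * x powr (\<epsilon> * real n))"
    using p0[OF p(2,1)] unfolding x_def by blast
  have s1: "s \<ge> 1" using assms(1,3) mult_le_mono[OF assms(1), of 2 "k + 1"] by simp
  have s2: "k * (k + 1) = 2 * s" using assms(3) by simp
  define C' where "C' = C * (2 * x) powr (real s - 1 + \<epsilon>) * 2"
  have "real (card (vinogradov_pairs k s N)) \<le> C' * of_int N powr (real s + \<epsilon>)" if N: "N \<ge> 1" for N :: int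
  proof -
    define A where "A = {-N..<N}"
    have ex: "\<exists>n. 2 * N \<le> p ^ n"
    proof -
      obtain n where "real_of_int (2 * N) < x ^ n" using real_arch_pow[OF x] by blast
      then have "real_of_int (2 * N) < real_of_int (p ^ n)" by (simp add: x_def)
      then have "2 * N < p ^ n" by (simp only: of_int_less_iff)
      then show ?thesis by (intro exI[of _ n]) simp
    qed
    define n where "n = (LEAST n. 2 * N \<le> p ^ n)"
    have n1: "2 * N \<le> p ^ n" unfolding n_def using ex by (rule LeastI_ex)
    have n2: "p ^ n \<le> 2 * N * p"
    proof (cases n)
      case 0
      then show ?thesis using N p1 mult_mono[of 1 "2 * N" 1 p] by simp
    next
      case (Suc n')
      then have "\<not> 2 * N \<le> p ^ n'" using not_less_Least[of n' "\<lambda>n. 2 * N \<le> p ^ n"] by (simp add: n_def)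
      then have "p ^ n' * p \<le> 2 * N * p" using p1 by (intro mult_right_mono) auto
      then show ?thesis using Suc by (simp add: mult.commute)
    qed
    have Q: "p ^ (k * n) > 0" using p1 by simp
    have cur: "curve p k (monom 1)" unfolding curve_def by auto
    have "real (card (vinogradov_pairs k s N)) \<le> moment k (p ^ (k * n)) (monom 1) (\<lambda>_. 1) A (k * (k + 1))"
      unfolding s2 A_def by (rule card_vinogradov_pairs_le[OF Q])
    also have "\<dots> \<le> (C * x powr (\<epsilon> * real n)) * of_int p ^ (n * (k * (k + 1) div 2 - 1)) * (\<Sum>\<theta>\<in>{0..<p ^ n}.
         moment k (p ^ (k * n)) (monom 1) (\<lambda>_. 1) (cls p n \<theta> A) (k * (k + 1)))"
      using C(2)[of n] cur unfolding dec_def dec_at_def A_def by blast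
    also have "\<dots> \<le> (C * x powr (\<epsilon> * real n)) * of_int p ^ (n * (k * (k + 1) div 2 - 1)) * (2 * of_int N)"
    proof (rule mult_left_mono)
      have "moment k (p ^ (k * n)) (monom 1) (\<lambda>_. 1) (cls p n \<theta> A) (k * (k + 1))
         \<le> real (card (cls p n \<theta> A))" if "\<theta> \<in> {0..<p ^ n}" for \<theta>
      proof -
        have inj: "x = y" if "x \<in> cls p n \<theta> A" "y \<in> cls p n \<theta> A" for x y
        proof -
          have "x mod p ^ n = y mod p ^ n" using that by (simp add: cls_def)
          then have "p ^ n dvd x - y" by (simp add: mod_eq_dvd_iff)
          moreover have "\<bar>x - y\<bar> < p ^ n" using that n1 by (auto simp: cls_def A_def)
          ultimately show ?thesis using zdvd_imp_le[of "p ^ n" "\<bar>x - y\<bar>"] by auto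
        qed
        have fin: "finite (cls p n \<theta> A)" by (simp add: A_def)
        have "norm (expsum k (p ^ (k * n)) (monom 1) (\<lambda>_. 1) (cls p n \<theta> A) \<alpha>) ^ (k * (k + 1)) \<le> real (card (cls p n \<theta> A))" for \<alpha>
        proof (cases "cls p n \<theta> A = {}")
          case True
          then show ?thesis using s1 s2 by (simp add: expsum_def power_0_left)
        next
          case False
          then obtain y where "cls p n \<theta> A = {y}" using inj by blast
          then show ?thesis by (simp add: expsum_def)
        qed
        then show ?thesis using mean_mono[of k "p ^ (k * n)" _ "\<lambda>_. real (card (cls p n \<theta> A))"] Q
          by (simp add: moment_def mean_const)
      qed
      then have "(\<Sum>\<theta>\<in>{0..<p ^ n}. moment k (p ^ (k * n)) (monom 1) (\<lambda>_. 1) (cls p n \<theta> A) (k * (k + 1)))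
        \<le> (\<Sum>\<theta>\<in>{0..<p ^ n}. real (card (cls p n \<theta> A)))" by (rule sum_mono)
      also have "\<dots> = (\<Sum>\<theta>\<in>{0..<p ^ n}. \<Sum>y\<in>{y\<in>A. y mod p ^ n = \<theta>}. 1)" by (simp add: cls_def)
      also have "\<dots> = (\<Sum>y\<in>A. 1)" using p1 by (intro sum.group) (auto simp: A_def)
      also have "\<dots> = 2 * of_int N" using N by (simp add: A_def)
      finally show "(\<Sum>\<theta>\<in>{0..<p ^ n}. moment k (p ^ (k * n)) (monom 1) (\<lambda>_. 1) (cls p n \<theta> A) (k * (k + 1))) \<le> 2 * of_int N" .
    qed (use C x p1 in auto)
    also have "\<dots> = C * (x ^ n) powr (real s - 1 + \<epsilon>) * (2 * of_int N)"
    proof -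
      have "of_int p ^ (n * (k * (k + 1) div 2 - 1)) = x powr (real n * (real s - 1))"
        using x s1 unfolding s2 by (simp add: x_def[symmetric] powr_realpow[symmetric] of_nat_diff)
      moreover have "(x ^ n) powr (real s - 1 + \<epsilon>) = x powr (\<epsilon> * real n) * x powr (real n * (real s - 1))"
        using x by (simp add: powr_realpow[symmetric] powr_powr powr_add[symmetric] algebra_simps)
      ultimately show ?thesis by simp
    qed
    also have "\<dots> \<le> C * (2 * x * of_int N) powr (real s - 1 + \<epsilon>) * (2 * of_int N)"
    proof -
      have "real_of_int (p ^ n) \<le> real_of_int (2 * N * p)" using n2 by (simp only: of_int_le_iff)
      then have "x ^ n \<le> 2 * x * of_int N" by (simp add: x_def mult_ac)
      then show ?thesis using C x s1 N assms(2) by (intro mult_right_mono mult_left_mono powr_mono2) auto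
    qed
    also have "\<dots> = C' * of_int N powr (real s + \<epsilon>)"
    proof -
      have "of_int N powr (real s + \<epsilon>) = of_int N powr (real s - 1 + \<epsilon>) * (of_int N :: real)"
        using powr_mult_base[of "of_int N" "real s - 1 + \<epsilon>"] N by (simp add: algebra_simps)
      then show ?thesis using N x by (simp add: C'_def powr_mult)
    qed
    finally show ?thesis .
  qed
  moreover have "C' > 0" using C x by (simp add: C'_def)
  ultimately show ?thesis by blast
qed

section \<open>Weyl sums\<close>

text \<open>A dual large sieve inequality: the Gram matrix of the vectors \<open>h y\<close> is
  Hermitian, so its norm is bounded by its row sums, as in Schur's test. The left-hand side
  \<open>Z\<close> satisfies \<open>Z^2 <= \<kappa> * Z\<close> times the norm of \<open>R\<close>,
  and a factor \<open>Z\<close> cancels.\<close>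

lemma duality:
  fixes h :: "'a \<Rightarrow> 'b \<Rightarrow> complex"
  assumes "finite Y" "finite I" "\<kappa> \<ge> 0" and \<kappa>: "\<And>y. y \<in> Y \<Longrightarrow> (\<Sum>y'\<in>Y. norm (\<Sum>i\<in>I. h y i * cnj (h y' i))) \<le> \<kappa>"
  shows "(\<Sum>y\<in>Y. norm (\<Sum>i\<in>I. R i * h y i) ^ 2) \<le> \<kappa> * (\<Sum>i\<in>I. norm (R i) ^ 2)"
proof -
  define H where "H = (\<lambda>y. \<Sum>i\<in>I. R i * h y i)"
  define Z where "Z = (\<Sum>y\<in>Y. norm (H y) ^ 2)"
  define K where "K = (\<lambda>y y'. \<Sum>i\<in>I. h y i * cnj (h y' i))"
  define V where "V = (\<lambda>i. \<Sum>y\<in>Y. h y i * cnj (H y))"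
  have Ksym: "norm (K y y') = norm (K y' y)" for y y'
  proof -
    have "K y y' = cnj (K y' y)" by (simp add: K_def mult.commute)
    then show ?thesis by simp
  qed
  have Z0: "Z \<ge> 0" unfolding Z_def by (intro sum_nonneg) auto
  have "of_real Z = (\<Sum>y\<in>Y. H y * cnj (H y))" by (simp only: Z_def of_real_sum complex_norm_square)
  also have "\<dots> = (\<Sum>y\<in>Y. \<Sum>i\<in>I. R i * (h y i * cnj (H y)))"
  proof (intro sum.cong refl)
    fix y
    have "H y * cnj (H y) = (\<Sum>i\<in>I. R i * h y i) * cnj (H y)" by (simp only: H_def)
    then show "H y * cnj (H y) = (\<Sum>i\<in>I. R i * (h y i * cnj (H y)))"
      by (simp add: sum_distrib_right mult.assoc)
  qed
  also have "\<dots> = (\<Sum>i\<in>I. R i * V i)"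
    unfolding V_def sum_distrib_left by (rule sum.swap)
  finally have Zeq: "of_real Z = (\<Sum>i\<in>I. R i * V i)" .
  have "Z = norm (of_real Z :: complex)" using Z0 by simp
  also have "\<dots> \<le> (\<Sum>i\<in>I. norm (R i) * norm (V i))"
    unfolding Zeq norm_mult[symmetric] by (rule norm_sum)
  finally have "Z ^ 2 \<le> (\<Sum>i\<in>I. norm (R i) * norm (V i)) ^ 2" using Z0 by (intro power_mono)
  also have "\<dots> \<le> (\<Sum>i\<in>I. norm (R i) ^ 2) * (\<Sum>i\<in>I. norm (V i) ^ 2)" by (rule Cauchy_Schwarz_ineq_sum)
  also have "\<dots> \<le> (\<Sum>i\<in>I. norm (R i) ^ 2) * (\<kappa> * Z)"
  proof (rule mult_left_mono)
    have "of_real (\<Sum>i\<in>I. norm (V i) ^ 2) = (\<Sum>i\<in>I. V i * cnj (V i))" by (simp only: of_real_sum complex_norm_square)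
    also have "\<dots> = (\<Sum>i\<in>I. \<Sum>y\<in>Y. \<Sum>y'\<in>Y. cnj (H y) * H y' * (h y i * cnj (h y' i)))"
      unfolding V_def cnj_sum sum_product by (intro sum.cong refl) simp
    also have "\<dots> = (\<Sum>y\<in>Y. \<Sum>y'\<in>Y. cnj (H y) * H y' * K y y')"
      unfolding K_def sum_distrib_left by (subst sum.swap, intro sum.cong refl, rule sum.swap)
    finally have eq: "of_real (\<Sum>i\<in>I. norm (V i) ^ 2) = (\<Sum>y\<in>Y. \<Sum>y'\<in>Y. cnj (H y) * H y' * K y y')" .
    have "(\<Sum>i\<in>I. norm (V i) ^ 2) = norm (of_real (\<Sum>i\<in>I. norm (V i) ^ 2) :: complex)"
      by (simp add: sum_nonneg del: of_real_sum of_real_power)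
    also have "\<dots> \<le> (\<Sum>y\<in>Y. \<Sum>y'\<in>Y. norm (cnj (H y) * H y' * K y y'))"
      unfolding eq by (intro order_trans[OF norm_sum] sum_mono norm_sum)
    also have "\<dots> \<le> (\<Sum>y\<in>Y. \<Sum>y'\<in>Y. (norm (H y) ^ 2 / 2 + norm (H y') ^ 2 / 2) * norm (K y y'))"
    proof (intro sum_mono)
      fix y y'
      have "0 \<le> (norm (H y) - norm (H y')) ^ 2" by simp
      then have "norm (H y) * norm (H y') \<le> norm (H y) ^ 2 / 2 + norm (H y') ^ 2 / 2"
        by (simp add: power2_diff)
      then show "norm (cnj (H y) * H y' * K y y') \<le> (norm (H y) ^ 2 / 2 + norm (H y') ^ 2 / 2) * norm (K y y')"
        by (simp add: norm_mult mult_right_mono)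
    qed
    also have "\<dots> = (\<Sum>y\<in>Y. \<Sum>y'\<in>Y. norm (H y) ^ 2 / 2 * norm (K y y')) + (\<Sum>y\<in>Y. \<Sum>y'\<in>Y. norm (H y') ^ 2 / 2 * norm (K y y'))"
      by (simp add: distrib_right sum.distrib)
    also have "(\<Sum>y\<in>Y. \<Sum>y'\<in>Y. norm (H y') ^ 2 / 2 * norm (K y y')) = (\<Sum>y\<in>Y. \<Sum>y'\<in>Y. norm (H y) ^ 2 / 2 * norm (K y y'))"
      by (subst sum.swap) (simp add: Ksym)
    also have "(\<Sum>y\<in>Y. \<Sum>y'\<in>Y. norm (H y) ^ 2 / 2 * norm (K y y')) + (\<Sum>y\<in>Y. \<Sum>y'\<in>Y. norm (H y) ^ 2 / 2 * norm (K y y'))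
       = (\<Sum>y\<in>Y. norm (H y) ^ 2 * (\<Sum>y'\<in>Y. norm (K y y')))"
      by (simp add: sum.distrib[symmetric] sum_distrib_right distrib_right[symmetric] mult.commute)
    also have "\<dots> \<le> (\<Sum>y\<in>Y. norm (H y) ^ 2 * \<kappa>)"
      using \<kappa> by (intro sum_mono mult_left_mono) (auto simp: K_def)
    also have "\<dots> = \<kappa> * Z" by (simp add: Z_def sum_distrib_left mult.commute)
    finally show "(\<Sum>i\<in>I. norm (V i) ^ 2) \<le> \<kappa> * Z" .
  qed (auto intro: sum_nonneg)
  finally have ZZ: "Z * Z \<le> (\<kappa> * (\<Sum>i\<in>I. norm (R i) ^ 2)) * Z" by (simp add: power2_eq_square mult_ac)
  have "Z \<le> \<kappa> * (\<Sum>i\<in>I. norm (R i) ^ 2)"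
  proof (cases "Z = 0")
    case True
    then show ?thesis using assms(3) by (auto intro!: mult_nonneg_nonneg sum_nonneg)
  next
    case False
    then show ?thesis using ZZ Z0 by simp
  qed
  then show ?thesis by (simp add: Z_def H_def)
qed

section \<open>Dirichlet kernels at well-spaced points\<close>

definition dirichlet_kernel :: "nat \<Rightarrow> real \<Rightarrow> real"
  where "dirichlet_kernel B \<theta> = norm (\<Sum>m\<in>{- int B..int B}. e (of_int m * \<theta>))"

definition dist_nint :: "real \<Rightarrow> real"
  where "dist_nint x = \<bar>x - of_int (round x)\<bar>"

lemma dirichlet_kernel_nonneg: "dirichlet_kernel B \<theta> \<ge> 0" by (simp add: dirichlet_kernel_def)

lemma dirichlet_kernel_le: "dirichlet_kernel B \<theta> \<le> 2 * real B + 1"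
proof -
  have "dirichlet_kernel B \<theta> \<le> (\<Sum>m\<in>{- int B..int B}. 1)"
    unfolding dirichlet_kernel_def by (rule order_trans[OF norm_sum]) simp
  then show ?thesis by simp
qed

text \<open>The sine is concave on [0, pi], so it lies above its chord from 0 to pi/2.\<close>

lemma jordan_sin:
  assumes "0 \<le> t" "t \<le> 1"
  shows "t \<le> sin (t * (pi / 2))"
proof -
  have "concave_on {0..pi} sin"
    by (rule f''_le0_imp_concave[where f' = cos and f'' = "\<lambda>x. - sin x"])
       (auto intro!: derivative_eq_intros sin_ge_zero)
  then have "(1 - t) * sin 0 + t * sin (pi / 2) \<le> sin ((1 - t) *\<^sub>R 0 + t *\<^sub>R (pi / 2))"
    using assms by (intro concave_onD[where A = "{0..pi}"]) auto
  then show ?thesis by simp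
qed

lemma norm_e_minus_one: "norm (e x - 1) \<ge> 4 * dist_nint x"
proof -
  define r where "r = x - of_int (round x)"
  have r: "\<bar>r\<bar> \<le> 1 / 2" unfolding r_def using of_int_round_abs_le[of x] by (simp add: abs_minus_commute)
  have "e x = e r" unfolding r_def using e_add_int[of "x - of_int (round x)" "round x"] by simp
  also have "e r = exp (\<i> * of_real (2 * pi * r))" by (simp add: e_def mult_ac)
  also have "norm (\<dots> - 1) = 2 * \<bar>sin (2 * pi * r / 2)\<bar>" by (rule dist_exp_i_1)
  also have "\<bar>sin (2 * pi * r / 2)\<bar> = \<bar>sin (\<bar>2 * r\<bar> * (pi / 2))\<bar>"
    by (cases "r \<ge> 0") (auto simp: algebra_simps)
  finally have "norm (e x - 1) = 2 * \<bar>sin (\<bar>2 * r\<bar> * (pi / 2))\<bar>" .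
  moreover have "\<bar>2 * r\<bar> \<le> sin (\<bar>2 * r\<bar> * (pi / 2))" by (rule jordan_sin) (use r in auto)
  ultimately show ?thesis unfolding dist_nint_def r_def[symmetric] by linarith
qed

lemma dirichlet_kernel_le_inverse: "dirichlet_kernel B x * (2 * dist_nint x) \<le> 1"
proof -
  define z where "z = e x"
  have "(\<Sum>m\<in>{- int B..int B}. e (of_int m * x)) = (\<Sum>i<2 * B + 1. e (- real B * x) * z ^ i)"
    unfolding z_def e_power e_add[symmetric]
    by (rule sum.reindex_bij_witness[where i = "\<lambda>i. int i - int B" and j = "\<lambda>m. nat (m + int B)"])
       (auto simp: algebra_simps)
  then have "dirichlet_kernel B x = norm (\<Sum>i<2 * B + 1. z ^ i)"
    unfolding dirichlet_kernel_def by (simp only: sum_distrib_left[symmetric] norm_mult norm_e mult_1)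
  moreover have "(z - 1) * (\<Sum>i<2 * B + 1. z ^ i) = z ^ (2 * B + 1) - 1"
    by (rule power_diff_1_eq[symmetric])
  ultimately have "norm (z - 1) * dirichlet_kernel B x = norm (z ^ (2 * B + 1) - 1)" by (metis norm_mult)
  also have "\<dots> \<le> norm (z ^ (2 * B + 1)) + norm (1::complex)" by (rule norm_triangle_ineq4)
  also have "\<dots> = 2" by (simp add: z_def norm_power norm_mult)
  finally have "norm (z - 1) * dirichlet_kernel B x \<le> 2" .
  moreover have "4 * dist_nint x * dirichlet_kernel B x \<le> norm (z - 1) * dirichlet_kernel B x"
    using norm_e_minus_one[of x] by (intro mult_right_mono) (auto simp: z_def dirichlet_kernel_nonneg)
  ultimately show ?thesis by (simp add: mult_ac)
qed

lemma dist_nint_le: "dist_nint x \<le> \<bar>x - of_int m\<bar>"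
  unfolding dist_nint_def using round_diff_minimal[of x m] by (simp add: abs_minus_commute)

text \<open>Cells of length \<open>1/(2*q)\<close> around 0 contain at most one point each. The two
  cells that touch 0 are estimated trivially and the others by the inverse distance to 0, which
  yields two harmonic sums.\<close>

lemma sum_kernel_spaced:
  fixes x :: "'a \<Rightarrow> real" and q :: nat
  assumes "finite W" "q \<ge> 1" and sp: "\<And>z z'. z \<in> W \<Longrightarrow> z' \<in> W \<Longrightarrow> z \<noteq> z' \<Longrightarrow> dist_nint (x z - x z') \<ge> 1 / (2 * real q)"
  shows "(\<Sum>z\<in>W. dirichlet_kernel B (x z)) \<le> 2 * (2 * real B + 1) + 2 * real q * (1 + ln (real q))"
proof -
  define \<rho> where "\<rho> = (\<lambda>z. x z - of_int (round (x z)))"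
  define ix where "ix = (\<lambda>z. \<lfloor>2 * real q * \<rho> z\<rfloor>)"
  define M where "M = 2 * real B + 1"
  \<comment> \<open>In units of \<open>1/(2*q)\<close>, cell \<open>i\<close> is the interval from
    \<open>i\<close> to \<open>i + 1\<close>. Its distance from 0 is \<open>i\<close> on the right
    and \<open>-i-1\<close> on the left; the cells 0 and -1 both touch 0.\<close>
  define b where "b = (\<lambda>i::int. if i = 0 \<or> i = -1 then M else if i > 0 then real q / of_int i else real q / of_int (- i - 1))"
  have q0: "real q > 0" using assms(2) by simp
  have inj: "inj_on ix W"
  proof (rule inj_onI, rule ccontr)
    fix z z' assume z: "z \<in> W" "z' \<in> W" "ix z = ix z'" "z \<noteq> z'"
    have "\<bar>2 * real q * \<rho> z - 2 * real q * \<rho> z'\<bar> < 1" using z(3) unfolding ix_def by linarith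
    then have "2 * real q * \<bar>\<rho> z - \<rho> z'\<bar> < 1" using q0 by (simp add: right_diff_distrib[symmetric] abs_mult)
    then have "\<bar>\<rho> z - \<rho> z'\<bar> < 1 / (2 * real q)" using q0 by (simp add: field_simps)
    moreover have "dist_nint (x z - x z') \<le> \<bar>\<rho> z - \<rho> z'\<bar>"
      using dist_nint_le[of "x z - x z'" "round (x z) - round (x z')"] by (simp add: \<rho>_def algebra_simps)
    ultimately show False using sp[of z z'] z by linarith
  qed
  have \<rho>: "\<bar>\<rho> z\<bar> \<le> 1 / 2" for z unfolding \<rho>_def using of_int_round_abs_le[of "x z"] by (simp add: abs_minus_commute)
  have gb: "dirichlet_kernel B (x z) \<le> b (ix z)" for z
  proof -
    have dr: "dist_nint (x z) = \<bar>\<rho> z\<bar>" by (simp add: dist_nint_def \<rho>_def)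
    have key: "dirichlet_kernel B (x z) \<le> real q / y" if "y > 0" "y \<le> 2 * real q * \<bar>\<rho> z\<bar>" for y
    proof -
      have "dirichlet_kernel B (x z) * y \<le> dirichlet_kernel B (x z) * (2 * real q * \<bar>\<rho> z\<bar>)" using that dirichlet_kernel_nonneg by (intro mult_left_mono) auto
      also have "\<dots> = real q * (dirichlet_kernel B (x z) * (2 * dist_nint (x z)))" by (simp add: dr)
      also have "\<dots> \<le> real q * 1" using dirichlet_kernel_le_inverse q0 by (intro mult_left_mono) auto
      finally show ?thesis using that by (simp add: pos_le_divide_eq)
    qed
    have fl: "of_int (ix z) \<le> 2 * real q * \<rho> z" "2 * real q * \<rho> z < of_int (ix z) + 1"
      unfolding ix_def by linarith+
    consider "ix z = 0 \<or> ix z = -1" | "ix z > 0" | "ix z < -1" by linarith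
    then show ?thesis
    proof cases
      case 1
      then show ?thesis using dirichlet_kernel_le[of B "x z"] by (simp add: b_def M_def)
    next
      case 2
      have "of_int (ix z) \<le> 2 * real q * \<bar>\<rho> z\<bar>" using fl(1) q0 by (meson abs_ge_self mult_left_mono order_trans less_imp_le mult_nonneg_nonneg zero_le_numeral)
      then show ?thesis using 2 key[of "of_int (ix z)"] by (simp add: b_def)
    next
      case 3
      have "- (2 * real q * \<rho> z) \<le> 2 * real q * \<bar>\<rho> z\<bar>" using q0 mult_left_mono[OF abs_ge_minus_self[of "\<rho> z"], of "2 * real q"] by simp
      then have "of_int (- ix z - 1) \<le> 2 * real q * \<bar>\<rho> z\<bar>" using fl(2) by simp
      then show ?thesis using 3 key[of "of_int (- ix z - 1)"] by (simp add: b_def)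
    qed
  qed
  have rng: "ix z \<in> {- int q..int q}" for z
  proof -
    have "2 * real q * \<rho> z \<le> real q" "- real q \<le> 2 * real q * \<rho> z"
      using \<rho>[of z] q0 mult_left_mono[of "\<rho> z" "1/2" "2 * real q"] mult_left_mono[of "- (1/2)" "\<rho> z" "2 * real q"] by auto
    then show ?thesis unfolding ix_def by (simp add: le_floor_iff floor_le_iff)
  qed
  have b0: "b i \<ge> 0" for i unfolding b_def M_def using q0 by auto
  have "(\<Sum>z\<in>W. dirichlet_kernel B (x z)) \<le> (\<Sum>z\<in>W. b (ix z))" using gb by (intro sum_mono)
  also have "\<dots> = (\<Sum>i\<in>ix ` W. b i)" using inj by (simp add: sum.reindex)
  also have "\<dots> \<le> (\<Sum>i\<in>{- int q..int q}. b i)" using rng b0 by (intro sum_mono2) auto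
  also have "{- int q..int q} = ({0, -1} \<union> {1..int q}) \<union> {- int q..-2}" using assms(2) by auto
  also have "(\<Sum>i\<in>({0, -1} \<union> {1..int q}) \<union> {- int q..-2}. b i) = (b 0 + b (-1)) + (\<Sum>i\<in>{1..int q}. b i) + (\<Sum>i\<in>{- int q..-2}. b i)"
    by (subst sum.union_disjoint; auto)+
  also have "(\<Sum>i\<in>{1..int q}. b i) = (\<Sum>i\<in>{1..int q}. real q / of_int i)" by (intro sum.cong) (auto simp: b_def)
  also have "(b 0 + b (-1)) + (\<Sum>i\<in>{1..int q}. real q / of_int i) + (\<Sum>i\<in>{- int q..-2}. b i)
     \<le> 2 * M + 2 * (\<Sum>i\<in>{1..int q}. real q / of_int i)"
  proof -
    have "(\<Sum>i\<in>{- int q..-2}. b i) = (\<Sum>i\<in>{1..int q - 1}. real q / of_int i)"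
      by (rule sum.reindex_bij_witness[where i = "\<lambda>i. - i - 1" and j = "\<lambda>i. - i - 1"]) (auto simp: b_def)
    also have "\<dots> \<le> (\<Sum>i\<in>{1..int q}. real q / of_int i)" using q0 by (intro sum_mono2) auto
    finally show ?thesis by (simp add: b_def)
  qed
  also have "(\<Sum>i\<in>{1..int q}. real q / of_int i) = real q * harm q"
    unfolding harm_def sum_distrib_left
    by (rule sum.reindex_bij_witness[where i = int and j = nat]) (auto simp: field_simps)
  also have "2 * M + 2 * (real q * harm q) \<le> 2 * M + 2 * (real q * (1 + ln (real q)))"
    using euler_mascheroni_sequence_decreasing[of 1 q] assms(2) q0
    by (intro add_left_mono mult_left_mono) (auto simp: harm_def)
  finally show ?thesis by (simp add: M_def mult.assoc)
qed

text \<open>The fraction \<open>t*a/q\<close> is not an integer and hence has distance at least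
  \<open>1/q\<close> from the integers; replacing \<open>a/q\<close> by \<open>\<alpha>\<close>
  costs at most \<open>|t|/q^2\<close>, which is at most \<open>1/(2*q)\<close>.\<close>

lemma dist_nint_lower:
  fixes a q t :: int
  assumes "q \<ge> 1" "gcd a q = 1" "\<bar>\<alpha> - of_int a / of_int q\<bar> < 1 / (of_int q)\<^sup>2" "t \<noteq> 0" "2 * \<bar>t\<bar> \<le> q"
  shows "dist_nint (\<alpha> * of_int t) \<ge> 1 / (2 * of_int q)"
proof -
  define m where "m = round (\<alpha> * of_int t)"
  define Q where "Q = (of_int q :: real)"
  have Q: "Q \<ge> 1" using assms(1) by (simp add: Q_def)
  have "t * a - m * q \<noteq> 0"
  proof
    assume "t * a - m * q = 0"
    then have "q dvd t * a" by (metis dvd_triv_right eq_iff_diff_eq_0)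
    moreover have "coprime q a" using assms(2) by (simp add: coprime_iff_gcd_eq_1 gcd.commute)
    ultimately have "q dvd t" by (simp add: coprime_dvd_mult_left_iff)
    then have "q \<le> \<bar>t\<bar>" using assms(4) by (simp add: zdvd_imp_le)
    then show False using assms(1,5) by linarith
  qed
  then have "1 \<le> \<bar>t * a - m * q\<bar>" by linarith
  then have "1 \<le> \<bar>real_of_int (t * a - m * q)\<bar>" by linarith
  then have "1 / Q \<le> \<bar>of_int (t * a - m * q) / Q\<bar>" using Q by (simp add: divide_right_mono)
  also have "of_int (t * a - m * q) / Q = of_int t * (of_int a / Q) - of_int m"
    using Q by (simp add: Q_def field_simps)
  also have "\<bar>\<dots>\<bar> \<le> \<bar>\<alpha> * of_int t - of_int m\<bar> + \<bar>of_int t * (\<alpha> - of_int a / Q)\<bar>"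
    by (simp add: algebra_simps)
  also have "\<bar>\<alpha> * of_int t - of_int m\<bar> = dist_nint (\<alpha> * of_int t)" by (simp add: dist_nint_def m_def)
  also have "\<bar>of_int t * (\<alpha> - of_int a / Q)\<bar> \<le> (Q / 2) * (1 / Q\<^sup>2)"
    unfolding abs_mult using assms(3,5) Q by (intro mult_mono) (auto simp: Q_def)
  also have "(Q / 2) * (1 / Q\<^sup>2) = 1 / Q - 1 / (2 * Q)" using Q by (simp add: power2_eq_square field_simps)
  finally show ?thesis by (simp add: Q_def)
qed

lemma sum_kernel_progression:
  fixes a q c N y :: int
  assumes q: "q \<ge> 1" "gcd a q = 1" "\<bar>\<alpha> - of_int a / of_int q\<bar> < 1 / (of_int q)\<^sup>2" and c: "c \<noteq> 0" and N: "N \<ge> 1"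
  shows "(\<Sum>y'\<in>{0..<N}. dirichlet_kernel B (of_int c * \<alpha> * of_int (y - y'))) \<le>
    (2 * of_int \<bar>c\<bar> * of_int N / of_int q + 1) * (2 * (2 * real B + 1) + 2 * of_int q * (1 + ln (of_int q)))"
proof -
  define C where "C = \<bar>c\<bar>"
  have C: "C \<ge> 1" using c by (simp add: C_def)
  \<comment> \<open>Two points of one block differ by at most \<open>L - 1\<close>, so their
    difference times \<open>c\<close> is at most \<open>q/2\<close> and the points are spaced. For
    \<open>q < 2*C\<close> the blocks are single points.\<close>
  define L where "L = q div (2 * C) + 1"
  have L: "L \<ge> 1" using q(1) C by (simp add: L_def pos_imp_zdiv_nonneg_iff)
  define T where "T = {0..(N - 1) div L}"
  define BB where "BB = 2 * (2 * real B + 1) + 2 * of_int q * (1 + ln (of_int q))"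
  have BB0: "BB \<ge> 0" unfolding BB_def using q(1) by (intro add_nonneg_nonneg mult_nonneg_nonneg) auto
  have block: "(\<Sum>y'\<in>{y'\<in>{0..<N}. y' div L = i}. dirichlet_kernel B (of_int c * \<alpha> * of_int (y - y'))) \<le> BB" for i
  proof -
    have sp: "1 / (2 * real (nat q)) \<le> dist_nint (of_int c * \<alpha> * of_int (y - z) - of_int c * \<alpha> * of_int (y - z'))"
      if "z div L = i" "z' div L = i" "z \<noteq> z'" for z z'
    proof -
      have "\<bar>z - z'\<bar> \<le> L - 1"
      proof -
        have "z = L * i + z mod L" "z' = L * i + z' mod L" using that by (metis mult_div_mod_eq)+
        moreover have "0 \<le> z mod L" "z mod L < L" "0 \<le> z' mod L" "z' mod L < L" using L by auto
        ultimately show ?thesis by linarith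
      qed
      then have "2 * C * \<bar>z - z'\<bar> \<le> 2 * C * (q div (2 * C))" using C by (simp add: L_def)
      also have "\<dots> \<le> q" using C mult_div_mod_eq[of "2 * C" q] pos_mod_sign[of "2 * C" q] by linarith
      finally have "2 * \<bar>c * (z' - z)\<bar> \<le> q" by (simp add: abs_mult C_def abs_minus_commute)
      then have "1 / (2 * of_int q) \<le> dist_nint (\<alpha> * of_int (c * (z' - z)))"
        using q c that(3) by (intro dist_nint_lower) auto
      also have "\<alpha> * of_int (c * (z' - z)) = of_int c * \<alpha> * of_int (y - z) - of_int c * \<alpha> * of_int (y - z')"
        by (simp add: algebra_simps)
      finally show ?thesis using q(1) by simp
    qed
    have fin: "finite {y'\<in>{0..<N}. y' div L = i}" by (rule finite_subset[of _ "{0..<N}"]) auto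
    have "(\<Sum>y'\<in>{y'\<in>{0..<N}. y' div L = i}. dirichlet_kernel B (of_int c * \<alpha> * of_int (y - y'))) \<le>
       2 * (2 * real B + 1) + 2 * real (nat q) * (1 + ln (real (nat q)))"
      by (rule sum_kernel_spaced[OF fin]) (use sp q(1) in auto)
    then show ?thesis using q(1) by (simp add: BB_def)
  qed
  have "(\<Sum>y'\<in>{0..<N}. dirichlet_kernel B (of_int c * \<alpha> * of_int (y - y'))) =
     (\<Sum>i\<in>T. \<Sum>y'\<in>{y'\<in>{0..<N}. y' div L = i}. dirichlet_kernel B (of_int c * \<alpha> * of_int (y - y')))"
    using L unfolding T_def
    by (intro sum.group[symmetric]) (auto simp: pos_imp_zdiv_nonneg_iff intro!: zdiv_mono1)
  also have "\<dots> \<le> (\<Sum>i\<in>T. BB)" using block by (intro sum_mono)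
  also have "\<dots> = (of_int ((N - 1) div L) + 1) * BB"
    using N L by (simp add: T_def pos_imp_zdiv_nonneg_iff)
  also have "\<dots> \<le> (2 * of_int C * of_int N / of_int q + 1) * BB"
  proof (intro mult_right_mono add_right_mono BB0)
    have "2 * C * (q div (2 * C)) + q mod (2 * C) = q" by simp
    moreover have "q mod (2 * C) < 2 * C" using C by simp
    ultimately have "q \<le> 2 * C * L" by (simp add: L_def algebra_simps)
    then have qL: "real_of_int q \<le> 2 * of_int C * of_int L" by (metis of_int_le_iff of_int_mult of_int_numeral)
    have "((N - 1) div L) * L \<le> N" using L div_mult_mod_eq[of "N - 1" L] pos_mod_sign[of L "N - 1"] by linarith
    then have "of_int ((N - 1) div L) * of_int L \<le> (of_int N :: real)" by (metis of_int_le_iff of_int_mult)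
    then have "2 * of_int C * (of_int ((N - 1) div L) * of_int L) \<le> 2 * of_int C * (of_int N :: real)"
      using C by (intro mult_left_mono) auto
    moreover have "of_int ((N - 1) div L) * real_of_int q \<le> of_int ((N - 1) div L) * (2 * of_int C * of_int L)"
      using qL N L by (intro mult_left_mono) (auto simp: pos_imp_zdiv_nonneg_iff)
    ultimately have "of_int ((N - 1) div L) * real_of_int q \<le> 2 * of_int C * of_int N"
      by (simp only: mult_ac)
    then show "of_int ((N - 1) div L) \<le> 2 * of_int C * of_int N / real_of_int q"
      using q(1) by (simp add: pos_le_divide_eq)
  qed
  finally show ?thesis by (simp add: BB_def C_def)
qed

text \<open>The Taylor coefficients at \<open>v\<close> of the polynomial with coefficients
  \<open>a\<close>.\<close>

definition shift_coeff :: "(nat \<Rightarrow> real) \<Rightarrow> nat \<Rightarrow> real \<Rightarrow> nat \<Rightarrow> real"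
  where "shift_coeff a n v j = (\<Sum>i\<le>n. a i * real (i choose j) * v ^ (i - j))"

lemma shift_coeff_expand: "(\<Sum>i\<le>n. a i * (x + v) ^ i) = (\<Sum>j\<le>n. shift_coeff a n v j * x ^ j)"
proof -
  have "(\<Sum>i\<le>n. a i * (x + v) ^ i) = (\<Sum>i\<le>n. \<Sum>j\<le>n. a i * real (i choose j) * v ^ (i - j) * x ^ j)"
  proof (intro sum.cong refl)
    fix i assume i: "i \<in> {..n}"
    have "(x + v) ^ i = (\<Sum>j\<le>i. real (i choose j) * x ^ j * v ^ (i - j))"
      by (rule binomial_ring)
    also have "\<dots> = (\<Sum>j\<le>n. real (i choose j) * x ^ j * v ^ (i - j))"
      using i by (intro sum.mono_neutral_left) (auto simp: binomial_eq_0)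
    finally show "a i * (x + v) ^ i = (\<Sum>j\<le>n. a i * real (i choose j) * v ^ (i - j) * x ^ j)"
      by (simp only: sum_distrib_left mult_ac)
  qed
  also have "\<dots> = (\<Sum>j\<le>n. shift_coeff a n v j * x ^ j)"
    unfolding shift_coeff_def sum_distrib_right by (rule sum.swap)
  finally show ?thesis .
qed

lemma shift_coeff_top: "shift_coeff a n v n = a n"
proof -
  have "shift_coeff a n v n = (\<Sum>i\<in>{n}. a i * real (i choose n) * v ^ (i - n))"
    unfolding shift_coeff_def by (intro sum.mono_neutral_right) (auto simp: binomial_eq_0)
  then show ?thesis by simp
qed

lemma shift_coeff_subtop: "shift_coeff a (Suc n) v n = a n + real (Suc n) * a (Suc n) * v"
proof -
  have "shift_coeff a (Suc n) v n = (\<Sum>i\<in>{n, Suc n}. a i * real (i choose n) * v ^ (i - n))"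
    unfolding shift_coeff_def by (intro sum.mono_neutral_right) (auto simp: binomial_eq_0)
  then show ?thesis by simp
qed

text \<open>The shift \<open>y\<close> moves the coefficients of \<open>F\<close>; this supplies the
  spacing of frequencies that a single Weyl sum lacks.\<close>

definition weyl_double :: "int \<Rightarrow> (int \<Rightarrow> real) \<Rightarrow> real"
  where "weyl_double N F = (\<Sum>y\<in>{0..<N}. norm (\<Sum>x\<in>{-N..<N}. e (F (x + y))))"

text \<open>Expansion of \<open>(l*h^d*n/q + 1) * (n^(d-2) + q)\<close> divided by
  \<open>n^(d-1)\<close>: up to constants and a logarithm, the number of blocks times the kernel sum
  over one block.\<close>

definition weyl_terms :: "nat \<Rightarrow> real \<Rightarrow> real \<Rightarrow> real \<Rightarrow> real \<Rightarrow> real"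
  where "weyl_terms d l h q n = l * h ^ d / q + 1 / n + l * h ^ d / n ^ (d - 2) + q / n ^ (d - 1)"

text \<open>The shift by \<open>y\<close> leaves the coefficient of degree \<open>k + 1\<close>
  unchanged, so it enters \<open>R\<close> as a unimodular factor, and only power sums up to degree
  \<open>k\<close> are recorded. In the Gram matrix only coordinate \<open>k\<close> is exploited,
  whose coefficient is an affine function of \<open>y\<close>; the others are bounded by the length
  of their range.\<close>

lemma weyl_moment:
  fixes a :: "nat \<Rightarrow> real" and N :: int
  assumes k: "k \<ge> 1" and N: "N \<ge> 1"
    and F: "\<And>x. F x = (\<Sum>i\<le>k+1. a i * of_int x ^ i)"
    and K0: "K0 \<ge> 0" "\<And>y. y \<in> {0..<N} \<Longrightarrow> (\<Sum>y'\<in>{0..<N}. dirichlet_kernel (s * nat N ^ k) (real (k + 1) * a (k + 1) * of_int (y - y'))) \<le> K0"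
  shows "(\<Sum>y\<in>{0..<N}. norm (\<Sum>x\<in>{-N..<N}. e (F (x + y))) ^ (2 * s)) \<le>
    (\<Prod>j\<in>{1..<k}. 2 * real s * of_int N ^ j + 1) * K0 * real (card (vinogradov_pairs k s N))"
proof -
  define B where "B = (\<lambda>j. s * nat N ^ j)"
  define c where "c = (\<lambda>j (y::int). shift_coeff a (k + 1) (of_int y) j)"
  define X where "X = PiE {..<s} (\<lambda>_. {-N..<N})"
  define v where "v = (\<lambda>(x :: nat \<Rightarrow> int). restrict (\<lambda>j. \<Sum>i<s. x i ^ j) {1..k})"
  define r where "r = (\<lambda>(x :: nat \<Rightarrow> int). e (a (k + 1) * of_int (\<Sum>i<s. x i ^ (k + 1))))"
  define Bx where "Bx = PiE {1..k} (\<lambda>j. {- int (B j)..int (B j)})"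
  define h where "h = (\<lambda>y n. e (\<Sum>j=1..k. c j y * of_int (n j)))"
  define R where "R = (\<lambda>n. \<Sum>x\<in>{x\<in>X. v x = n}. r x)"
  have finX: "finite X" by (simp add: X_def finite_PiE)
  have finB: "finite Bx" by (simp add: Bx_def finite_PiE)
  have expand: "F (x + y) = c 0 y + (\<Sum>j=1..k. c j y * of_int x ^ j) + a (k + 1) * of_int x ^ (k + 1)" for x y
  proof -
    have "F (x + y) = (\<Sum>j\<le>k+1. c j y * of_int x ^ j)"
      unfolding F c_def of_int_add by (rule shift_coeff_expand)
    also have "{..k+1} = insert 0 (insert (k+1) {1..k})" by auto
    also have "(\<Sum>j\<in>insert 0 (insert (k+1) {1..k}). c j y * of_int x ^ j) =
       c 0 y + (c (k + 1) y * of_int x ^ (k + 1) + (\<Sum>j=1..k. c j y * of_int x ^ j))"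
      by (subst sum.insert; simp)+
    also have "c (k + 1) y = a (k + 1)" by (simp only: c_def shift_coeff_top)
    finally show ?thesis by simp
  qed
  have ck: "c k y - c k y' = real (k + 1) * a (k + 1) * of_int (y - y')" for y y'
    unfolding c_def using shift_coeff_subtop[of a k] by (simp add: algebra_simps)
  have vB: "v x \<in> Bx" if "x \<in> X" for x
  proof -
    have "\<bar>\<Sum>i<s. x i ^ j\<bar> \<le> int (B j)" for j
    proof -
      have "\<bar>\<Sum>i<s. x i ^ j\<bar> \<le> (\<Sum>i<s. \<bar>x i ^ j\<bar>)" by (rule sum_abs)
      also have "\<dots> \<le> (\<Sum>i<s. N ^ j)"
      proof (intro sum_mono)
        fix i assume "i \<in> {..<s}"
        then have "x i \<in> {-N..<N}" using that by (auto simp: X_def PiE_iff)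
        then have "\<bar>x i\<bar> \<le> N" by auto
        then show "\<bar>x i ^ j\<bar> \<le> N ^ j" unfolding power_abs by (intro power_mono) auto
      qed
      also have "\<dots> = int (B j)" using N by (simp add: B_def)
      finally show ?thesis .
    qed
    then show ?thesis unfolding Bx_def v_def by (auto simp: PiE_iff abs_le_iff) (metis abs_le_iff neg_le_iff_le minus_le_iff)
  qed
  have G: "norm (\<Sum>x\<in>{-N..<N}. e (F (x + y))) ^ s = norm (\<Sum>n\<in>Bx. R n * h y n)" for y
  proof -
    have "(\<Sum>x\<in>{-N..<N}. e (F (x + y))) ^ s = (\<Prod>i<s. \<Sum>x\<in>{-N..<N}. e (F (x + y)))" by simp
    also have "\<dots> = (\<Sum>x\<in>X. \<Prod>i<s. e (F (x i + y)))" unfolding X_def by (rule prod_sum_PiE) auto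
    also have "\<dots> = (\<Sum>x\<in>X. e (real s * c 0 y) * (r x * h y (v x)))"
    proof (intro sum.cong refl)
      fix x assume "x \<in> X"
      have "(\<Sum>i<s. F (x i + y)) = real s * c 0 y + (a (k + 1) * of_int (\<Sum>i<s. x i ^ (k + 1)) + (\<Sum>j=1..k. c j y * of_int (v x j)))"
      proof -
        have "(\<Sum>i<s. F (x i + y)) = real s * c 0 y + (\<Sum>i<s. \<Sum>j=1..k. c j y * of_int (x i) ^ j) + a (k + 1) * of_int (\<Sum>i<s. x i ^ (k + 1))"
          unfolding expand by (simp add: sum.distrib sum_distrib_left del: power_Suc)
        also have "(\<Sum>i<s. \<Sum>j=1..k. c j y * of_int (x i) ^ j) = (\<Sum>j=1..k. c j y * of_int (v x j))"
          by (subst sum.swap) (simp add: v_def sum_distrib_left)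
        finally show ?thesis by simp
      qed
      then show "(\<Prod>i<s. e (F (x i + y))) = e (real s * c 0 y) * (r x * h y (v x))"
        unfolding e_sum[symmetric] r_def h_def by (simp only: e_add)
    qed
    also have "\<dots> = e (real s * c 0 y) * (\<Sum>x\<in>X. r x * h y (v x))" by (simp only: sum_distrib_left)
    also have "(\<Sum>x\<in>X. r x * h y (v x)) = (\<Sum>n\<in>Bx. \<Sum>x\<in>{x\<in>X. v x = n}. r x * h y (v x))"
      using vB finX finB by (intro sum.group[symmetric]) auto
    also have "\<dots> = (\<Sum>n\<in>Bx. R n * h y n)"
      unfolding R_def sum_distrib_right by (intro sum.cong refl) auto
    finally show ?thesis by (metis norm_power norm_mult norm_e mult_1)
  qed
  define PB where "PB = (\<Prod>j\<in>{1..<k}. 2 * real s * of_int N ^ j + 1)"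
  have PB0: "PB \<ge> 0" unfolding PB_def using N by (intro prod_nonneg) auto
  have "(\<Sum>y\<in>{0..<N}. norm (\<Sum>x\<in>{-N..<N}. e (F (x + y))) ^ (2 * s)) = (\<Sum>y\<in>{0..<N}. norm (\<Sum>n\<in>Bx. R n * h y n) ^ 2)"
    unfolding G[symmetric] by (simp add: power_mult[symmetric] mult.commute)
  also have "\<dots> \<le> (PB * K0) * (\<Sum>n\<in>Bx. norm (R n) ^ 2)"
  proof (rule duality)
    fix y assume y: "y \<in> {0..<N}"
    have "norm (\<Sum>n\<in>Bx. h y n * cnj (h y' n)) \<le> PB * dirichlet_kernel (s * nat N ^ k) (real (k + 1) * a (k + 1) * of_int (y - y'))" for y'
    proof -
      have "h y n * cnj (h y' n) = (\<Prod>j=1..k. e (of_int (n j) * (c j y - c j y')))" for n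
        unfolding h_def e_diff[symmetric] e_sum[symmetric] sum_subtractf[symmetric]
        by (simp add: algebra_simps)
      then have "(\<Sum>n\<in>Bx. h y n * cnj (h y' n)) = (\<Prod>j=1..k. \<Sum>m\<in>{- int (B j)..int (B j)}. e (of_int m * (c j y - c j y')))"
        unfolding Bx_def by (subst prod_sum_PiE) auto
      then have "norm (\<Sum>n\<in>Bx. h y n * cnj (h y' n)) = (\<Prod>j=1..k. dirichlet_kernel (B j) (c j y - c j y'))"
        unfolding dirichlet_kernel_def by (simp only: prod_norm)
      also have "{1..k} = insert k {1..<k}" using k by auto
      also have "(\<Prod>j\<in>insert k {1..<k}. dirichlet_kernel (B j) (c j y - c j y')) = dirichlet_kernel (B k) (c k y - c k y') * (\<Prod>j\<in>{1..<k}. dirichlet_kernel (B j) (c j y - c j y'))"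
        by simp
      also have "\<dots> \<le> dirichlet_kernel (B k) (c k y - c k y') * PB"
        unfolding PB_def
      proof (intro mult_left_mono prod_mono conjI dirichlet_kernel_nonneg)
        fix j
        show "dirichlet_kernel (B j) (c j y - c j y') \<le> 2 * real s * of_int N ^ j + 1"
          using dirichlet_kernel_le[of "B j" "c j y - c j y'"] N by (simp add: B_def)
      qed
      finally show ?thesis by (simp add: ck B_def mult.commute)
    qed
    then have "(\<Sum>y'\<in>{0..<N}. norm (\<Sum>n\<in>Bx. h y n * cnj (h y' n))) \<le>
      (\<Sum>y'\<in>{0..<N}. PB * dirichlet_kernel (s * nat N ^ k) (real (k + 1) * a (k + 1) * of_int (y - y')))" by (intro sum_mono)
    also have "\<dots> \<le> PB * K0" unfolding sum_distrib_left[symmetric] using K0(2)[OF y] PB0 by (intro mult_left_mono)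
    finally show "(\<Sum>y'\<in>{0..<N}. norm (\<Sum>n\<in>Bx. h y n * cnj (h y' n))) \<le> PB * K0" .
  qed (use finB PB0 K0 in auto)
  also have "\<dots> \<le> (PB * K0) * real (card (vinogradov_pairs k s N))"
  proof (rule mult_left_mono)
    \<comment> \<open>Each \<open>R n\<close> is bounded by the size of its fibre, and the squares
      of the fibre sizes count pairs of tuples with equal power sums.\<close>
    have "(\<Sum>n\<in>Bx. norm (R n) ^ 2) \<le> (\<Sum>n\<in>Bx. \<Sum>x\<in>{x\<in>X. v x = n}. real (card {x'\<in>X. v x' = v x}))"
    proof (intro sum_mono)
      fix n
      have "norm (R n) \<le> (\<Sum>x\<in>{x\<in>X. v x = n}. 1)"
        unfolding R_def by (rule order_trans[OF norm_sum]) (simp add: r_def)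
      then have "norm (R n) \<le> real (card {x\<in>X. v x = n})" by simp
      then have "norm (R n) ^ 2 \<le> real (card {x\<in>X. v x = n}) ^ 2" by (intro power_mono) auto
      also have "\<dots> = (\<Sum>x\<in>{x\<in>X. v x = n}. real (card {x'\<in>X. v x' = v x}))"
        by (simp add: power2_eq_square)
      finally show "norm (R n) ^ 2 \<le> (\<Sum>x\<in>{x\<in>X. v x = n}. real (card {x'\<in>X. v x' = v x}))" .
    qed
    also have "\<dots> = (\<Sum>x\<in>X. real (card {x'\<in>X. v x' = v x}))"
      using vB finX finB by (intro sum.group) auto
    also have "\<dots> = real (card (SIGMA x:X. {x'\<in>X. v x' = v x}))"
      using finX by (subst card_SigmaI) auto
    also have "(SIGMA x:X. {x'\<in>X. v x' = v x}) = vinogradov_pairs k s N"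
    proof -
      have "v x' = v x \<longleftrightarrow> (\<forall>j\<in>{1..k}. (\<Sum>i<s. x i ^ j) = (\<Sum>i<s. x' i ^ j))" for x x'
      proof
        assume "v x' = v x"
        then have "v x' j = v x j" for j by simp
        then show "\<forall>j\<in>{1..k}. (\<Sum>i<s. x i ^ j) = (\<Sum>i<s. x' i ^ j)" by (metis v_def restrict_apply')
      next
        assume "\<forall>j\<in>{1..k}. (\<Sum>i<s. x i ^ j) = (\<Sum>i<s. x' i ^ j)"
        then show "v x' = v x" unfolding v_def by (intro restrict_ext) auto
      qed
      then show ?thesis unfolding vinogradov_pairs_def X_def by auto
    qed
    finally show "(\<Sum>n\<in>Bx. norm (R n) ^ 2) \<le> real (card (vinogradov_pairs k s N))" .
  qed (use PB0 K0 in auto)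
  finally show ?thesis by (simp add: PB_def)
qed

section \<open>Sums over digit classes\<close>

lemma bin_digit_sum_rec: "bin_digit_sum n = n mod 2 + bin_digit_sum (n div 2)"
  by (cases "n = 0") (simp_all add: bin_digit_sum.simps[of n] bin_digit_sum.simps[of 0])

text \<open>The two summands occupy disjoint digit positions, so there are no carries.\<close>

lemma bin_digit_sum_split: "v < 2 ^ t \<Longrightarrow> bin_digit_sum (v + 2 ^ t * u) = bin_digit_sum v + bin_digit_sum u"
proof (induction t arbitrary: v)
  case 0
  then show ?case by (simp add: bin_digit_sum.simps[of 0])
next
  case (Suc t)
  have "bin_digit_sum (v + 2 ^ Suc t * u) = (v + 2 * (2 ^ t * u)) mod 2 + bin_digit_sum ((v + 2 * (2 ^ t * u)) div 2)"
    using bin_digit_sum_rec[of "v + 2 ^ Suc t * u"] by (simp add: mult.assoc)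
  also have "(v + 2 * (2 ^ t * u)) mod 2 = v mod 2" by simp
  also have "(v + 2 * (2 ^ t * u)) div 2 = v div 2 + 2 ^ t * u" by simp
  also have "bin_digit_sum (v div 2 + 2 ^ t * u) = bin_digit_sum (v div 2) + bin_digit_sum u"
    using Suc.prems by (intro Suc.IH) auto
  also have "v mod 2 + (bin_digit_sum (v div 2) + bin_digit_sum u) = bin_digit_sum v + bin_digit_sum u"
    using bin_digit_sum_rec[of v] by simp
  finally show ?case .
qed

definition digit_class :: "nat \<Rightarrow> nat \<Rightarrow> nat \<Rightarrow> int set"
  where "digit_class t m j = int ` {v. v < 2 ^ t \<and> bin_digit_sum v mod m = j}"

lemma digit_class_subset: "digit_class t m j \<subseteq> {0..<2 ^ t}"
  by (auto simp: digit_class_def)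

text \<open>Once \<open>v\<close> is sorted by its class \<open>j\<close>, the digit condition
  depends on \<open>u\<close> alone: it is a factor 0 or 1 outside the sum over \<open>v\<close> and
  is bounded by 1.\<close>

lemma norm_U_sum_le:
  assumes "t \<le> r" "m \<ge> 1"
  shows "norm (U_sum f r l k m) \<le>
    (\<Sum>j<m. \<Sum>u\<in>{0..<2 ^ (r - t)}. norm (\<Sum>v\<in>digit_class t m j. e (real l * poly f (of_int (v + 2 ^ t * u)))))"
proof -
  define g where "g = (\<lambda>n::nat. e (real l * poly f (real n)))"
  define N H :: nat where "N = 2 ^ (r - t)" and "H = 2 ^ t"
  have NH: "N * H = 2 ^ r" using assms(1) by (simp add: N_def H_def power_add[symmetric])
  have H0: "H > 0" by (simp add: H_def)
  have "U_sum f r l k m = (\<Sum>n<2 ^ r. if [bin_digit_sum n = k] (mod m) then g n else 0)"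
    unfolding U_sum_def E_set_def g_def by (subst sum.inter_filter[symmetric]) (auto intro: sum.cong)
  also have "\<dots> = (\<Sum>(u, v)\<in>{..<N} \<times> {..<H}. if [bin_digit_sum v + bin_digit_sum u = k] (mod m) then g (v + H * u) else 0)"
  proof (rule sum.reindex_bij_witness[where i = "\<lambda>(u, v). v + H * u" and j = "\<lambda>n. (n div H, n mod H)"])
    fix n :: nat assume n: "n \<in> {..<2 ^ r}"
    have dm: "n mod H + H * (n div H) = n" by simp
    show "(case (n div H, n mod H) of (u, v) \<Rightarrow> v + H * u) = n" by simp
    show "(n div H, n mod H) \<in> {..<N} \<times> {..<H}" using n H0 NH by (simp add: less_mult_imp_div_less)
    show "(case (n div H, n mod H) of (u, v) \<Rightarrow> if [bin_digit_sum v + bin_digit_sum u = k] (mod m) then g (v + H * u) else 0)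
       = (if [bin_digit_sum n = k] (mod m) then g n else 0)"
      using bin_digit_sum_split[of "n mod H" t "n div H"] H0 dm by (simp add: H_def)
  next
    fix b assume "b \<in> {..<N} \<times> {..<H}"
    then obtain u v where b: "b = (u, v)" "u < N" "v < H" by auto
    have "v + H * u < H + H * u" using b by simp
    also have "\<dots> = H * (u + 1)" by simp
    also have "\<dots> \<le> H * N" using b by (intro mult_le_mono2) simp
    finally show "(case b of (u, v) \<Rightarrow> v + H * u) \<in> {..<2 ^ r}" using NH b by (simp add: mult.commute)
    show "((case b of (u, v) \<Rightarrow> v + H * u) div H, (case b of (u, v) \<Rightarrow> v + H * u) mod H) = b" using b by simp
  qed
  also have "\<dots> = (\<Sum>u<N. \<Sum>v<H. if [bin_digit_sum v + bin_digit_sum u = k] (mod m) then g (v + H * u) else 0)"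
    by (simp add: sum.cartesian_product)
  also have "\<dots> = (\<Sum>u<N. \<Sum>j<m. \<Sum>v\<in>{v\<in>{..<H}. bin_digit_sum v mod m = j}. if [bin_digit_sum v + bin_digit_sum u = k] (mod m) then g (v + H * u) else 0)"
    using assms(2) by (intro sum.cong refl sum.group[symmetric]) auto
  finally have Ueq: "U_sum f r l k m = (\<Sum>u<N. \<Sum>j<m. \<Sum>v\<in>{v\<in>{..<H}. bin_digit_sum v mod m = j}. if [bin_digit_sum v + bin_digit_sum u = k] (mod m) then g (v + H * u) else 0)" .
  have "norm (U_sum f r l k m) \<le> (\<Sum>u<N. \<Sum>j<m. norm (\<Sum>v\<in>{v\<in>{..<H}. bin_digit_sum v mod m = j}. g (v + H * u)))"
    unfolding Ueq
  proof (intro sum_norm_le)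
    fix u j assume "j \<in> {..<m}"
    have "(\<Sum>v\<in>{v\<in>{..<H}. bin_digit_sum v mod m = j}. if [bin_digit_sum v + bin_digit_sum u = k] (mod m) then g (v + H * u) else 0)
      = (\<Sum>v\<in>{v\<in>{..<H}. bin_digit_sum v mod m = j}. if [j + bin_digit_sum u = k] (mod m) then g (v + H * u) else 0)"
      by (intro sum.cong refl if_cong) (auto simp: Cong.cong_def mod_add_left_eq)
    then show "norm (\<Sum>v\<in>{v\<in>{..<H}. bin_digit_sum v mod m = j}. if [bin_digit_sum v + bin_digit_sum u = k] (mod m) then g (v + H * u) else 0)
      \<le> norm (\<Sum>v\<in>{v\<in>{..<H}. bin_digit_sum v mod m = j}. g (v + H * u))"
      by (cases "[j + bin_digit_sum u = k] (mod m)") simp_all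
  qed
  also have "\<dots> = (\<Sum>j<m. \<Sum>u<N. norm (\<Sum>v\<in>{v\<in>{..<H}. bin_digit_sum v mod m = j}. g (v + H * u)))"
    by (rule sum.swap)
  also have "\<dots> = (\<Sum>j<m. \<Sum>u\<in>{0..<2 ^ (r - t)}. norm (\<Sum>v\<in>digit_class t m j. e (real l * poly f (of_int (v + 2 ^ t * u)))))"
  proof (intro sum.cong refl)
    fix j
    have "(\<Sum>v\<in>digit_class t m j. e (real l * poly f (of_int (v + 2 ^ t * int u)))) = (\<Sum>v\<in>{v\<in>{..<H}. bin_digit_sum v mod m = j}. g (v + H * u))" for u
      unfolding digit_class_def by (subst sum.reindex) (auto simp: g_def H_def intro!: sum.cong)
    then show "(\<Sum>u<N. norm (\<Sum>v\<in>{v\<in>{..<H}. bin_digit_sum v mod m = j}. g (v + H * u))) =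
      (\<Sum>u\<in>{0..<2 ^ (r - t)}. norm (\<Sum>v\<in>digit_class t m j. e (real l * poly f (of_int (v + 2 ^ t * u)))))"
      by (intro sum.reindex_bij_witness[where i = nat and j = int]) (auto simp: N_def nat_less_iff)
  qed
  finally show ?thesis .
qed

text \<open>The indicator of \<open>{0..<N}\<close> is majorised by \<open>1 / N\<close> times the number of representations as \<open>x + y\<close> with \<open>x\<close> in
  \<open>{-N..<N}\<close> and \<open>y\<close> in \<open>{0..<N}\<close>, which yields the shifted double sums without truncation.\<close>

lemma differencing:
  fixes E :: "int set" and N :: int and g :: "int \<Rightarrow> int \<Rightarrow> real"
  assumes "finite E" "real (card E) \<le> H" "N \<ge> 1" "Tm \<ge> 0"
    and T: "\<And>v w. v \<in> E \<Longrightarrow> w \<in> E \<Longrightarrow> v \<noteq> w \<Longrightarrow>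
      weyl_double N (\<lambda>z. g v z - g w z) \<le> Tm"
  shows "of_int N * (\<Sum>u\<in>{0..<N}. norm (\<Sum>v\<in>E. e (g v u)) ^ 2) \<le> H * (2 * of_int N ^ 2) + H ^ 2 * Tm"
proof -
  define V where "V = (\<lambda>u. norm (\<Sum>v\<in>E. e (g v u)) ^ 2)"
  have H0: "H \<ge> 0" using assms(2) by linarith
  have nn: "(\<Sum>y\<in>{0..<N}. \<Sum>x\<in>{-N..<N}. V (x + y)) \<ge> 0"
    by (intro sum_nonneg) (simp add: V_def)
  have "of_int N * (\<Sum>u\<in>{0..<N}. V u) = (\<Sum>y\<in>{0..<N}. \<Sum>u\<in>{0..<N}. V u)" using assms(3) by simp
  also have "\<dots> \<le> (\<Sum>y\<in>{0..<N}. \<Sum>x\<in>{-N..<N}. V (x + y))"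
  proof (intro sum_mono)
    fix y assume y: "y \<in> {0..<N}"
    have "(\<Sum>u\<in>{0..<N}. V u) = (\<Sum>x\<in>{-y..<N - y}. V (x + y))"
      by (rule sum.reindex_bij_witness[where i = "\<lambda>x. x + y" and j = "\<lambda>u. u - y"]) auto
    also have "\<dots> \<le> (\<Sum>x\<in>{-N..<N}. V (x + y))" using y by (intro sum_mono2) (auto simp: V_def)
    finally show "(\<Sum>u\<in>{0..<N}. V u) \<le> (\<Sum>x\<in>{-N..<N}. V (x + y))" .
  qed
  also have "\<dots> = norm (of_real (\<Sum>y\<in>{0..<N}. \<Sum>x\<in>{-N..<N}. V (x + y)) :: complex)"
    using nn by (simp only: norm_of_real abs_of_nonneg)
  also have "of_real (\<Sum>y\<in>{0..<N}. \<Sum>x\<in>{-N..<N}. V (x + y)) =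
     (\<Sum>v\<in>E. \<Sum>w\<in>E. \<Sum>y\<in>{0..<N}. \<Sum>x\<in>{-N..<N}. e (g v (x + y) - g w (x + y)))"
  proof -
    have "of_real (V u) = (\<Sum>v\<in>E. \<Sum>w\<in>E. e (g v u - g w u))" for u
      unfolding V_def complex_norm_square cnj_sum sum_product e_diff ..
    then have "of_real (\<Sum>y\<in>{0..<N}. \<Sum>x\<in>{-N..<N}. V (x + y)) =
      (\<Sum>y\<in>{0..<N}. \<Sum>x\<in>{-N..<N}. \<Sum>v\<in>E. \<Sum>w\<in>E. e (g v (x + y) - g w (x + y)))"
      by (simp only: of_real_sum)
    also have "\<dots> = (\<Sum>y\<in>{0..<N}. \<Sum>v\<in>E. \<Sum>w\<in>E. \<Sum>x\<in>{-N..<N}. e (g v (x + y) - g w (x + y)))"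
      by (rule sum.cong[OF refl], rule trans[OF sum.swap], rule sum.cong[OF refl], rule sum.swap)
    also have "\<dots> = (\<Sum>v\<in>E. \<Sum>w\<in>E. \<Sum>y\<in>{0..<N}. \<Sum>x\<in>{-N..<N}. e (g v (x + y) - g w (x + y)))"
      by (rule trans[OF sum.swap], rule sum.cong[OF refl], rule sum.swap)
    finally show ?thesis .
  qed
  also have "norm (\<Sum>v\<in>E. \<Sum>w\<in>E. \<Sum>y\<in>{0..<N}. \<Sum>x\<in>{-N..<N}. e (g v (x + y) - g w (x + y))) \<le>
     (\<Sum>v\<in>E. \<Sum>w\<in>E. if v = w then 2 * of_int N ^ 2 else Tm)"
  proof (intro sum_norm_le)
    fix v w assume vw: "v \<in> E" "w \<in> E"
    show "norm (\<Sum>y\<in>{0..<N}. \<Sum>x\<in>{-N..<N}. e (g v (x + y) - g w (x + y))) \<le> (if v = w then 2 * of_int N ^ 2 else Tm)"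
    proof (cases "v = w")
      case True
      have "norm (\<Sum>y\<in>{0..<N}. \<Sum>x\<in>{-N..<N}. e (g v (x + y) - g w (x + y))) \<le> (\<Sum>y\<in>{0..<N}. \<Sum>x\<in>{-N..<N}. 1)"
        by (intro sum_norm_le) auto
      also have "\<dots> = 2 * of_int N ^ 2" using assms(3) by (simp add: power2_eq_square)
      finally show ?thesis using True by simp
    next
      case False
      have "norm (\<Sum>y\<in>{0..<N}. \<Sum>x\<in>{-N..<N}. e (g v (x + y) - g w (x + y))) \<le>
         (\<Sum>y\<in>{0..<N}. norm (\<Sum>x\<in>{-N..<N}. e (g v (x + y) - g w (x + y))))" by (rule norm_sum)
      also have "\<dots> \<le> Tm" using T[OF vw False] by (simp add: weyl_double_def)
      finally show ?thesis using False by simp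
    qed
  qed
  also have "\<dots> \<le> (\<Sum>v\<in>E. 2 * of_int N ^ 2 + H * Tm)"
  proof (intro sum_mono)
    fix v assume v: "v \<in> E"
    have "(\<Sum>w\<in>E. if v = w then 2 * of_int N ^ 2 else Tm) \<le> (\<Sum>w\<in>E. (if v = w then 2 * of_int N ^ 2 else 0) + Tm)"
      using assms(4) by (intro sum_mono) auto
    also have "\<dots> = 2 * of_int N ^ 2 + real (card E) * Tm"
      using v assms(1) by (simp add: sum.distrib)
    also have "\<dots> \<le> 2 * of_int N ^ 2 + H * Tm" using assms by (intro add_left_mono mult_right_mono) auto
    finally show "(\<Sum>w\<in>E. if v = w then 2 * of_int N ^ 2 else Tm) \<le> 2 * of_int N ^ 2 + H * Tm" .
  qed
  also have "\<dots> \<le> H * (2 * of_int N ^ 2 + H * Tm)"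
    using assms H0 by (simp add: mult_right_mono)
  also have "\<dots> = H * (2 * of_int N ^ 2) + H ^ 2 * Tm" by (simp add: algebra_simps power2_eq_square)
  finally show ?thesis by (simp add: V_def)
qed

section \<open>The Weyl bound after differencing\<close>

text \<open>The mean value theorem is used at its critical exponent
  \<open>2*s = (d-1)*(d-2)\<close>, whence \<open>\<theta>\<close>. All dependence on
  \<open>v\<close>, \<open>w\<close>, \<open>H\<close> and \<open>l\<close> sits in an integer
  multiple \<open>c\<close> of the leading coefficient, so the given rational approximation applies
  unchanged and the constant is uniform.\<close>

lemma weyl_difference_bound:
  assumes "d \<ge> 3" "\<epsilon> > 0" and \<theta>: "\<theta> = 1 / ((real d - 1) * (real d - 2))"
  shows "\<exists>C\<ge>1. \<forall>(b :: nat \<Rightarrow> real) (a :: int) (q :: int) (l :: nat) (N :: int) (H :: int) v w.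
    q \<ge> 1 \<longrightarrow> gcd a q = 1 \<longrightarrow> \<bar>b d - of_int a / of_int q\<bar> < 1 / (of_int q)\<^sup>2 \<longrightarrow> l \<ge> 1 \<longrightarrow> N \<ge> 1 \<longrightarrow>
    v \<in> {0..<H} \<longrightarrow> w \<in> {0..<H} \<longrightarrow> v \<noteq> w \<longrightarrow>
    weyl_double N (\<lambda>z. real l * (\<Sum>i\<le>d. b i * of_int (v + H * z) ^ i) - real l * (\<Sum>i\<le>d. b i * of_int (w + H * z) ^ i))
      \<le> of_int N ^ 2 * (C * (1 + ln (of_int q)) * of_int N powr \<epsilon> * weyl_terms d l H q N) powr \<theta>"
proof -
  define k where "k = d - 2"
  have k: "k \<ge> 1" "d = k + 2" using assms(1) by (auto simp: k_def)
  define s where "s = k * (k + 1) div 2"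
  have s2: "2 * s = k * (k + 1)" by (simp add: s_def)
  have s1: "s \<ge> 1" using mult_le_mono[OF k(1), of 2 "k + 1"] k(1) by (simp add: s_def)
  have "(real d - 1) * (real d - 2) = real (k * (k + 1))" by (simp add: k(2) algebra_simps)
  then have th: "\<theta> = 1 / (2 * real s)" unfolding \<theta> s2[symmetric] by simp
  then have th01: "0 < \<theta>" "\<theta> < 1" using s1 by auto
  obtain CJ where CJ: "CJ > 0" "\<And>N. N \<ge> 1 \<Longrightarrow> real (card (vinogradov_pairs k s N)) \<le> CJ * of_int N powr (real s + \<epsilon>)"
    using vinogradov_mean_value[OF k(1) assms(2) s_def] by blast
  define C0 where "C0 = (3 * real s) ^ (k - 1) * (12 * real s * real d ^ 2) * CJ"
  define C where "C = max 1 C0"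
  have "weyl_double N (\<lambda>z. real l * (\<Sum>i\<le>d. b i * of_int (v + H * z) ^ i) - real l * (\<Sum>i\<le>d. b i * of_int (w + H * z) ^ i))
      \<le> of_int N ^ 2 * (C * (1 + ln (of_int q)) * of_int N powr \<epsilon> * weyl_terms d l H q N) powr \<theta>"
    if q: "q \<ge> 1" "gcd a q = 1" "\<bar>b d - of_int a / of_int q\<bar> < 1 / (of_int q)\<^sup>2" and l: "l \<ge> 1" and N: "N \<ge> 1"
      and vw: "v \<in> {0..<H}" "w \<in> {0..<H}" "v \<noteq> w"
    for b :: "nat \<Rightarrow> real" and a q N H v w :: int and l :: nat
  proof -
    define A where "A = (\<lambda>j. real l * (shift_coeff b d (of_int v) j - shift_coeff b d (of_int w) j) * of_int H ^ j)"
    define F where "F = (\<lambda>z::int. \<Sum>i\<le>k+1. A i * of_int z ^ i)"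
    have H: "H \<ge> 1" using vw by auto
    have phase: "real l * (\<Sum>i\<le>d. b i * of_int (v + H * z) ^ i) - real l * (\<Sum>i\<le>d. b i * of_int (w + H * z) ^ i) = F z" for z
    proof -
      have ex: "(\<Sum>i\<le>d. b i * of_int (u + H * z) ^ i) = (\<Sum>j\<le>d. shift_coeff b d (of_int u) j * (of_int (H * z)) ^ j)" for u
        using shift_coeff_expand[of b "of_int (H * z)" "of_int u" d] by (simp add: add.commute)
      have "real l * (\<Sum>i\<le>d. b i * of_int (v + H * z) ^ i) - real l * (\<Sum>i\<le>d. b i * of_int (w + H * z) ^ i) = (\<Sum>j\<le>d. A j * of_int z ^ j)"
        unfolding ex A_def by (simp add: sum_distrib_left sum_subtractf[symmetric] power_mult_distrib algebra_simps)
      also have "\<dots> = F z + A d * of_int z ^ d" using k(2) by (simp add: F_def)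
      also have "A d = 0" by (simp add: A_def shift_coeff_top)
      finally show ?thesis by simp
    qed
    \<comment> \<open>The factor \<open>k + 1\<close> comes from the shift by \<open>y\<close>,
      \<open>d * (v - w)\<close> from the difference in the subleading Taylor coefficient, and
      \<open>H^(k+1)\<close> from the scaling of \<open>z\<close>.\<close>
    define c where "c = int ((k + 1) * d * l) * (v - w) * H ^ (k + 1)"
    have cA: "real (k + 1) * A (k + 1) = of_int c * b d"
    proof -
      have "d = Suc (k + 1)" using k(2) by simp
      then have eq: "shift_coeff b d (of_int v) (k + 1) - shift_coeff b d (of_int w) (k + 1) = real d * b d * of_int (v - w)"
        using shift_coeff_subtop[of b "k + 1"] by (simp add: algebra_simps)
      show ?thesis unfolding A_def c_def
        by (simp only: eq of_int_mult of_int_of_nat_eq of_nat_mult of_int_power mult_ac)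
    qed
    have c0: "c \<noteq> 0"
    proof -
      have "(k + 1) * d * l \<noteq> 0" using l assms(1) by simp
      moreover have "v - w \<noteq> 0" "H ^ (k + 1) \<noteq> 0" using vw H by auto
      ultimately show ?thesis unfolding c_def by (simp only: mult_eq_0_iff of_nat_eq_0_iff simp_thms)
    qed
    define Lg where "Lg = 1 + ln (real_of_int q)"
    have Lg: "Lg \<ge> 1" using q(1) by (simp add: Lg_def)
    define B where "B = s * nat N ^ k"
    define K0 where "K0 = (2 * of_int \<bar>c\<bar> * of_int N / of_int q + 1) * (2 * (2 * real B + 1) + 2 * of_int q * Lg)"
    define X h n where "X = real_of_int q" and "h = real_of_int H" and "n = real_of_int N"
    have X: "X \<ge> 1" and h: "h \<ge> 1" and n: "n \<ge> 1" using q H N by (auto simp: X_def h_def n_def)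
    have l1: "real l \<ge> 1" using l by simp
    define \<Psi> where "\<Psi> = weyl_terms d l h X n"
    have \<Psi>0: "\<Psi> > 0" unfolding \<Psi>_def weyl_terms_def using X h n l1 by (intro add_pos_pos divide_pos_pos mult_pos_pos) auto
    have K00: "K0 \<ge> 0" unfolding K0_def using q(1) N Lg by (intro mult_nonneg_nonneg add_nonneg_nonneg divide_nonneg_nonneg) auto
    define S where "S = (\<lambda>y. norm (\<Sum>x\<in>{-N..<N}. e (F (x + y))))"
    define PB where "PB = (\<Prod>j\<in>{1..<k}. 2 * real s * of_int N ^ j + 1)"
    have mom: "(\<Sum>y\<in>{0..<N}. S y ^ (2 * s)) \<le> PB * K0 * real (card (vinogradov_pairs k s N))"
      unfolding S_def PB_def
    proof (rule weyl_moment[OF k(1) N _ K00, of F A])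
      show "F x = (\<Sum>i\<le>k + 1. A i * of_int x ^ i)" for x by (simp add: F_def)
      show "(\<Sum>y'\<in>{0..<N}. dirichlet_kernel (s * nat N ^ k) (real (k + 1) * A (k + 1) * of_int (y - y'))) \<le> K0" for y
        unfolding cA K0_def Lg_def B_def by (rule sum_kernel_progression[OF q c0 N])
    qed
    \<comment> \<open>The degrees 1, ..., k add up to \<open>s\<close>, so the frequency ranges
      contribute \<open>n^s\<close>, which together with the mean value gives \<open>n^(2*s)\<close>
      up to the error.\<close>
    have PBle: "PB * n ^ k \<le> (3 * real s) ^ (k - 1) * n ^ s"
    proof -
      have "PB \<le> (\<Prod>j\<in>{1..<k}. 3 * real s * n ^ j)"
        unfolding PB_def
      proof (intro prod_mono conjI)
        fix j
        have "1 * 1 \<le> real s * n ^ j" using s1 n by (intro mult_mono) auto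
        then show "2 * real s * of_int N ^ j + 1 \<le> 3 * real s * n ^ j" by (simp add: n_def)
      qed (use n in \<open>auto simp: n_def\<close>)
      also have "\<dots> = (3 * real s) ^ (k - 1) * n ^ (\<Sum>j\<in>{1..<k}. j)" by (simp add: prod.distrib power_sum)
      finally have "PB * n ^ k \<le> (3 * real s) ^ (k - 1) * n ^ (\<Sum>j\<in>{1..<k}. j) * n ^ k" using n by (intro mult_right_mono) auto
      also have "\<dots> = (3 * real s) ^ (k - 1) * n ^ ((\<Sum>j\<in>{1..<k}. j) + k)" by (simp add: power_add)
      also have "(\<Sum>j\<in>{1..<k}. j) + k = s"
      proof -
        have "{0..k} = insert 0 (insert k {1..<k})" using k(1) by auto
        then have "(\<Sum>j\<in>{0..k}. j) = k + (\<Sum>j\<in>{1..<k}. j)" using k(1) by simp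
        then show ?thesis using gauss_sum_nat[of k] by (simp add: s_def)
      qed
      finally show ?thesis .
    qed
    have reassoc: "(2 * x1 * x2) * (6 * x3 * x4 * x5) = 12 * x3 * x1 * x4 * (x2 * x5)" for x1 x2 x3 x4 x5 :: real
      by simp
    have K0le: "K0 \<le> 12 * real s * real d ^ 2 * Lg * (n ^ (k + 1) * \<Psi>)"
    proof -
      have "of_int \<bar>c\<bar> = real ((k + 1) * d * l) * \<bar>of_int (v - w)\<bar> * h ^ (k + 1)"
        using h by (simp add: c_def abs_mult h_def)
      also have "\<dots> \<le> (real d ^ 2 * real l) * h * h ^ (k + 1)"
      proof (intro mult_right_mono mult_mono)
        have "(k + 1) * d * l \<le> d * d * l" using k(2) by (intro mult_le_mono) auto
        then have "real ((k + 1) * d * l) \<le> real (d * d * l)" by (simp only: of_nat_le_iff)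
        then show "real ((k + 1) * d * l) \<le> real d ^ 2 * real l" by (simp add: power2_eq_square)
        show "\<bar>of_int (v - w)\<bar> \<le> h" using vw unfolding h_def by (auto simp: abs_le_iff)
      qed (use h in auto)
      also have "\<dots> = real d ^ 2 * (real l * h ^ d)" by (simp add: k(2) mult_ac)
      finally have cle: "of_int \<bar>c\<bar> \<le> real d ^ 2 * (real l * h ^ d)" .
      have d1: "real d ^ 2 \<ge> 1" using k by simp
      have f1: "2 * of_int \<bar>c\<bar> * n / X + 1 \<le> 2 * real d ^ 2 * (real l * h ^ d * n / X + 1)"
      proof -
        have "2 * of_int \<bar>c\<bar> * n / X \<le> 2 * (real d ^ 2 * (real l * h ^ d)) * n / X"
          using cle n X by (intro divide_right_mono mult_right_mono mult_left_mono) auto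
        moreover have "1 \<le> 2 * real d ^ 2" using d1 by simp
        ultimately show ?thesis by (simp add: algebra_simps)
      qed
      have f2: "2 * (2 * real B + 1) + 2 * X * Lg \<le> 6 * real s * Lg * (n ^ k + X)"
      proof -
        have rB: "real B = real s * n ^ k" using N by (simp add: B_def n_def)
        have "1 * 1 \<le> real s * n ^ k" using s1 n by (intro mult_mono) auto
        then have "2 * (2 * real B + 1) \<le> 6 * (real s * n ^ k)" by (simp add: rB)
        also have "\<dots> \<le> 6 * (real s * n ^ k) * Lg" using Lg n mult_left_mono[OF Lg, of "6 * (real s * n ^ k)"] by simp
        finally have g1: "2 * (2 * real B + 1) \<le> 6 * real s * Lg * n ^ k" by (simp add: mult_ac)
        have "2 * (X * Lg) \<le> (6 * real s) * (X * Lg)" using s1 X Lg by (intro mult_right_mono) auto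
        then show ?thesis using g1 by (simp add: algebra_simps)
      qed
      have "K0 \<le> (2 * real d ^ 2 * (real l * h ^ d * n / X + 1)) * (6 * real s * Lg * (n ^ k + X))"
        unfolding K0_def X_def[symmetric] n_def[symmetric] using f1 f2 X n h Lg l1
        by (intro mult_mono) auto
      also have "\<dots> = 12 * real s * real d ^ 2 * Lg * ((real l * h ^ d * n / X + 1) * (n ^ k + X))"
        by (rule reassoc)
      also have "(real l * h ^ d * n / X + 1) * (n ^ k + X) = n ^ (k + 1) * \<Psi>"
      proof -
        have dk: "d - 2 = k" "d - 1 = k + 1" using k(2) by auto
        show ?thesis unfolding \<Psi>_def weyl_terms_def dk using X n by (simp add: field_simps)
      qed
      finally show ?thesis .
    qed
    have J: "real (card (vinogradov_pairs k s N)) \<le> CJ * n powr (real s + \<epsilon>)" using CJ(2)[OF N] by (simp add: n_def)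
    have PB0: "PB \<ge> 0" unfolding PB_def using N by (intro prod_nonneg) auto
    have tot: "(\<Sum>y\<in>{0..<N}. S y ^ (2 * s)) \<le> C * Lg * n powr \<epsilon> * \<Psi> * n powr (2 * real s + 1)"
    proof -
      have "PB * K0 * real (card (vinogradov_pairs k s N)) \<le> PB * (12 * real s * real d ^ 2 * Lg * (n ^ (k + 1) * \<Psi>)) * (CJ * n powr (real s + \<epsilon>))"
        using PB0 K0le K00 J Lg n \<Psi>0 by (intro mult_mono mult_left_mono mult_nonneg_nonneg) auto
      also have "\<dots> = (PB * n ^ k) * (12 * real s * real d ^ 2 * Lg * (n * \<Psi>) * (CJ * n powr (real s + \<epsilon>)))"
        by (simp add: mult_ac)
      also have "\<dots> \<le> ((3 * real s) ^ (k - 1) * n ^ s) * (12 * real s * real d ^ 2 * Lg * (n * \<Psi>) * (CJ * n powr (real s + \<epsilon>)))"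
        using PBle Lg n \<Psi>0 CJ(1) by (intro mult_right_mono mult_nonneg_nonneg) auto
      also have "\<dots> = C0 * (Lg * \<Psi>) * (n ^ s * n * n powr (real s + \<epsilon>))"
        by (simp add: C0_def mult_ac)
      also have "n ^ s * n * n powr (real s + \<epsilon>) = n powr \<epsilon> * n powr (2 * real s + 1)"
      proof -
        have "n ^ s * n = n powr (real s + 1)" using n by (simp add: powr_realpow powr_add)
        then show ?thesis by (simp add: powr_add[symmetric] algebra_simps)
      qed
      also have "C0 * (Lg * \<Psi>) * (n powr \<epsilon> * n powr (2 * real s + 1)) \<le> C * (Lg * \<Psi>) * (n powr \<epsilon> * n powr (2 * real s + 1))"
        using Lg \<Psi>0 by (intro mult_right_mono) (auto simp: C_def)
      finally show ?thesis using mom by (simp add: mult_ac)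
    qed
    have "(\<Sum>y\<in>{0..<N}. S y) = (\<Sum>y\<in>{0..<N}. (S y ^ (2 * s)) powr \<theta>)"
    proof (intro sum.cong refl)
      fix y
      have "S y \<ge> 0" by (simp add: S_def)
      then show "S y = (S y ^ (2 * s)) powr \<theta>"
        using s1 rpow_of_nat[of "S y" "2 * s"] rpow_powr[of "S y" "real (2 * s)" \<theta>] th01 rpow_of_nat[of "S y" 1]
        by (simp add: th)
    qed
    also have "\<dots> \<le> real (card {0..<N}) powr (1 - \<theta>) * (\<Sum>y\<in>{0..<N}. S y ^ (2 * s)) powr \<theta>"
      using th01 by (intro sum_powr_le) (auto simp: S_def)
    also have "real (card {0..<N}) = n" using N by (simp add: n_def)
    also have "n powr (1 - \<theta>) * (\<Sum>y\<in>{0..<N}. S y ^ (2 * s)) powr \<theta> \<le>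
        n powr (1 - \<theta>) * (C * Lg * n powr \<epsilon> * \<Psi> * n powr (2 * real s + 1)) powr \<theta>"
      using tot th01 by (intro mult_left_mono powr_mono2 sum_nonneg) (auto simp: S_def)
    also have "\<dots> = (C * Lg * n powr \<epsilon> * \<Psi>) powr \<theta> * (n powr (1 - \<theta>) * n powr ((2 * real s + 1) * \<theta>))"
      using Lg \<Psi>0 by (subst powr_mult) (auto simp: powr_powr C_def)
    also have "n powr (1 - \<theta>) * n powr ((2 * real s + 1) * \<theta>) = n powr 2"
    proof -
      have "2 * real s * \<theta> = 1" using s1 by (simp add: th)
      then have eq: "1 - \<theta> + (2 * real s + 1) * \<theta> = 2" by (simp add: algebra_simps)
      show ?thesis unfolding powr_add[symmetric] eq ..
    qed
    also have "n powr 2 = n ^ 2" using n by (simp add: powr_numeral)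
    finally show ?thesis unfolding weyl_double_def phase S_def \<Psi>_def Lg_def X_def h_def n_def by (simp add: mult.commute)
  qed
  then show ?thesis by (intro exI[of _ C]) (auto simp: C_def)
qed

section \<open>Choice of the cut and conclusion\<close>

lemma powr_le_inverse_exponent:
  fixes x \<Delta> :: real
  assumes "x > 0" "u > 0" "x powr u \<le> \<Delta>" "u * w = 1"
  shows "x \<le> \<Delta> powr w"
proof -
  have w: "w > 0" using assms(2,4) by (metis zero_less_mult_pos zero_less_one)
  have "x = (x powr u) powr w" using assms by (simp add: powr_powr)
  also have "\<dots> \<le> \<Delta> powr w" using assms w by (intro powr_mono2) auto
  finally show ?thesis .
qed

lemma norm_U_sum_trivial: "norm (U_sum f r l k m) \<le> 2 ^ r"
proof -
  have "norm (U_sum f r l k m) \<le> (\<Sum>n\<in>E_set k m r. 1)"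
    unfolding U_sum_def by (rule order_trans[OF norm_sum]) simp
  also have "\<dots> \<le> real (card {..<2 ^ r :: nat})"
    using card_mono[of "{..<2 ^ r :: nat}" "E_set k m r"] by (auto simp: E_set_def)
  also have "\<dots> = 2 ^ r" by simp
  finally show ?thesis .
qed

text \<open>The Cauchy-Schwarz inequality over the digit classes and over \<open>u\<close>. Relative
  to the trivial bound \<open>4^r\<close>, the diagonal pairs contribute \<open>2/2^t\<close> and
  the others \<open>T0\<close>.\<close>

lemma U_sum_square_le:
  fixes f :: "real poly" and T0 :: real
  assumes "t \<le> r" "m \<ge> 1" "T0 \<ge> 0" and deg: "degree f = d"
    and T: "\<And>v w. v \<in> {0..<2 ^ t} \<Longrightarrow> w \<in> {0..<2 ^ t} \<Longrightarrow> v \<noteq> w \<Longrightarrow>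
     weyl_double (2 ^ (r - t)) (\<lambda>z. real l * (\<Sum>i\<le>d. coeff f i * of_int (v + 2 ^ t * z) ^ i) -
       real l * (\<Sum>i\<le>d. coeff f i * of_int (w + 2 ^ t * z) ^ i)) \<le> (2 ^ (r - t)) ^ 2 * T0"
  shows "norm (U_sum f r l k m) ^ 2 \<le> real m ^ 2 * 4 ^ r * (2 / 2 ^ t + T0)"
proof -
  define N where "N = (2 ^ (r - t) :: int)"
  define V where "V = (\<lambda>j u. norm (\<Sum>v\<in>digit_class t m j. e (real l * poly f (of_int (v + 2 ^ t * u)))))"
  have N1: "N \<ge> 1" by (simp add: N_def)
  have fin: "finite (digit_class t m j)" for j using digit_class_subset by (rule finite_subset) simp
  have cd: "real (card (digit_class t m j)) \<le> 2 ^ t" for j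
  proof -
    have "card (digit_class t m j) \<le> card {0..<2 ^ t :: int}" using digit_class_subset by (intro card_mono) auto
    then show ?thesis by (simp add: nat_power_eq)
  qed
  have each: "of_int N * (\<Sum>u\<in>{0..<N}. V j u ^ 2) \<le> 4 ^ r * (2 / 2 ^ t + T0)" for j
  proof -
    have "of_int N * (\<Sum>u\<in>{0..<N}. V j u ^ 2) \<le> 2 ^ t * (2 * of_int N ^ 2) + (2 ^ t) ^ 2 * (of_int N ^ 2 * T0)"
      unfolding V_def
    proof (rule differencing[OF fin cd N1])
      show "of_int N ^ 2 * T0 \<ge> 0" using assms(3) by simp
      fix v w assume "v \<in> digit_class t m j" "w \<in> digit_class t m j" "v \<noteq> w"
      then have vw: "v \<in> {0..<2 ^ t}" "w \<in> {0..<2 ^ t}" "v \<noteq> w" using digit_class_subset by blast+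
      show "weyl_double N (\<lambda>z. real l * poly f (of_int (v + 2 ^ t * z)) - real l * poly f (of_int (w + 2 ^ t * z))) \<le> of_int N ^ 2 * T0"
        using T[OF vw] unfolding poly_altdef deg N_def by simp
    qed
    also have "\<dots> = (2 ^ t * of_int N) ^ 2 * (2 / 2 ^ t + T0)"
      by (simp add: power_mult_distrib power2_eq_square field_simps)
    also have "(2 ^ t * of_int N :: real) = 2 ^ r" using assms(1) by (simp add: N_def power_add[symmetric])
    also have "((2::real) ^ r) ^ 2 = 4 ^ r" by (simp add: power2_eq_square flip: power_mult_distrib)
    finally show ?thesis .
  qed
  have "norm (U_sum f r l k m) \<le> (\<Sum>j<m. \<Sum>u\<in>{0..<N}. V j u)"
    unfolding V_def N_def by (rule norm_U_sum_le[OF assms(1,2)])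
  then have "norm (U_sum f r l k m) ^ 2 \<le> (\<Sum>j<m. \<Sum>u\<in>{0..<N}. V j u) ^ 2" by (intro power_mono) auto
  also have "\<dots> \<le> real m ^ 2 * (4 ^ r * (2 / 2 ^ t + T0))"
  proof -
    have "(\<Sum>j<m. \<Sum>u\<in>{0..<N}. V j u) ^ 2 \<le> real (card {..<m}) ^ 2 * (4 ^ r * (2 / 2 ^ t + T0))"
    proof -
      have "(\<Sum>j<m. \<Sum>u\<in>{0..<N}. V j u) ^ 2 \<le> real (card {..<m}) * (\<Sum>j<m. (\<Sum>u\<in>{0..<N}. V j u) ^ 2)"
        using Cauchy_Schwarz_ineq_sum[of "\<lambda>_. 1" "\<lambda>j. \<Sum>u\<in>{0..<N}. V j u" "{..<m}"] by simp
      also have "\<dots> \<le> real (card {..<m}) * (\<Sum>j<m. 4 ^ r * (2 / 2 ^ t + T0))"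
      proof (intro mult_left_mono sum_mono)
        fix j
        have "(\<Sum>u\<in>{0..<N}. V j u) ^ 2 \<le> of_int N * (\<Sum>u\<in>{0..<N}. V j u ^ 2)"
          using Cauchy_Schwarz_ineq_sum[of "\<lambda>_. 1" "V j" "{0..<N}"] N1 by simp
        then show "(\<Sum>u\<in>{0..<N}. V j u) ^ 2 \<le> 4 ^ r * (2 / 2 ^ t + T0)" using each[of j] by linarith
      qed auto
      finally show ?thesis by (simp add: power2_eq_square)
    qed
    then show ?thesis by simp
  qed
  finally show ?thesis by (simp add: mult.assoc)
qed

lemma poly_times_powr_eventually_le:
  fixes \<epsilon> K :: real
  assumes "\<epsilon> > 0" "K > 0"
  shows "\<exists>r0::nat. \<forall>r\<ge>r0. K * (real r + 1) \<le> 2 powr (\<epsilon> * real r)"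
proof -
  define x where "x = 2 powr (- \<epsilon>)"
  have x: "0 < x" "x < 1" using assms(1) by (auto simp: x_def powr_less_one)
  have "(\<lambda>n. real n * x ^ n) \<longlonglongrightarrow> 0" using powser_times_n_limit_0[of x] x by simp
  moreover have "(\<lambda>n. x ^ n) \<longlonglongrightarrow> 0" using x by (intro LIMSEQ_realpow_zero) auto
  ultimately have "(\<lambda>n. K * (real n * x ^ n + x ^ n)) \<longlonglongrightarrow> K * (0 + 0)"
    by (intro tendsto_mult tendsto_const tendsto_add)
  then have "\<forall>\<^sub>F n in sequentially. K * (real n * x ^ n + x ^ n) < 1"
    by (rule order_tendstoD) simp
  then obtain r0 where r0: "\<And>r. r \<ge> r0 \<Longrightarrow> K * (real r * x ^ r + x ^ r) < 1"
    unfolding eventually_sequentially by blast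
  have "K * (real r + 1) \<le> 2 powr (\<epsilon> * real r)" if "r \<ge> r0" for r
  proof -
    have "x ^ r = 1 / 2 powr (\<epsilon> * real r)"
      unfolding x_def by (simp add: powr_realpow[symmetric] powr_powr powr_minus field_simps)
    then have "K * (real r + 1) / 2 powr (\<epsilon> * real r) < 1" using r0[OF that] by (simp add: algebra_simps add_divide_distrib)
    then show ?thesis by (simp add: divide_less_eq)
  qed
  then show ?thesis by blast
qed

text \<open>\<open>Delta\<close> is the quantity in parentheses in the theorem and \<open>H\<close> has size about \<open>1 / Delta\<close>; each term of
  \<open>Delta\<close> balances one of the Weyl terms.\<close>

lemma balance_terms:
  fixes H :: real and q :: real and l :: nat
  assumes d: "d \<ge> 3" and \<Delta>: "\<Delta> > 0" and q: "q \<ge> 1" and l: "l \<ge> 1" and H: "0 < H" "H \<le> 2 / \<Delta>" and N: "N = 2 powr real r / H"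
    and D: "real l powr eta1 d * q powr (- eta1 d) \<le> \<Delta>" "real l powr vartheta d * 2 powr (- zeta1 d * real r) \<le> \<Delta>"
      "2 powr (- zeta2 d * real r) \<le> \<Delta>" "2 powr (- zeta3 d * real r) * q powr eta2 d \<le> \<Delta>"
  shows "weyl_terms d l H q N \<le> 4 ^ (d + 1) * \<Delta> powr ((real d - 1) * (real d - 2))"
proof -
  define y where "y = (real d - 1) * (real d - 2)"
  define z where "z = 2 powr real r"
  have z: "z > 0" by (simp add: z_def)
  have dr: "real d \<ge> 3" using d by simp
  have lr: "real l > 0" using l by simp
  have q0: "q > 0" using q by simp
  have Hpow: "H ^ n \<le> 2 ^ n * \<Delta> powr (- real n)" for n
  proof -
    have "H ^ n \<le> (2 / \<Delta>) ^ n" using H by (intro power_mono) auto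
    also have "\<dots> = 2 ^ n * \<Delta> powr (- real n)" using \<Delta> by (simp add: power_divide powr_minus powr_realpow divide_inverse power_inverse)
    finally show ?thesis .
  qed
  \<comment> \<open>All four terms have this shape. The pairs of \<open>w\<close> and
    \<open>n\<close> are d^2-2d+2 and d, d^2-3d+3 and 1, d(d-1) and 2d-2, (d-1)^2 and d-1; each time
    \<open>w - n\<close> is (d-1)(d-2).\<close>
  have gen: "u * H ^ n \<le> 4 ^ d * \<Delta> powr y" if "u \<ge> 0" "u \<le> \<Delta> powr w" "w - real n = y" "n \<le> 2 * d" for u w n
  proof -
    have "u * H ^ n \<le> \<Delta> powr w * (2 ^ n * \<Delta> powr (- real n))" using that Hpow[of n] H by (intro mult_mono) auto
    also have "\<dots> = 2 ^ n * \<Delta> powr (w + - real n)" unfolding powr_add by simp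
    also have "w + - real n = y" using that(3) by simp
    also have "2 ^ n * \<Delta> powr y \<le> 2 ^ (2 * d) * \<Delta> powr y" using that(4) by (intro mult_right_mono power_increasing) auto
    also have "(2::real) ^ (2 * d) = 4 ^ d" by (simp add: power_mult)
    finally show ?thesis .
  qed
  have e1: "real l * H ^ d / q \<le> 4 ^ d * \<Delta> powr y"
  proof -
    have pos: "(real d)\<^sup>2 - 2 * real d + 2 > 0"
    proof -
      have "(real d)\<^sup>2 - 2 * real d + 2 = (real d - 1)\<^sup>2 + 1" by (simp add: power2_eq_square algebra_simps)
      moreover have "(real d - 1)\<^sup>2 \<ge> 0" by simp
      ultimately show ?thesis by linarith
    qed
    have "real l / q \<le> \<Delta> powr ((real d)\<^sup>2 - 2 * real d + 2)"
    proof (rule powr_le_inverse_exponent)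
      have "(real l / q) powr eta1 d = real l powr eta1 d * q powr (- eta1 d)"
        using lr q0 by (simp add: powr_divide powr_minus_divide)
      then show "(real l / q) powr eta1 d \<le> \<Delta>" using D(1) by simp
    qed (use lr q0 pos in \<open>auto simp: eta1_def\<close>)
    then have "real l / q * H ^ d \<le> 4 ^ d * \<Delta> powr y"
      using lr q0 by (rule_tac gen) (auto simp: y_def power2_eq_square algebra_simps)
    then show ?thesis by simp
  qed
  have e2: "1 / N \<le> 4 ^ d * \<Delta> powr y"
  proof -
    have pos: "(real d)\<^sup>2 - 3 * real d + 3 > 0"
    proof -
      have "(real d)\<^sup>2 - 3 * real d + 3 = real d * (real d - 3) + 3" by (simp add: power2_eq_square algebra_simps)
      moreover have "real d * (real d - 3) \<ge> 0" using dr by (intro mult_nonneg_nonneg) auto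
      ultimately show ?thesis by linarith
    qed
    have "1 / z \<le> \<Delta> powr ((real d)\<^sup>2 - 3 * real d + 3)"
    proof (rule powr_le_inverse_exponent)
      have "1 / z = 2 powr (- real r)" by (simp add: z_def powr_minus divide_inverse)
      then show "(1 / z) powr zeta2 d \<le> \<Delta>" using D(3) by (simp add: powr_powr mult.commute)
    qed (use z pos in \<open>auto simp: zeta2_def\<close>)
    then have "1 / z * H ^ 1 \<le> 4 ^ d * \<Delta> powr y"
      using z d by (rule_tac gen) (auto simp: y_def power2_eq_square algebra_simps)
    then show ?thesis by (simp add: N z_def)
  qed
  have e3: "real l * H ^ d / N ^ (d - 2) \<le> 4 ^ d * \<Delta> powr y"
  proof -
    have "real l / z ^ (d - 2) \<le> \<Delta> powr (real d * (real d - 1))"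
    proof (rule powr_le_inverse_exponent)
      have "zeta1 d = (real d - 2) * vartheta d" by (simp add: zeta1_def vartheta_def)
      moreover have "real (d - 2) = real d - 2" using d by (simp add: of_nat_diff)
      moreover have "1 / z ^ (d - 2) = 2 powr (- (real r * real (d - 2)))"
        unfolding z_def by (simp add: powr_realpow[symmetric] powr_powr powr_minus_divide)
      ultimately have "(1 / z ^ (d - 2)) powr vartheta d = 2 powr (- zeta1 d * real r)"
        by (simp add: powr_powr mult_ac)
      then show "(real l / z ^ (d - 2)) powr vartheta d \<le> \<Delta>"
        using D(2) lr z powr_mult[of "real l" "1 / z ^ (d - 2)" "vartheta d"] by simp
    qed (use lr z dr in \<open>auto simp: vartheta_def\<close>)
    then have "real l / z ^ (d - 2) * H ^ (d + (d - 2)) \<le> 4 ^ d * \<Delta> powr y"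
      using lr z d by (rule_tac gen) (auto simp: y_def of_nat_diff algebra_simps)
    moreover have "real l * H ^ d / N ^ (d - 2) = real l / z ^ (d - 2) * H ^ (d + (d - 2))"
      using H z by (simp add: N z_def[symmetric] power_divide power_add)
    ultimately show ?thesis by simp
  qed
  have e4: "q / N ^ (d - 1) \<le> 4 ^ d * \<Delta> powr y"
  proof -
    have "q / z ^ (d - 1) \<le> \<Delta> powr ((real d - 1)\<^sup>2)"
    proof (rule powr_le_inverse_exponent)
      have "zeta3 d = (real d - 1) * eta2 d" using dr by (simp add: zeta3_def eta2_def power2_eq_square)
      moreover have "real (d - 1) = real d - 1" using d by (simp add: of_nat_diff)
      moreover have "1 / z ^ (d - 1) = 2 powr (- (real r * real (d - 1)))"
        unfolding z_def by (simp add: powr_realpow[symmetric] powr_powr powr_minus_divide)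
      ultimately have "(1 / z ^ (d - 1)) powr eta2 d = 2 powr (- zeta3 d * real r)"
        by (simp add: powr_powr mult_ac)
      then show "(q / z ^ (d - 1)) powr eta2 d \<le> \<Delta>"
        using D(4) q0 z powr_mult[of q "1 / z ^ (d - 1)" "eta2 d"] by (simp add: mult.commute)
    qed (use q0 z dr in \<open>auto simp: eta2_def\<close>)
    then have "q / z ^ (d - 1) * H ^ (d - 1) \<le> 4 ^ d * \<Delta> powr y"
      using q0 z d by (rule_tac gen) (auto simp: y_def of_nat_diff power2_eq_square algebra_simps)
    moreover have "q / N ^ (d - 1) = q / z ^ (d - 1) * H ^ (d - 1)"
      using H z by (simp add: N z_def[symmetric] power_divide)
    ultimately show ?thesis by simp
  qed
  have "weyl_terms d l H q N \<le> 4 * (4 ^ d * \<Delta> powr y)"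
    unfolding weyl_terms_def using e1 e2 e3 e4 by linarith
  then show ?thesis by (simp add: y_def)
qed

theorem theorem2p1:
  fixes d m :: nat and \<epsilon> :: real
  assumes "d \<ge> 3" and "m \<ge> 1" and "\<epsilon> > 0"
  shows "\<exists>r0::nat. \<forall>r\<ge>r0. \<forall>(f::real poly) (a::int) (q::int) (l::nat) (k::nat).
    degree f = d \<longrightarrow> coeff f 0 = 0 \<longrightarrow>
    q \<ge> 1 \<longrightarrow> gcd a q = 1 \<longrightarrow>
    \<bar>coeff f d - real_of_int a / real_of_int q\<bar> < 1 / (real_of_int q)\<^sup>2 \<longrightarrow>
    l \<ge> 1 \<longrightarrow> k < m \<longrightarrow>
    norm (U_sum f r l k m) \<le>
      2 powr ((1 + \<epsilon>) * real r) *
      (real l powr eta1 d * real_of_int q powr (- eta1 d)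
       + real l powr vartheta d * 2 powr (- zeta1 d * real r)
       + 2 powr (- zeta2 d * real r)
       + 2 powr (- zeta3 d * real r) * real_of_int q powr eta2 d) powr (1 / 2)"
proof -
  define \<theta> where "\<theta> = 1 / ((real d - 1) * (real d - 2))"
  obtain C where C: "C \<ge> 1" and weyl: "\<forall>(b :: nat \<Rightarrow> real) (a :: int) (q :: int) (l :: nat) (N :: int) (H :: int) v w.
    q \<ge> 1 \<longrightarrow> gcd a q = 1 \<longrightarrow> \<bar>b d - of_int a / of_int q\<bar> < 1 / (of_int q)\<^sup>2 \<longrightarrow> l \<ge> 1 \<longrightarrow> N \<ge> 1 \<longrightarrow>
    v \<in> {0..<H} \<longrightarrow> w \<in> {0..<H} \<longrightarrow> v \<noteq> w \<longrightarrow>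
    weyl_double N (\<lambda>z. real l * (\<Sum>i\<le>d. b i * of_int (v + H * z) ^ i) - real l * (\<Sum>i\<le>d. b i * of_int (w + H * z) ^ i))
      \<le> of_int N ^ 2 * (C * (1 + ln (of_int q)) * of_int N powr \<epsilon> * weyl_terms d l H q N) powr \<theta>"
    using weyl_difference_bound[OF assms(1,3) \<theta>_def] by (elim exE conjE) (rule that)
  \<comment> \<open>The factor \<open>m^2\<close> stems from the digit classes, the 2 from the
    diagonal, and the rest from the Weyl bound, with \<open>real d\<close> for the logarithm of
    \<open>q\<close>.\<close>
  define K where "K = real m ^ 2 * (2 + C * real d * 4 ^ (d + 1))"
  have K: "K > 0" unfolding K_def using assms C by (intro mult_pos_pos add_pos_nonneg) auto
  obtain r1 where r1: "\<And>r. r \<ge> r1 \<Longrightarrow> K * (real r + 1) \<le> 2 powr (\<epsilon> * real r)"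
    using poly_times_powr_eventually_le[OF assms(3) K] by blast
  have dr: "real d \<ge> 3" using assms(1) by simp
  have y0: "(real d - 1) * (real d - 2) \<ge> 2" using dr mult_mono[of 2 "real d - 1" 1 "real d - 2"] by simp
  then have \<theta>: "0 < \<theta>" "\<theta> \<le> 1" by (auto simp: \<theta>_def)
  have main: "norm (U_sum f r l k m) \<le> 2 powr ((1 + \<epsilon>) * real r) *
      (real l powr eta1 d * real_of_int q powr (- eta1 d)
       + real l powr vartheta d * 2 powr (- zeta1 d * real r)
       + 2 powr (- zeta2 d * real r)
       + 2 powr (- zeta3 d * real r) * real_of_int q powr eta2 d) powr (1 / 2)"
    if r: "r \<ge> max r1 2" and f: "degree f = d" and q: "q \<ge> 1" "gcd a q = 1"
      "\<bar>coeff f d - real_of_int a / real_of_int q\<bar> < 1 / (real_of_int q)\<^sup>2" and l: "l \<ge> 1"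
    for r l k :: nat and f :: "real poly" and a q :: int
  proof -
    define X where "X = real_of_int q"
    define D1 D2 D3 D4 where "D1 = real l powr eta1 d * X powr (- eta1 d)"
      and "D2 = real l powr vartheta d * 2 powr (- zeta1 d * real r)"
      and "D3 = 2 powr (- zeta2 d * real r)" and "D4 = 2 powr (- zeta3 d * real r) * X powr eta2 d"
    define \<Delta> where "\<Delta> = D1 + D2 + D3 + D4"
    have X: "X \<ge> 1" using q by (simp add: X_def)
    have l1: "real l \<ge> 1" using l by simp
    have Dpos: "D1 > 0" "D2 > 0" "D3 > 0" "D4 > 0"
      using X l1 by (auto simp: D1_def D2_def D3_def D4_def)
    have \<Delta>0: "\<Delta> > 0" using Dpos by (simp add: \<Delta>_def)
    have Dle: "D1 \<le> \<Delta>" "D2 \<le> \<Delta>" "D3 \<le> \<Delta>" "D4 \<le> \<Delta>" using Dpos by (auto simp: \<Delta>_def)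
    \<comment> \<open>For \<open>\<Delta> >= 1\<close> the trivial bound is enough. The opposite
      case also limits the size of \<open>q\<close>, through the last term of
      \<open>\<Delta>\<close>.\<close>
    have "norm (U_sum f r l k m) \<le> 2 powr ((1 + \<epsilon>) * real r) * \<Delta> powr (1 / 2)"
    proof (cases "\<Delta> \<ge> 1")
      case True
      have "norm (U_sum f r l k m) \<le> 2 powr real r" using norm_U_sum_trivial[of f r l k m] by (simp add: powr_realpow)
      also have "\<dots> \<le> 2 powr ((1 + \<epsilon>) * real r)" using assms(3) by (intro powr_mono) (auto simp: distrib_right)
      also have "\<dots> * 1 \<le> 2 powr ((1 + \<epsilon>) * real r) * \<Delta> powr (1 / 2)"
        using True by (intro mult_left_mono ge_one_powr_ge_zero) auto
      finally show ?thesis by simp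
    next
      case False
      define L where "L = log 2 (1 / \<Delta>)"
      have L0: "L > 0" unfolding L_def using False \<Delta>0 by simp
      have L2: "2 powr L = 1 / \<Delta>" unfolding L_def using \<Delta>0 by simp
      \<comment> \<open>This makes \<open>2^t\<close> the least power of 2 that is at least
        \<open>1/\<Delta>\<close>.\<close>
      define t where "t = nat \<lceil>L\<rceil>"
      have t: "L \<le> real t" "real t < L + 1" using L0 by (auto simp: t_def) linarith+
      \<comment> \<open>The third term bounds \<open>1/\<Delta>\<close> by
        \<open>2^(zeta2 d * r)\<close> with \<open>zeta2 d <= 1/2\<close>; rounding up costs less
        than 1, which \<open>r >= 2\<close> leaves room for.\<close>
      have tr: "t \<le> r"
      proof -
        have "2 powr L \<le> 2 powr (zeta2 d * real r)"
        proof -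
          have "1 / \<Delta> \<le> 1 / D3" using Dle(3) Dpos(3) by (intro divide_left_mono) (auto intro: mult_pos_pos \<Delta>0)
          also have "1 / D3 = 2 powr (zeta2 d * real r)" by (simp add: D3_def powr_minus_divide)
          finally show ?thesis unfolding L2 .
        qed
        then have "L \<le> zeta2 d * real r" by simp
        also have "\<dots> \<le> 1 / 2 * real r"
        proof (rule mult_right_mono)
          have "(real d)\<^sup>2 - 3 * real d + 3 = real d * (real d - 3) + 3" by (simp add: power2_eq_square algebra_simps)
          moreover have "real d * (real d - 3) \<ge> 0" using dr by (intro mult_nonneg_nonneg) auto
          ultimately have "(real d)\<^sup>2 - 3 * real d + 3 \<ge> 2" by linarith
          then show "zeta2 d \<le> 1 / 2" unfolding zeta2_def by (intro divide_left_mono) auto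
        qed simp
        finally have "real t < real r / 2 + 1" using t by linarith
        moreover have "real r \<ge> 2" using r by simp
        ultimately show ?thesis by linarith
      qed
      define h where "h = (2 ^ t :: real)"
      have h1: "1 / \<Delta> \<le> h"
      proof -
        have "2 powr L \<le> 2 powr real t" using t by (intro powr_mono) auto
        then show ?thesis by (simp add: L2 h_def powr_realpow)
      qed
      have h2: "h \<le> 2 / \<Delta>"
      proof -
        have "2 powr real t \<le> 2 powr (L + 1)" using t by (intro powr_mono) auto
        then show ?thesis using L2 by (simp add: powr_add h_def powr_realpow)
      qed
      define n where "n = (2 ^ (r - t) :: real)"
      have nh: "n = 2 powr real r / h" using tr by (simp add: n_def h_def powr_realpow power_diff)
      have n1: "n \<ge> 1" by (simp add: n_def)
      define \<Psi> where "\<Psi> = weyl_terms d l h X n"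
      have \<Psi>: "\<Psi> \<le> 4 ^ (d + 1) * \<Delta> powr ((real d - 1) * (real d - 2))"
        unfolding \<Psi>_def
        by (rule balance_terms[OF assms(1) \<Delta>0 X l _ h2 nh]) (use Dle in \<open>auto simp: D1_def D2_def D3_def D4_def h_def\<close>)
      have \<Psi>0: "\<Psi> \<ge> 0" unfolding \<Psi>_def weyl_terms_def using X n1 l1 by (intro add_nonneg_nonneg divide_nonneg_nonneg mult_nonneg_nonneg) (auto simp: h_def)
      \<comment> \<open>Since \<open>D4 < 1\<close>, \<open>q\<close> is below
        \<open>2^((d-1)*r)\<close>, so its logarithm is linear in \<open>r\<close>.\<close>
      have lnX: "1 + ln X \<le> real d * (real r + 1)"
      proof -
        have "D4 < 1" using Dle False by linarith
        have z3: "zeta3 d = (real d - 1) * eta2 d" using dr by (simp add: zeta3_def eta2_def power2_eq_square)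
        have e2: "eta2 d > 0" using dr by (simp add: eta2_def)
        have "ln D4 < 0" using \<open>D4 < 1\<close> Dpos by simp
        moreover have "ln D4 = - zeta3 d * real r * ln 2 + eta2 d * ln X"
          unfolding D4_def using X by (simp add: ln_mult ln_powr)
        ultimately have "eta2 d * ln X < eta2 d * ((real d - 1) * real r * ln 2)" by (simp add: z3 algebra_simps)
        then have "ln X < (real d - 1) * real r * ln 2" using e2 by simp
        also have "\<dots> \<le> (real d - 1) * real r * 1" using dr ln_2_less_1 by (intro mult_left_mono) auto
        finally have "1 + ln X \<le> 1 + (real d - 1) * real r" by simp
        also have "\<dots> \<le> real d * (real r + 1)" using dr by (simp add: algebra_simps)
        finally show ?thesis .
      qed
      have lnX0: "1 + ln X \<ge> 1" using X by simp
      define T0 where "T0 = (C * (1 + ln X) * n powr \<epsilon> * \<Psi>) powr \<theta>"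
      have T0: "T0 \<le> C * real d * 4 ^ (d + 1) * (real r + 1) * 2 powr (\<epsilon> * real r) * \<Delta>"
      proof -
        define W where "W = C * (1 + ln X) * n powr \<epsilon> * 4 ^ (d + 1)"
        have ne: "1 \<le> n powr \<epsilon>" using n1 assms(3) by (intro ge_one_powr_ge_zero) auto
        have W1: "W \<ge> 1"
        proof -
          have "(1::real) \<le> 4 ^ (d + 1)" by (rule one_le_power) simp
          then have "1 * 1 * 1 * 1 \<le> W" unfolding W_def using C lnX0 ne by (intro mult_mono) auto
          then show ?thesis by simp
        qed
        have "T0 \<le> (C * (1 + ln X) * n powr \<epsilon> * (4 ^ (d + 1) * \<Delta> powr ((real d - 1) * (real d - 2)))) powr \<theta>"
          unfolding T0_def using \<theta> \<Psi> \<Psi>0 C lnX0 by (intro powr_mono2 mult_left_mono mult_nonneg_nonneg) auto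
        also have "\<dots> = (W * \<Delta> powr ((real d - 1) * (real d - 2))) powr \<theta>" by (simp add: W_def mult.assoc)
        also have "\<dots> = W powr \<theta> * \<Delta>"
        proof -
          have "(real d - 1) * (real d - 2) * \<theta> = 1" using dr by (simp add: \<theta>_def)
          then show ?thesis using W1 \<Delta>0 by (simp add: powr_mult powr_powr)
        qed
        also have "\<dots> \<le> W * \<Delta>"
          using powr_mono[of \<theta> 1 W] W1 \<theta> \<Delta>0 by (intro mult_right_mono) auto
        also have "\<dots> \<le> (C * (real d * (real r + 1)) * 2 powr (\<epsilon> * real r) * 4 ^ (d + 1)) * \<Delta>"
        proof -
          have "n \<le> 2 powr real r" by (simp add: n_def powr_realpow[symmetric])
          then have "n powr \<epsilon> \<le> (2 powr real r) powr \<epsilon>" using n1 assms(3) by (intro powr_mono2) auto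
          then have "n powr \<epsilon> \<le> 2 powr (\<epsilon> * real r)" by (simp add: powr_powr mult.commute)
          then show ?thesis unfolding W_def using C lnX lnX0 \<Delta>0 by (intro mult_right_mono mult_mono) auto
        qed
        finally show ?thesis by (simp add: mult_ac)
      qed
      have T00: "T0 \<ge> 0" by (simp add: T0_def)
      have "norm (U_sum f r l k m) ^ 2 \<le> real m ^ 2 * 4 ^ r * (2 / 2 ^ t + T0)"
      proof (rule U_sum_square_le[OF tr assms(2) T00 f])
        fix v w :: int assume vw: "v \<in> {0..<2 ^ t}" "w \<in> {0..<2 ^ t}" "v \<noteq> w"
        show "weyl_double (2 ^ (r - t)) (\<lambda>z. real l * (\<Sum>i\<le>d. coeff f i * of_int (v + 2 ^ t * z) ^ i) -
           real l * (\<Sum>i\<le>d. coeff f i * of_int (w + 2 ^ t * z) ^ i)) \<le> (2 ^ (r - t)) ^ 2 * T0"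
          using weyl[rule_format, where b = "coeff f", OF q l _ vw, of "2 ^ (r - t)"] unfolding T0_def \<Psi>_def X_def h_def n_def by simp
      qed
      also have "\<dots> \<le> real m ^ 2 * 4 ^ r * (K / real m ^ 2 * (real r + 1) * 2 powr (\<epsilon> * real r) * \<Delta>)"
      proof (rule mult_left_mono)
        have "2 / 2 ^ t \<le> 2 * \<Delta>" using h1 \<Delta>0 by (simp add: h_def field_simps)
        also have "\<dots> \<le> 2 * (real r + 1) * 2 powr (\<epsilon> * real r) * \<Delta>"
        proof -
          have "1 * 1 \<le> (real r + 1) * 2 powr (\<epsilon> * real r)"
            using assms(3) by (intro mult_mono ge_one_powr_ge_zero) auto
          then have "(1 * 1) * (2 * \<Delta>) \<le> ((real r + 1) * 2 powr (\<epsilon> * real r)) * (2 * \<Delta>)"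
            using \<Delta>0 by (intro mult_right_mono) auto
          then show ?thesis by (simp only: mult_ac mult_1_left)
        qed
        finally have "2 / 2 ^ t + T0 \<le> 2 * (real r + 1) * 2 powr (\<epsilon> * real r) * \<Delta> +
            C * real d * 4 ^ (d + 1) * (real r + 1) * 2 powr (\<epsilon> * real r) * \<Delta>"
          using T0 by linarith
        also have "\<dots> = (2 + C * real d * 4 ^ (d + 1)) * (real r + 1) * 2 powr (\<epsilon> * real r) * \<Delta>"
          by (simp only: distrib_right)
        also have "2 + C * real d * 4 ^ (d + 1) = K / real m ^ 2" using assms(2) by (simp add: K_def)
        finally show "2 / 2 ^ t + T0 \<le> K / real m ^ 2 * (real r + 1) * 2 powr (\<epsilon> * real r) * \<Delta>" .
      qed simp
      also have "\<dots> = 4 ^ r * \<Delta> * 2 powr (\<epsilon> * real r) * (K * (real r + 1))" using assms(2) by simp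
      \<comment> \<open>Of the two factors \<open>2^(\<epsilon>*r)\<close> that the square of the
        claim allows, one is taken by the loss in the mean value theorem and the other absorbs
        \<open>K * (r+1)\<close>.\<close>
      also have "\<dots> \<le> 4 ^ r * \<Delta> * 2 powr (\<epsilon> * real r) * 2 powr (\<epsilon> * real r)"
        using r1[of r] r \<Delta>0 by (intro mult_left_mono) auto
      also have "\<dots> = (2 powr ((1 + \<epsilon>) * real r) * \<Delta> powr (1 / 2)) ^ 2"
      proof -
        have "(4::real) ^ r = 2 powr real r * 2 powr real r" by (simp add: powr_realpow power_mult_distrib[symmetric])
        moreover have "2 powr ((1 + \<epsilon>) * real r) = 2 powr real r * 2 powr (\<epsilon> * real r)" by (simp add: powr_add[symmetric] distrib_right)
        moreover have "\<Delta> powr (1 / 2) * \<Delta> powr (1 / 2) = \<Delta>" using \<Delta>0 by (simp add: powr_add[symmetric])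
        ultimately show ?thesis by (simp add: power2_eq_square mult_ac)
      qed
      finally show ?thesis by (rule power2_le_imp_le) simp
    qed
    then show ?thesis by (simp add: \<Delta>_def D1_def D2_def D3_def D4_def X_def)
  qed
  show ?thesis
    by (intro exI[of _ "max r1 2"] allI impI) (rule main; assumption)
qed

end
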